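(* Assume that $M=M(\pi,\lambda,\tau)$ is negatively KZ-hyperbolic and that $(\pi,\tau)$ is of dual Roth type. Let $\upsilon\in\mathbb R^\Sigma_0$ and let $\Upsilon\in H_1(M,\Sigma,\mathbb R)$ be a class with $\partial\Upsilon=\upsilon$ and of subpolynomial growth in the past (as defined in the context). For any $\alpha\in\mathcal A$, the functions $\Omega_\alpha^{(n)}(\Upsilon):[0,q_\alpha^{(0)}]\to\mathbb R$ converge as $n\to-\infty$ as distributions on Hölder functions, i.e. for any function $\psi$ on $[0,q_\alpha^{(0)}]$ which has mean zero and is Hölder continuous for some exponent $\eta\in(0,1)$, the sequence $$\int_0^{q_\alpha^{(0)}}\psi(x)\,\Omega_\alpha^{(n)}(\Upsilon)(x)\,dx$$ is convergent as $n\to-\infty$.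
   Context: Data. Let $\mathcal A$ be an alphabet with $d\ge2$ letters and $\pi=(\pi_t,\pi_b)$ an irreducible pair of bijections $\mathcal A\to\{1,\dots,d\}$ (irreducible: $\pi_t^{-1}(\{1,\dots,k\})\ne\pi_b^{-1}(\{1,\dots,k\})$ for $1\le k<d$). For $\lambda\in(0,\infty)^{\mathcal A}$ the interval exchange map $T_{\pi,\lambda}$ translates intervals $I_\alpha$ of length $\lambda_\alpha$, ordered from left to right by $\pi_t$, onto intervals $I_\alpha^b$ ordered by $\pi_b$. $\Omega_\pi$ is the antisymmetric matrix with $\Omega_{\alpha\beta}=1$ if $\pi_t(\alpha)<\pi_t(\beta),\pi_b(\alpha)>\pi_b(\beta)$, $-1$ if $\pi_t(\alpha)>\pi_t(\beta),\pi_b(\alpha)<\pi_b(\beta)$, $0$ otherwise; rank $2g$. Suspension vectors: $\tau\in\Theta_\pi$, i.e. $\sum_{\pi_t(\alpha)<k}\tau_\alpha>0$, $\sum_{\pi_b(\alpha)<k}\tau_\alpha<0$ for $1<k\le d$. $M=M(\pi,\lambda,\tau)$ is the translation surface of genus $g$ with marked set $\Sigma$ given by Veech's zippered rectangle construction, with rectangles $I_\alpha\times[0,q_\alpha]$, $q=-\Omega_\pi\tau$; $T_{\pi,\lambda}$ is the return map of the vertical flow to the horizontal base interval. Backward Rauzy--Veech algorithm. If $M$ has no horizontal saddle connection, define $(\pi^{(n)},\lambda^{(n)},\tau^{(n)})$, $n\le0$, from $(\pi,\lambda,\tau)$ at $n=0$: if $\sum_\alpha\tau^{(n)}_\alpha<0$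 (top type), let $\alpha_w$ be the letter with $\pi^{(n)}_t(\alpha_w)=d$ and $\alpha_\ell$ the letter with $\pi_b^{(n)}(\alpha_\ell)=\pi_b^{(n)}(\alpha_w)+1$; $\pi^{(n-1)}$ is obtained by moving $\alpha_\ell$ to the last place of the bottom row. If $\sum_\alpha\tau^{(n)}_\alpha>0$ (bottom type), do the same exchanging the roles of $t$ and $b$. In both cases the $\alpha_w$-entries of $\lambda^{(n-1)},\tau^{(n-1)}$ are those of index $n$ plus the $\alpha_\ell$-entries, the others being unchanged. $\alpha_w$ is the winner, $\alpha_\ell$ the loser of the arrow $\gamma_n:\pi^{(n-1)}\to\pi^{(n)}$, with matrix $B_{\gamma_n}=\mathrm{Id}+E_{\alpha_\ell\alpha_w}$; $B(m,n)=B_{\gamma_n}\cdots B_{\gamma_{m+1}}$ for $m\le n\le0$. The infinite path $\cdots\gamma_{-1}\star\gamma_0$ (backward rotation number) depends only on $(\pi,\tau)$. $T^{(n)}$ is the i.e.m. with data $(\pi^{(n)},\lambda^{(n)})$, on $I^{(n)}$ with exchanged intervals $I_\alpha^{(n)}$; $T^{(n)}$ is the first return map of $T^{(m)}$ to $I^{(n)}$ for $m\le n$. $q^{(n)}=-\Omega_{\pi^{(n)}}\tau^{(n)}$. Norm: $\|B\|=\sum_{\alpha,\beta}|B_{\alpha\beta}|$. Homology. All $M(\pi^{(n)},\lambda^{(n)},\tau^{(n)})$ are canonically identified with $M$. $\theta_\alpha^{(n)}\in H_1(M\setminus\Sigma,\mathbb Z)$ is the class of the loop made of the upward vertical segment of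 length $q_\alpha^{(n)}$ from $x\in I_\alpha^{(n)}$ to $T^{(n)}(x)$, followed by the horizontal segment in $I^{(n)}$ back to $x$; these form a basis. $(\zeta_\alpha^{(n)})$ is the basis of $H_1(M,\Sigma,\mathbb Z)$ dual to it for the intersection form: $i(\zeta_\alpha^{(n)},\theta_\beta^{(n)})=\delta_{\alpha\beta}$. For $\Upsilon\in H_1(M,\Sigma,\mathbb R)$ write $\Upsilon=\sum_\alpha\chi_\alpha^{(n)}\zeta_\alpha^{(n)}$, so $\chi^{(n)}_\alpha=i(\Upsilon,\theta^{(n)}_\alpha)$ and $\chi^{(n)}=B(m,n)\chi^{(m)}$. $\partial:H_1(M,\Sigma,\mathbb R)\to H_0(\Sigma,\mathbb R)\simeq\mathbb R^\Sigma$ is the boundary map, with image $\mathbb R_0^\Sigma$ (vectors with zero coordinate sum). Negative KZ-hyperbolicity. $\Gamma^u$ is the space of $\Upsilon$ for which there are $\sigma>0,C>0$ with $\|\chi^{(n)}\|\le C\|B(n,0)\|^{-\sigma}\|\chi^{(0)}\|$ for all $n<0$. $M$ is negatively KZ-hyperbolic if it has no horizontal connection and: (1) $\sum_{n<0}\|B(n,0)\|^{-\tau}<\infty$ for every $\tau>0$; (2) $\dim\Gamma^u=g$; (3) for every $\tau>0$ there is $C_\tau>0$ such that $\|\chi^{(n)}\|\le C_\tau\|B(n,0)\|^\tau\|\chi^{(m)}\|$ for all $\Upsilon\in\Gamma^u$ and $0\ge m\ge n$. Subpolynomial growth in the past: $\varlimsup_{n\to-\infty}\log(\|\chi^{(n)}\|/\|\chi^{(0)}\|)/\log\|B(n,0)\|=0$.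 Functions $\Omega_\alpha^{(n)}(\Upsilon)$, $n\le0$. Let $N=\sum_\beta B(n,0)_{\alpha\beta}$ (return time of $I_\alpha^{(0)}$ to $I^{(0)}$ under $T^{(n)}$) and let $\beta_j$ be the letter with $(T^{(n)})^j(I_\alpha^{(0)})\subset I_{\beta_j}^{(n)}$, $0\le j<N$. $\Omega_\alpha^{(n)}(\Upsilon):[0,q_\alpha^{(0)}]\to\mathbb R$ is the continuous piecewise affine function whose graph is the broken line with successive vertices $\big(\sum_{0\le i<j}q_{\beta_i}^{(n)},\ \sum_{0\le i<j}i(\Upsilon,\theta_{\beta_i}^{(n)})\big)$, $0\le j\le N$. Dual Roth type. A finite path is complete if every letter is the winner of at least one arrow; an infinite path is $\infty$-complete if it is a concatenation of infinitely many complete paths. Put $\hat n_0=0$ and, for $k\le0$, let $\hat n_{k-1}$ be the largest $n<\hat n_k$ such that $\gamma_{n+1}\star\cdots\star\gamma_{\hat n_k}$ is complete. $(\pi,\tau)$ is of dual Roth type if its backward rotation number is $\infty$-complete and: (a) for every $\varepsilon>0$ there is $C_0>0$ with $\|B(\hat n_{k-1},\hat n_k)\|\le C_0\|B(\hat n_k,0)\|^\varepsilon$ for all $k\le0$; (b) there are $\theta,C_1>0$ with $\|{}^tB_0(n,0)\|\le C_1\|{}^tB(n,0)\|^{1-\theta}$ for all $n\le0$, where ${}^tB_0(n,0)$ is the restriction of ${}^tB(n,0)$ to $\{v\in\mathbb R^{\mathcal A}:\sum_\alpha q_\alpha^{(0)}v_\alpha=0\}$. *)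

theory Defs
  imports "HOL-Analysis.Analysis"
begin

section \<open>Interval exchange data\<close>

text \<open>The alphabet is a finite type \<open>'a\<close>, so \<open>d = CARD('a)\<close>; a combinatorial datum is the pair
  \<open>(\<pi>\<^sub>t, \<pi>\<^sub>b)\<close>. Vectors indexed by the alphabet are elements of \<open>real ^ 'a\<close>.\<close>

type_synonym 'a rows = "('a \<Rightarrow> nat) \<times> ('a \<Rightarrow> nat)"

abbreviation top_row :: "'a rows \<Rightarrow> 'a \<Rightarrow> nat" where "top_row \<equiv> fst"
abbreviation bot_row :: "'a rows \<Rightarrow> 'a \<Rightarrow> nat" where "bot_row \<equiv> snd"

definition irreducible_rows :: "'a::finite rows \<Rightarrow> bool" where
  "irreducible_rows \<pi> \<longleftrightarrow>
     bij_betw (top_row \<pi>) UNIV {1..CARD('a)} \<and>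
     bij_betw (bot_row \<pi>) UNIV {1..CARD('a)} \<and>
     (\<forall>k. 1 \<le> k \<and> k < CARD('a) \<longrightarrow> top_row \<pi> -` {1..k} \<noteq> bot_row \<pi> -` {1..k})"

text \<open>Sum of \<open>v\<close> over the letters strictly preceding \<open>\<alpha>\<close> in the row \<open>r\<close>.\<close>

definition sum_before :: "('a::finite \<Rightarrow> nat) \<Rightarrow> real ^ 'a \<Rightarrow> 'a \<Rightarrow> real" where
  "sum_before r v \<alpha> = (\<Sum>\<beta> | r \<beta> < r \<alpha>. v $ \<beta>)"

definition entry_sum :: "real ^ 'a::finite \<Rightarrow> real" where
  "entry_sum v = (\<Sum>\<alpha>\<in>UNIV. v $ \<alpha>)"

definition exch_interval :: "'a::finite rows \<Rightarrow> real ^ 'a \<Rightarrow> 'a \<Rightarrow> real set" where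
  "exch_interval \<pi> l \<alpha> = {sum_before (top_row \<pi>) l \<alpha> ..< sum_before (top_row \<pi>) l \<alpha> + l $ \<alpha>}"

definition translation :: "'a::finite rows \<Rightarrow> real ^ 'a \<Rightarrow> 'a \<Rightarrow> real" where
  "translation \<pi> l \<alpha> = sum_before (bot_row \<pi>) l \<alpha> - sum_before (top_row \<pi>) l \<alpha>"

text \<open>The base interval is \<open>{0..<entry_sum l}\<close>; the value outside it is irrelevant.\<close>

definition iem :: "'a::finite rows \<Rightarrow> real ^ 'a \<Rightarrow> real \<Rightarrow> real" where
  "iem \<pi> l x = x + (\<Sum>\<alpha> | x \<in> exch_interval \<pi> l \<alpha>. translation \<pi> l \<alpha>)"

definition Omega_mat :: "'a::finite rows \<Rightarrow> real ^ 'a ^ 'a" where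
  "Omega_mat \<pi> = (\<chi> \<alpha> \<beta>.
     if top_row \<pi> \<alpha> < top_row \<pi> \<beta> \<and> bot_row \<pi> \<alpha> > bot_row \<pi> \<beta> then 1
     else if top_row \<pi> \<alpha> > top_row \<pi> \<beta> \<and> bot_row \<pi> \<alpha> < bot_row \<pi> \<beta> then - 1
     else 0)"

definition genus :: "'a::finite rows \<Rightarrow> nat" where
  "genus \<pi> = rank (Omega_mat \<pi>) div 2"

definition suspension_cone :: "'a::finite rows \<Rightarrow> (real ^ 'a) set" where
  "suspension_cone \<pi> = {\<tau>. \<forall>k. 1 < k \<and> k \<le> CARD('a) \<longrightarrow>
     (\<Sum>\<alpha> | top_row \<pi> \<alpha> < k. \<tau> $ \<alpha>) > 0 \<and> (\<Sum>\<alpha> | bot_row \<pi> \<alpha> < k. \<tau> $ \<alpha>) < 0}"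

definition heights :: "'a::finite rows \<Rightarrow> real ^ 'a \<Rightarrow> real ^ 'a" where
  "heights \<pi> \<tau> = - (Omega_mat \<pi> *v \<tau>)"


section \<open>The zippered rectangle surface\<close>

text \<open>A point of the disjoint union of the closed rectangles is written \<open>(\<alpha>, x, y)\<close>, where \<open>x\<close>
  ranges over the closure of \<open>I\<^sub>\<alpha>\<close> and \<open>0 \<le> y \<le> q\<^sub>\<alpha>\<close>.

  The singularity on the left side of the rectangle \<open>\<alpha>\<close> lies at height
  \<open>sum_before (top_row \<pi>) \<tau> \<alpha>\<close>, that on the (prolonged) right side at height
  \<open>sum_before (top_row \<pi>) \<tau> \<alpha> + \<tau>\<^sub>\<alpha>\<close>. Below it, the right side is glued to the left side of the
  next rectangle of the top row, heights being measured from the bottom; above it, to the left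
  side of the next rectangle of the bottom row, depths being measured from the top. For the
  last letters of the two rows one prolongation is needed, see \<open>zip_end_up\<close> and
  \<open>zip_end_down\<close>: when \<open>\<Sum>\<tau> > 0\<close> the zipper above the right end of the last rectangle
  of the bottom row continues along the right side of the last rectangle of the top row;
  when \<open>\<Sum>\<tau> < 0\<close> symmetrically.\<close>

type_synonym 'a rect_point = "'a \<times> real \<times> real"

definition left_end :: "'a::finite rows \<Rightarrow> real ^ 'a \<Rightarrow> 'a \<Rightarrow> real" where
  "left_end \<pi> l \<alpha> = sum_before (top_row \<pi>) l \<alpha>"

definition right_end :: "'a::finite rows \<Rightarrow> real ^ 'a \<Rightarrow> 'a \<Rightarrow> real" where
  "right_end \<pi> l \<alpha> = sum_before (top_row \<pi>) l \<alpha> + l $ \<alpha>"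

definition left_sing :: "'a::finite rows \<Rightarrow> real ^ 'a \<Rightarrow> 'a \<Rightarrow> real" where
  "left_sing \<pi> \<tau> \<alpha> = sum_before (top_row \<pi>) \<tau> \<alpha>"

definition right_sing :: "'a::finite rows \<Rightarrow> real ^ 'a \<Rightarrow> 'a \<Rightarrow> real" where
  "right_sing \<pi> \<tau> \<alpha> = sum_before (top_row \<pi>) \<tau> \<alpha> + \<tau> $ \<alpha>"

definition rectangles :: "'a::finite rows \<Rightarrow> real ^ 'a \<Rightarrow> real ^ 'a \<Rightarrow> 'a rect_point set" where
  "rectangles \<pi> l \<tau> =
     {(\<alpha>, x, y). left_end \<pi> l \<alpha> \<le> x \<and> x \<le> right_end \<pi> l \<alpha> \<and> 0 \<le> y \<and> y \<le> heights \<pi> \<tau> $ \<alpha>}"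

inductive glued :: "'a::finite rows \<Rightarrow> real ^ 'a \<Rightarrow> real ^ 'a \<Rightarrow> 'a rect_point \<Rightarrow> 'a rect_point \<Rightarrow> bool"
  for \<pi> :: "'a rows" and l \<tau> :: "real ^ 'a"
where
  top_to_base:
    "\<lbrakk>x \<in> {left_end \<pi> l \<alpha> .. right_end \<pi> l \<alpha>};
      x + translation \<pi> l \<alpha> \<in> {left_end \<pi> l \<beta> .. right_end \<pi> l \<beta>}\<rbrakk>
     \<Longrightarrow> glued \<pi> l \<tau> (\<alpha>, x, heights \<pi> \<tau> $ \<alpha>) (\<beta>, x + translation \<pi> l \<alpha>, 0)"
| zip_below:
    "\<lbrakk>top_row \<pi> \<beta> = top_row \<pi> \<alpha> + 1; 0 \<le> y; y \<le> right_sing \<pi> \<tau> \<alpha>; y \<le> heights \<pi> \<tau> $ \<alpha>\<rbrakk>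
     \<Longrightarrow> glued \<pi> l \<tau> (\<alpha>, right_end \<pi> l \<alpha>, y) (\<beta>, left_end \<pi> l \<beta>, y)"
| zip_above:
    "\<lbrakk>bot_row \<pi> \<beta> = bot_row \<pi> \<alpha> + 1; 0 \<le> y; right_sing \<pi> \<tau> \<alpha> \<le> y; y \<le> heights \<pi> \<tau> $ \<alpha>\<rbrakk>
     \<Longrightarrow> glued \<pi> l \<tau> (\<alpha>, right_end \<pi> l \<alpha>, y)
           (\<beta>, left_end \<pi> l \<beta>, heights \<pi> \<tau> $ \<beta> - (heights \<pi> \<tau> $ \<alpha> - y))"
| zip_end_up:
    "\<lbrakk>top_row \<pi> \<alpha> = CARD('a); bot_row \<pi> \<delta> = CARD('a); top_row \<pi> \<beta> = top_row \<pi> \<delta> + 1;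
      0 \<le> y; y \<le> entry_sum \<tau>\<rbrakk>
     \<Longrightarrow> glued \<pi> l \<tau> (\<alpha>, right_end \<pi> l \<alpha>, y) (\<beta>, left_end \<pi> l \<beta>, heights \<pi> \<tau> $ \<delta> + y)"
| zip_end_down:
    "\<lbrakk>top_row \<pi> \<alpha> = CARD('a); bot_row \<pi> \<delta> = CARD('a); bot_row \<pi> \<beta> = bot_row \<pi> \<alpha> + 1;
      0 \<le> s; s \<le> - entry_sum \<tau>\<rbrakk>
     \<Longrightarrow> glued \<pi> l \<tau> (\<delta>, right_end \<pi> l \<delta>, heights \<pi> \<tau> $ \<delta> - s)
           (\<beta>, left_end \<pi> l \<beta>, heights \<pi> \<tau> $ \<beta> - heights \<pi> \<tau> $ \<alpha> - s)"

definition surf_class ::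
    "'a::finite rows \<Rightarrow> real ^ 'a \<Rightarrow> real ^ 'a \<Rightarrow> 'a rect_point \<Rightarrow> 'a rect_point set" where
  "surf_class \<pi> l \<tau> p = {p' \<in> rectangles \<pi> l \<tau>. equivclp (glued \<pi> l \<tau>) p p'}"

text \<open>\<open>M(\<pi>, l, \<tau>)\<close>, as the set of equivalence classes of points of the rectangles, and the marked
  set \<open>\<Sigma>\<close>.\<close>

definition surface :: "'a::finite rows \<Rightarrow> real ^ 'a \<Rightarrow> real ^ 'a \<Rightarrow> 'a rect_point set set" where
  "surface \<pi> l \<tau> = surf_class \<pi> l \<tau> ` rectangles \<pi> l \<tau>"

definition left_vertex ::
    "'a::finite rows \<Rightarrow> real ^ 'a \<Rightarrow> real ^ 'a \<Rightarrow> 'a \<Rightarrow> 'a rect_point set" where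
  "left_vertex \<pi> l \<tau> \<alpha> = surf_class \<pi> l \<tau> (\<alpha>, left_end \<pi> l \<alpha>, left_sing \<pi> \<tau> \<alpha>)"

definition marked_points :: "'a::finite rows \<Rightarrow> real ^ 'a \<Rightarrow> real ^ 'a \<Rightarrow> 'a rect_point set set" where
  "marked_points \<pi> l \<tau> = range (left_vertex \<pi> l \<tau>)"

text \<open>A horizontal saddle connection is a horizontal segment from a marked point to a marked point
  with no marked point inside. Marked points lie on vertical sides only, so the segment
  is a chain of full crossings of rectangles from left to right, the \<open>i\<close>-th one being that of
  \<open>\<alpha> i\<close> at height \<open>y i\<close>.\<close>

definition has_horizontal_connection :: "'a::finite rows \<Rightarrow> real ^ 'a \<Rightarrow> real ^ 'a \<Rightarrow> bool" where
  "has_horizontal_connection \<pi> l \<tau> \<longleftrightarrow>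
    (\<exists>(k::nat) (\<alpha> :: nat \<Rightarrow> 'a) (y :: nat \<Rightarrow> real).
       (\<forall>i\<le>k. 0 \<le> y i \<and> y i \<le> heights \<pi> \<tau> $ \<alpha> i) \<and>
       surf_class \<pi> l \<tau> (\<alpha> 0, left_end \<pi> l (\<alpha> 0), y 0) \<in> marked_points \<pi> l \<tau> \<and>
       surf_class \<pi> l \<tau> (\<alpha> k, right_end \<pi> l (\<alpha> k), y k) \<in> marked_points \<pi> l \<tau> \<and>
       (\<forall>i<k. surf_class \<pi> l \<tau> (\<alpha> i, right_end \<pi> l (\<alpha> i), y i) =
                surf_class \<pi> l \<tau> (\<alpha> (Suc i), left_end \<pi> l (\<alpha> (Suc i)), y (Suc i)) \<and>
              surf_class \<pi> l \<tau> (\<alpha> i, right_end \<pi> l (\<alpha> i), y i) \<notin> marked_points \<pi> l \<tau>))"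


section \<open>The backward Rauzy--Veech algorithm\<close>

text \<open>Indices \<open>n \<le> 0\<close> are encoded by the natural number \<open>k = - n\<close> throughout. Since the rotation
  number depends on \<open>(\<pi>, \<tau>)\<close> only, the algorithm runs on these pairs.\<close>

definition winner :: "'a::finite rows \<Rightarrow> real ^ 'a \<Rightarrow> 'a" where
  "winner \<pi> \<tau> = (if entry_sum \<tau> < 0 then inv (top_row \<pi>) CARD('a) else inv (bot_row \<pi>) CARD('a))"

definition loser :: "'a::finite rows \<Rightarrow> real ^ 'a \<Rightarrow> 'a" where
  "loser \<pi> \<tau> =
     (if entry_sum \<tau> < 0 then inv (bot_row \<pi>) (bot_row \<pi> (winner \<pi> \<tau>) + 1)
      else inv (top_row \<pi>) (top_row \<pi> (winner \<pi> \<tau>) + 1))"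

definition move_last :: "('a::finite \<Rightarrow> nat) \<Rightarrow> 'a \<Rightarrow> 'a \<Rightarrow> nat" where
  "move_last r a \<alpha> = (if \<alpha> = a then CARD('a) else if r \<alpha> > r a then r \<alpha> - 1 else r \<alpha>)"

definition back_rows :: "'a::finite rows \<Rightarrow> real ^ 'a \<Rightarrow> 'a rows" where
  "back_rows \<pi> \<tau> =
     (if entry_sum \<tau> < 0 then (top_row \<pi>, move_last (bot_row \<pi>) (loser \<pi> \<tau>))
      else (move_last (top_row \<pi>) (loser \<pi> \<tau>), bot_row \<pi>))"

definition add_entry :: "'a \<Rightarrow> 'a \<Rightarrow> 'b::plus ^ 'a::finite \<Rightarrow> 'b ^ 'a" where
  "add_entry w a v = (\<chi> \<alpha>. if \<alpha> = w then v $ w + v $ a else v $ \<alpha>)"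

primrec back_pair :: "'a::finite rows \<Rightarrow> real ^ 'a \<Rightarrow> nat \<Rightarrow> 'a rows \<times> (real ^ 'a)" where
  "back_pair \<pi> \<tau> 0 = (\<pi>, \<tau>)"
| "back_pair \<pi> \<tau> (Suc k) =
     (let (\<pi>', \<tau>') = back_pair \<pi> \<tau> k
      in (back_rows \<pi>' \<tau>', add_entry (winner \<pi>' \<tau>') (loser \<pi>' \<tau>') \<tau>'))"

definition rows_seq :: "'a::finite rows \<Rightarrow> real ^ 'a \<Rightarrow> nat \<Rightarrow> 'a rows" where
  "rows_seq \<pi> \<tau> k = fst (back_pair \<pi> \<tau> k)"

definition susp_seq :: "'a::finite rows \<Rightarrow> real ^ 'a \<Rightarrow> nat \<Rightarrow> real ^ 'a" where
  "susp_seq \<pi> \<tau> k = snd (back_pair \<pi> \<tau> k)"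

definition heights_seq :: "'a::finite rows \<Rightarrow> real ^ 'a \<Rightarrow> nat \<Rightarrow> real ^ 'a" where
  "heights_seq \<pi> \<tau> k = heights (rows_seq \<pi> \<tau> k) (susp_seq \<pi> \<tau> k)"

text \<open>Winner and loser of the arrow \<open>\<gamma>\<^sub>n : \<pi>\<^sup>(\<^sup>n\<^sup>-\<^sup>1\<^sup>) \<rightarrow> \<pi>\<^sup>(\<^sup>n\<^sup>)\<close> for \<open>n = - k\<close>.\<close>

definition win :: "'a::finite rows \<Rightarrow> real ^ 'a \<Rightarrow> nat \<Rightarrow> 'a" where
  "win \<pi> \<tau> k = winner (rows_seq \<pi> \<tau> k) (susp_seq \<pi> \<tau> k)"

definition lose :: "'a::finite rows \<Rightarrow> real ^ 'a \<Rightarrow> nat \<Rightarrow> 'a" where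
  "lose \<pi> \<tau> k = loser (rows_seq \<pi> \<tau> k) (susp_seq \<pi> \<tau> k)"

primrec length_seq :: "'a::finite rows \<Rightarrow> real ^ 'a \<Rightarrow> real ^ 'a \<Rightarrow> nat \<Rightarrow> real ^ 'a" where
  "length_seq \<pi> l \<tau> 0 = l"
| "length_seq \<pi> l \<tau> (Suc k) = add_entry (win \<pi> \<tau> k) (lose \<pi> \<tau> k) (length_seq \<pi> l \<tau> k)"

definition iem_seq :: "'a::finite rows \<Rightarrow> real ^ 'a \<Rightarrow> real ^ 'a \<Rightarrow> nat \<Rightarrow> real \<Rightarrow> real" where
  "iem_seq \<pi> l \<tau> k = iem (rows_seq \<pi> \<tau> k) (length_seq \<pi> l \<tau> k)"

definition interval_seq :: "'a::finite rows \<Rightarrow> real ^ 'a \<Rightarrow> real ^ 'a \<Rightarrow> nat \<Rightarrow> 'a \<Rightarrow> real set" where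
  "interval_seq \<pi> l \<tau> k = exch_interval (rows_seq \<pi> \<tau> k) (length_seq \<pi> l \<tau> k)"

definition arrow_mat :: "'a::finite rows \<Rightarrow> real ^ 'a \<Rightarrow> nat \<Rightarrow> real ^ 'a ^ 'a" where
  "arrow_mat \<pi> \<tau> k =
     mat 1 + (\<chi> \<alpha> \<beta>. if \<alpha> = lose \<pi> \<tau> k \<and> \<beta> = win \<pi> \<tau> k then 1 else 0)"

text \<open>\<open>B_mat \<pi> \<tau> k j\<close> is \<open>B(- k, - j)\<close> for \<open>j \<le> k\<close>, that is, the product
  \<open>arrow_mat \<pi> \<tau> j ** \<dots> ** arrow_mat \<pi> \<tau> (k - 1)\<close>.\<close>

definition B_mat :: "'a::finite rows \<Rightarrow> real ^ 'a \<Rightarrow> nat \<Rightarrow> nat \<Rightarrow> real ^ 'a ^ 'a" where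
  "B_mat \<pi> \<tau> k j = foldr (\<lambda>i P. arrow_mat \<pi> \<tau> i ** P) [j..<k] (mat 1)"

definition mat_norm :: "real ^ 'a ^ 'b \<Rightarrow> real" where
  "mat_norm B = (\<Sum>\<alpha>\<in>UNIV. \<Sum>\<beta>\<in>UNIV. \<bar>B $ \<alpha> $ \<beta>\<bar>)"


section \<open>Homology\<close>

text \<open>\<open>M\<close> is a cell complex with vertex set \<open>\<Sigma>\<close>, one oriented edge \<open>\<zeta>\<^sub>\<alpha>\<close> for each letter
  (the segment with displacement \<open>l\<^sub>\<alpha> + i \<tau>\<^sub>\<alpha>\<close> starting at the singularity on the left side of
  the rectangle \<open>\<alpha>\<close>) and one two-cell, whose boundary runs once in each direction along each edge
  and is therefore the zero chain. Hence \<open>H\<^sub>1(M, \<Sigma>, \<real>)\<close> is the space \<open>real ^ 'a\<close> of cellular 1-chains: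
  every chain is a cycle relative to \<open>\<Sigma>\<close> and the boundaries vanish. Likewise \<open>M - \<Sigma>\<close>
  retracts onto the dual graph, which has one vertex and one loop for each edge, namely the class of
  \<open>\<theta>\<^sub>\<alpha>\<close> crossing \<open>\<zeta>\<^sub>\<alpha>\<close> upward, so \<open>H\<^sub>1(M - \<Sigma>, \<int>)\<close> is \<open>int ^ 'a\<close>; the intersection form pairs an
  edge with its dual loop. These are the complexes at level \<open>0\<close>; the classes \<open>\<theta>\<^sup>(\<^sup>n\<^sup>)\<close>, \<open>\<zeta>\<^sup>(\<^sup>n\<^sup>)\<close> of the
  other levels are expressed in them.\<close>

type_synonym 'a rel_class = "real ^ 'a"
type_synonym 'a abs_class = "int ^ 'a"

definition intersection :: "'a::finite rel_class \<Rightarrow> 'a abs_class \<Rightarrow> real" where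
  "intersection \<Upsilon> \<theta> = (\<Sum>\<alpha>\<in>UNIV. \<Upsilon> $ \<alpha> * of_int (\<theta> $ \<alpha>))"

text \<open>The loop \<open>\<theta>\<^sup>(\<^sup>n\<^sup>)\<close> of the loser of \<open>\<gamma>\<^sub>n\<close> runs through the rectangles of the loser and of
  the winner at level \<open>n - 1\<close>, so
  \<open>\<theta>\<^sup>(\<^sup>n\<^sup>)\<^sub>\<ell> = \<theta>\<^sup>(\<^sup>n\<^sup>-\<^sup>1\<^sup>)\<^sub>\<ell> + \<theta>\<^sup>(\<^sup>n\<^sup>-\<^sup>1\<^sup>)\<^sub>w\<close>;
  the other loops run through a single rectangle.\<close>

primrec theta :: "'a::finite rows \<Rightarrow> real ^ 'a \<Rightarrow> nat \<Rightarrow> 'a \<Rightarrow> 'a abs_class" where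
  "theta \<pi> \<tau> 0 = (\<lambda>\<alpha>. axis \<alpha> 1)"
| "theta \<pi> \<tau> (Suc k) = (theta \<pi> \<tau> k)
     (lose \<pi> \<tau> k := theta \<pi> \<tau> k (lose \<pi> \<tau> k) - theta \<pi> \<tau> k (win \<pi> \<tau> k))"

text \<open>The edge of the winner at level \<open>n - 1\<close> is the concatenation of the edges of the winner and
  of the loser at level \<open>n\<close>.\<close>

primrec zeta :: "'a::finite rows \<Rightarrow> real ^ 'a \<Rightarrow> nat \<Rightarrow> 'a \<Rightarrow> 'a rel_class" where
  "zeta \<pi> \<tau> 0 = (\<lambda>\<alpha>. axis \<alpha> 1)"
| "zeta \<pi> \<tau> (Suc k) = (zeta \<pi> \<tau> k)
     (win \<pi> \<tau> k := zeta \<pi> \<tau> k (win \<pi> \<tau> k) + zeta \<pi> \<tau> k (lose \<pi> \<tau> k))"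

definition chi_vec :: "'a::finite rows \<Rightarrow> real ^ 'a \<Rightarrow> 'a rel_class \<Rightarrow> nat \<Rightarrow> real ^ 'a" where
  "chi_vec \<pi> \<tau> \<Upsilon> k = (\<chi> \<alpha>. intersection \<Upsilon> (theta \<pi> \<tau> k \<alpha>))"

lemma chi_vec_step:
  assumes "win \<pi> \<tau> k \<noteq> lose \<pi> \<tau> k"
  shows "arrow_mat \<pi> \<tau> k *v chi_vec \<pi> \<tau> \<Upsilon> (Suc k) = chi_vec \<pi> \<tau> \<Upsilon> k"
proof -
  have *: "(\<Sum>j\<in>UNIV. (if i = L \<and> j = W then 1 else 0) * f j) = (if i = L then f W else (0::real))"
    for i L W :: 'a and f
    by (cases "i = L") (simp_all add: if_distrib[of "\<lambda>x. x * _"] cong: if_cong)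
  have "(arrow_mat \<pi> \<tau> k *v v) $ i = v $ i + (if i = lose \<pi> \<tau> k then v $ win \<pi> \<tau> k else 0)" for v i
    by (simp add: arrow_mat_def matrix_vector_mult_add_rdistrib)
       (simp add: matrix_vector_mult_def *)
  then show ?thesis using assms
    by (simp add: vec_eq_iff chi_vec_def intersection_def algebra_simps sum_subtractf)
qed

lemma intersection_zeta_theta:
  assumes "\<And>i. i < k \<Longrightarrow> win \<pi> \<tau> i \<noteq> lose \<pi> \<tau> i"
  shows "intersection (zeta \<pi> \<tau> k \<alpha>) (theta \<pi> \<tau> k \<beta>) = of_bool (\<alpha> = \<beta>)"
  using assms
proof (induction k arbitrary: \<alpha> \<beta>)
  case 0
  then show ?case
    by (simp add: intersection_def axis_def if_distrib[of "\<lambda>x. x * _"] cong: if_cong)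
next
  case (Suc k)
  have add: "intersection (x + y) t = intersection x t + intersection y t"
    and diff: "intersection x (s - t) = intersection x s - intersection x t"
    for x y :: "'a rel_class" and s t
    by (simp_all add: intersection_def algebra_simps sum.distrib sum_subtractf)
  have "win \<pi> \<tau> k \<noteq> lose \<pi> \<tau> k" "lose \<pi> \<tau> k \<noteq> win \<pi> \<tau> k"
    using Suc.prems[of k] by simp_all
  with Suc show ?case by (auto simp: add diff)
qed

text \<open>The final point of \<open>\<zeta>\<^sub>\<alpha>\<close> is the initial point of the edge following it on the top side
  or on the bottom side of the polygon; in an irreducible datum at least one of them exists, and
  if both do, they have the same initial point in \<open>M\<close>.\<close>

definition right_vertex ::
    "'a::finite rows \<Rightarrow> real ^ 'a \<Rightarrow> real ^ 'a \<Rightarrow> 'a \<Rightarrow> 'a rect_point set" where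
  "right_vertex \<pi> l \<tau> \<alpha> = left_vertex \<pi> l \<tau>
     (if top_row \<pi> \<alpha> < CARD('a) then inv (top_row \<pi>) (top_row \<pi> \<alpha> + 1)
      else inv (bot_row \<pi>) (bot_row \<pi> \<alpha> + 1))"

text \<open>\<open>H\<^sub>0(\<Sigma>, \<real>)\<close> is the space of functions on \<open>\<Sigma>\<close>, extended by \<open>0\<close>.\<close>

definition boundary ::
    "'a::finite rows \<Rightarrow> real ^ 'a \<Rightarrow> real ^ 'a \<Rightarrow> 'a rel_class \<Rightarrow> 'a rect_point set \<Rightarrow> real" where
  "boundary \<pi> l \<tau> \<Upsilon> s =
     (\<Sum>\<alpha>\<in>UNIV. \<Upsilon> $ \<alpha> * (of_bool (right_vertex \<pi> l \<tau> \<alpha> = s) - of_bool (left_vertex \<pi> l \<tau> \<alpha> = s)))"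

definition zero_sum_on_marked ::
    "'a::finite rows \<Rightarrow> real ^ 'a \<Rightarrow> real ^ 'a \<Rightarrow> ('a rect_point set \<Rightarrow> real) set" where
  "zero_sum_on_marked \<pi> l \<tau> =
     {v. (\<forall>s. s \<notin> marked_points \<pi> l \<tau> \<longrightarrow> v s = 0) \<and> (\<Sum>s\<in>marked_points \<pi> l \<tau>. v s) = 0}"


section \<open>Growth conditions\<close>

definition Gamma_u :: "'a::finite rows \<Rightarrow> real ^ 'a \<Rightarrow> 'a rel_class set" where
  "Gamma_u \<pi> \<tau> = {\<Upsilon>. \<exists>\<sigma>>0. \<exists>C>0. \<forall>k>0.
     norm (chi_vec \<pi> \<tau> \<Upsilon> k) \<le> C * mat_norm (B_mat \<pi> \<tau> k 0) powr (- \<sigma>) * norm (chi_vec \<pi> \<tau> \<Upsilon> 0)}"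

definition neg_KZ_hyperbolic :: "'a::finite rows \<Rightarrow> real ^ 'a \<Rightarrow> real ^ 'a \<Rightarrow> bool" where
  "neg_KZ_hyperbolic \<pi> l \<tau> \<longleftrightarrow>
     \<not> has_horizontal_connection \<pi> l \<tau> \<and>
     (\<forall>t>0. summable (\<lambda>k. mat_norm (B_mat \<pi> \<tau> (Suc k) 0) powr (- t))) \<and>
     dim (Gamma_u \<pi> \<tau>) = genus \<pi> \<and>
     (\<forall>t>0. \<exists>C>0. \<forall>\<Upsilon>\<in>Gamma_u \<pi> \<tau>. \<forall>j k. j \<le> k \<longrightarrow>
        norm (chi_vec \<pi> \<tau> \<Upsilon> k) \<le> C * mat_norm (B_mat \<pi> \<tau> k 0) powr t * norm (chi_vec \<pi> \<tau> \<Upsilon> j))"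

definition subpolynomial_growth_past :: "'a::finite rows \<Rightarrow> real ^ 'a \<Rightarrow> 'a rel_class \<Rightarrow> bool" where
  "subpolynomial_growth_past \<pi> \<tau> \<Upsilon> \<longleftrightarrow>
     limsup (\<lambda>k. ereal (ln (norm (chi_vec \<pi> \<tau> \<Upsilon> k) / norm (chi_vec \<pi> \<tau> \<Upsilon> 0))
                        / ln (mat_norm (B_mat \<pi> \<tau> k 0)))) = 0"

text \<open>\<open>complete_path \<pi> \<tau> j k\<close>: the path \<open>\<gamma>\<^bsub>-k+1\<^esub> \<star> \<dots> \<star> \<gamma>\<^bsub>-j\<^esub>\<close> is complete.\<close>

definition complete_path :: "'a::finite rows \<Rightarrow> real ^ 'a \<Rightarrow> nat \<Rightarrow> nat \<Rightarrow> bool" where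
  "complete_path \<pi> \<tau> j k \<longleftrightarrow> (\<forall>\<alpha>. \<exists>i\<in>{j..<k}. win \<pi> \<tau> i = \<alpha>)"

text \<open>The first conjunct says that the algorithm never stops, i.e. that the backward rotation
  number is defined as an infinite path.\<close>

definition infinity_complete :: "'a::finite rows \<Rightarrow> real ^ 'a \<Rightarrow> bool" where
  "infinity_complete \<pi> \<tau> \<longleftrightarrow>
     (\<forall>k. entry_sum (susp_seq \<pi> \<tau> k) \<noteq> 0) \<and>
     (\<exists>N :: nat \<Rightarrow> nat. N 0 = 0 \<and> strict_mono N \<and> (\<forall>i. complete_path \<pi> \<tau> (N i) (N (Suc i))))"

text \<open>\<open>complete_time \<pi> \<tau> j\<close> is \<open>- n\<^sub>-\<^sub>j\<close> for the times \<open>n\<^sub>k\<close>, \<open>k \<le> 0\<close>, of the successive shortest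
  complete paths.\<close>

primrec complete_time :: "'a::finite rows \<Rightarrow> real ^ 'a \<Rightarrow> nat \<Rightarrow> nat" where
  "complete_time \<pi> \<tau> 0 = 0"
| "complete_time \<pi> \<tau> (Suc j) =
     (LEAST k. k > complete_time \<pi> \<tau> j \<and> complete_path \<pi> \<tau> (complete_time \<pi> \<tau> j) k)"

text \<open>Operator norm of the restriction of a linear map to a subspace.\<close>

definition restricted_norm :: "real ^ 'a ^ 'b \<Rightarrow> (real ^ 'a) set \<Rightarrow> real" where
  "restricted_norm A H = (SUP v \<in> {v \<in> H. norm v \<le> 1}. norm (A *v v))"

definition dual_Roth_type :: "'a::finite rows \<Rightarrow> real ^ 'a \<Rightarrow> bool" where
  "dual_Roth_type \<pi> \<tau> \<longleftrightarrow>
     infinity_complete \<pi> \<tau> \<and>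
     (\<forall>\<epsilon>>0. \<exists>C\<^sub>0>0. \<forall>j.
        mat_norm (B_mat \<pi> \<tau> (complete_time \<pi> \<tau> (Suc j)) (complete_time \<pi> \<tau> j))
          \<le> C\<^sub>0 * mat_norm (B_mat \<pi> \<tau> (complete_time \<pi> \<tau> j) 0) powr \<epsilon>) \<and>
     (\<exists>\<theta>>0. \<exists>C\<^sub>1>0. \<forall>k.
        restricted_norm (transpose (B_mat \<pi> \<tau> k 0))
            {v. (\<Sum>\<alpha>\<in>UNIV. heights \<pi> \<tau> $ \<alpha> * v $ \<alpha>) = 0}
          \<le> C\<^sub>1 * mat_norm (transpose (B_mat \<pi> \<tau> k 0)) powr (1 - \<theta>))"


section \<open>The functions \<open>\<Omega>\<^sub>\<alpha>\<^sup>(\<^sup>n\<^sup>)(\<Upsilon>)\<close>\<close>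

definition return_time :: "'a::finite rows \<Rightarrow> real ^ 'a \<Rightarrow> nat \<Rightarrow> 'a \<Rightarrow> nat" where
  "return_time \<pi> \<tau> k \<alpha> = nat \<lfloor>\<Sum>\<beta>\<in>UNIV. B_mat \<pi> \<tau> k 0 $ \<alpha> $ \<beta>\<rfloor>"

definition itinerary :: "'a::finite rows \<Rightarrow> real ^ 'a \<Rightarrow> real ^ 'a \<Rightarrow> nat \<Rightarrow> 'a \<Rightarrow> nat \<Rightarrow> 'a" where
  "itinerary \<pi> l \<tau> k \<alpha> j =
     (THE \<beta>. (iem_seq \<pi> l \<tau> k ^^ j) ` interval_seq \<pi> l \<tau> 0 \<alpha> \<subseteq> interval_seq \<pi> l \<tau> k \<beta>)"

definition vertex ::
    "'a::finite rows \<Rightarrow> real ^ 'a \<Rightarrow> real ^ 'a \<Rightarrow> 'a rel_class \<Rightarrow> nat \<Rightarrow> 'a \<Rightarrow> nat \<Rightarrow> real \<times> real" where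
  "vertex \<pi> l \<tau> \<Upsilon> k \<alpha> j =
     (\<Sum>i<j. heights_seq \<pi> \<tau> k $ itinerary \<pi> l \<tau> k \<alpha> i,
      \<Sum>i<j. intersection \<Upsilon> (theta \<pi> \<tau> k (itinerary \<pi> l \<tau> k \<alpha> i)))"

text \<open>The function on \<open>{0..q\<^sub>\<alpha>}\<close> whose graph is the broken line with these vertices.\<close>

definition Omega_fun ::
    "'a::finite rows \<Rightarrow> real ^ 'a \<Rightarrow> real ^ 'a \<Rightarrow> 'a rel_class \<Rightarrow> nat \<Rightarrow> 'a \<Rightarrow> real \<Rightarrow> real" where
  "Omega_fun \<pi> l \<tau> \<Upsilon> k \<alpha> x =
     (THE y. \<exists>j<return_time \<pi> \<tau> k \<alpha>.
        (x, y) \<in> closed_segment (vertex \<pi> l \<tau> \<Upsilon> k \<alpha> j) (vertex \<pi> l \<tau> \<Upsilon> k \<alpha> (Suc j)))"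

definition hoelder_on :: "real set \<Rightarrow> real \<Rightarrow> (real \<Rightarrow> real) \<Rightarrow> bool" where
  "hoelder_on S \<eta> \<psi> \<longleftrightarrow> (\<exists>C. \<forall>x\<in>S. \<forall>y\<in>S. \<bar>\<psi> x - \<psi> y\<bar> \<le> C * \<bar>x - y\<bar> powr \<eta>)"

end

theory Submission
  imports Defs
begin

text \<open>
  Passing from level \<open>n\<close> to level \<open>n - 1\<close> replaces the rectangle of the loser by a pile of two
  rectangles. In the broken line of \<open>\<Omega>\<^sup>(\<^sup>n\<^sup>)\<close> every segment of the loser is replaced by two segments
  with the same sum, so the difference of consecutive functions is a sum of copies of a single tent, one copy
  for each occurrence of the loser in the itinerary. The height of the tent is at most of the order of
  \<open>\<chi>\<^sup>(\<^sup>n\<^sup>-\<^sup>1\<^sup>)\<close>, which is subpolynomial in \<open>\<parallel>B(n,0)\<parallel>\<close>. This alone does not make the integral of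
  the difference small; cancellation comes from the equidistribution of the occurrences of the loser and from the
  mean value zero of \<open>\<psi>\<close>.

  To see it, take an intermediate level \<open>m\<close> with \<open>\<parallel>B(m,0)\<parallel>\<close> about \<open>\<parallel>B(n,0)\<parallel>\<^sup>\<kappa>\<close> for a small
  \<open>\<kappa>\<close>. The interval is divided into pieces of lengths \<open>q\<^sup>(\<^sup>m\<^sup>)\<^sub>\<beta>\<close>. They are short, so \<open>\<psi>\<close> is
  nearly constant on each. The fraction of a piece that is covered by occurrences of the loser
  is nearly the same for all pieces (\<open>letter_share_le\<close>): the deviation is the height of the loser times an entry of
  \<open>\<^sup>tB(n,0) u\<close> with \<open>u\<close> orthogonal to \<open>q\<^sup>(\<^sup>0\<^sup>)\<close>, and the size of \<open>u\<close> is polynomial in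
  \<open>\<parallel>B(m,0)\<parallel>\<close> by Cramer's rule. The contraction in the dual Roth condition gains a power
  \<open>\<parallel>B(n,0)\<parallel>\<^sup>-\<^sup>\<theta>\<close>, which beats the losses if \<open>\<kappa>\<close> is small. So the difference
  integrates against \<open>\<psi>\<close> to almost a multiple of the integral of \<open>\<psi>\<close>, which is zero
  (\<open>integral_tile_hoelder_le\<close>, \<open>Omega_step_le\<close>). The outcome is a bound by a negative power of
  \<open>\<parallel>B(n,0)\<parallel>\<close> (\<open>Omega_step_eventually_le\<close>), and these powers are summable by hyperbolicity.

  That the pieces of level \<open>m\<close> and the rectangles of level \<open>n\<close> are thin is the content of
  \<open>height_le\<close>. It rests on a positivity property of complete paths (\<open>B_mat_ge_1\<close>): the winner of an
  arrow is the winner or the loser of its predecessor in the backward order, hence two complete paths always enlarge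
  the set of letters that occur in a word, until it is the whole alphabet. By the growth part of the dual
  Roth condition a bounded number of complete paths changes \<open>\<parallel>B(n,0)\<parallel>\<close> by an arbitrarily small power.

  The link between the dynamical definition of the functions and these words is the fact that the itinerary of an
  interval is obtained by iterating substitutions (\<open>itinerary_eq\<close>, \<open>Omega_fun_eq\<close>).
\<close>

section \<open>One step of the backward algorithm\<close>

definition bij_rows :: "'a::finite rows \<Rightarrow> bool" where
  "bij_rows \<pi> \<longleftrightarrow> bij_betw (top_row \<pi>) UNIV {1..CARD('a)} \<and> bij_betw (bot_row \<pi>) UNIV {1..CARD('a)}"

lemma bij_row_range:
  assumes "bij_betw r UNIV {1..CARD('a::finite)}"
  shows "1 \<le> r (\<alpha>::'a)" "r \<alpha> \<le> CARD('a)"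
  using assms by (auto simp: bij_betw_def)

lemma bij_row_inj:
  assumes "bij_betw r UNIV {1..CARD('a::finite)}"
  shows "r (\<alpha>::'a) = r \<beta> \<longleftrightarrow> \<alpha> = \<beta>"
  using assms by (auto simp: bij_betw_def inj_def)

lemma bij_row_inv:
  assumes "bij_betw r UNIV {1..CARD('a::finite)}" "1 \<le> k" "k \<le> CARD('a)"
  shows "r (inv r k :: 'a) = k"
  using assms by (intro f_inv_into_f) (auto simp: bij_betw_def)

lemma bij_row_inv_eq:
  assumes "bij_betw r UNIV {1..CARD('a::finite)}" "r (\<alpha>::'a) = k"
  shows "inv r k = \<alpha>"
  using assms by (metis bij_betw_imp_inj_on inv_f_f)

lemma move_last_bij:
  assumes r: "bij_betw r UNIV {1..CARD('a::finite)}"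
  shows "bij_betw (move_last r (a::'a)) UNIV {1..CARD('a)}"
proof -
  note range = bij_row_range[OF r] and inj = bij_row_inj[OF r]
  have "inj (move_last r a)"
  proof (rule injI)
    fix x y assume eq: "move_last r a x = move_last r a y"
    have ne: "r x \<noteq> r a" if "x \<noteq> a" for x using inj that by blast
    show "x = y"
      using eq ne[of x] ne[of y] range[of x] range[of y] range[of a] inj[of x y]
      by (auto simp: move_last_def split: if_splits)
  qed
  moreover have "range (move_last r a) \<subseteq> {1..CARD('a)}"
  proof -
    have "move_last r a x \<in> {1..CARD('a)}" for x
      using range[of x] range[of a] by (auto simp: move_last_def)
    then show ?thesis by blast
  qed
  ultimately show ?thesis
    by (simp add: bij_betw_def card_image card_subset_eq)
qed

lemma sum_before_last:
  assumes r: "bij_betw r UNIV {1..CARD('a::finite)}" and "r (w::'a) = CARD('a)"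
  shows "sum_before r v w + v $ w = entry_sum v"
proof -
  have "{\<beta>. r \<beta> < r w} = UNIV - {w}"
  proof -
    have "r \<beta> < r w \<longleftrightarrow> \<beta> \<noteq> w" for \<beta>
      using bij_row_range(2)[OF r, of \<beta>] bij_row_inj[OF r, of \<beta> w] assms(2) by linarith
    then show ?thesis by auto
  qed
  then show ?thesis
    by (simp add: sum_before_def entry_sum_def sum_diff1)
qed

lemma sum_before_next:
  assumes r: "bij_betw r UNIV {1..CARD('a::finite)}" and "r (a::'a) = r w + 1"
  shows "sum_before r v a = sum_before r v w + v $ w"
proof -
  have "{\<beta>. r \<beta> < r a} = insert w {\<beta>. r \<beta> < r w}"
    using bij_row_inj[OF r] assms(2) by (auto simp: less_Suc_eq)
  then show ?thesis
    by (simp add: sum_before_def)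
qed

text \<open>Enlarging the entry of the last letter of a row does not move the letters of that row, since the last
  letter precedes none of them.\<close>

lemma sum_before_add_entry_last:
  assumes r: "bij_betw r UNIV {1..CARD('a::finite)}" and "r (w::'a) = CARD('a)"
  shows "sum_before r (add_entry w a v) \<alpha> = sum_before r v \<alpha>"
  unfolding sum_before_def
  by (rule sum.cong) (use bij_row_range[OF r] assms(2) in \<open>auto simp: add_entry_def leD\<close>)

text \<open>In the other row the loser directly follows the winner. Moving it to the end leaves a gap that is
  filled exactly by the enlarged winner, so the loser alone changes its position.\<close>

lemma sum_before_move_last:
  assumes r: "bij_betw r UNIV {1..CARD('a::finite)}" and aw: "r (a::'a) = r w + 1"
  shows "sum_before (move_last r a) (add_entry w a v) \<alpha> =
           (if \<alpha> = a then entry_sum v else sum_before r v \<alpha>)"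
proof -
  note range = bij_row_range[OF r] and inj = bij_row_inj[OF r]
  have wa: "w \<noteq> a" using aw by auto
  have split: "sum (\<lambda>\<beta>. add_entry w a v $ \<beta>) (S - {a}) = sum (\<lambda>\<beta>. v $ \<beta>) S"
    if "w \<in> S" "a \<in> S" for S :: "'a set"
  proof -
    have "sum (\<lambda>\<beta>. add_entry w a v $ \<beta>) (S - {a})
        = add_entry w a v $ w + sum (\<lambda>\<beta>. add_entry w a v $ \<beta>) (S - {a} - {w})"
      using that wa by (intro sum.remove) auto
    also have "sum (\<lambda>\<beta>. add_entry w a v $ \<beta>) (S - {a} - {w}) = sum (\<lambda>\<beta>. v $ \<beta>) (S - {a} - {w})"
      by (rule sum.cong) (auto simp: add_entry_def)
    also have "add_entry w a v $ w + \<dots> = v $ a + (v $ w + sum (\<lambda>\<beta>. v $ \<beta>) (S - {a} - {w}))"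
      by (simp add: add_entry_def)
    also have "v $ w + sum (\<lambda>\<beta>. v $ \<beta>) (S - {a} - {w}) = sum (\<lambda>\<beta>. v $ \<beta>) (S - {a})"
      using that wa by (intro sum.remove[symmetric]) auto
    also have "v $ a + \<dots> = sum (\<lambda>\<beta>. v $ \<beta>) S"
      using that by (intro sum.remove[symmetric]) auto
    finally show ?thesis .
  qed
  have ne: "r \<beta> \<noteq> r a" if "\<beta> \<noteq> a" for \<beta> using inj that by blast
  consider "\<alpha> = a" | "\<alpha> \<noteq> a" "r \<alpha> < r a" | "\<alpha> \<noteq> a" "r \<alpha> > r a"
    using ne by (metis linorder_neqE_nat)
  then show ?thesis
  proof cases
    case 1
    have "{\<beta>. move_last r a \<beta> < move_last r a \<alpha>} = UNIV - {a}"
    proof -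
      have "move_last r a \<beta> < CARD('a)" if "\<beta> \<noteq> a" for \<beta>
        using ne[OF that] range[of \<beta>] range[of a] that by (auto simp: move_last_def)
      then show ?thesis using 1 by (auto simp: move_last_def)
    qed
    then show ?thesis using 1 split[of UNIV] by (simp add: sum_before_def entry_sum_def)
  next
    case 2
    have "{\<beta>. move_last r a \<beta> < move_last r a \<alpha>} = {\<beta>. r \<beta> < r \<alpha>}"
      using 2 range(2)[of \<alpha>] ne by (auto simp: move_last_def)
    moreover have "(\<Sum>\<beta> | r \<beta> < r \<alpha>. add_entry w a v $ \<beta>) = (\<Sum>\<beta> | r \<beta> < r \<alpha>. v $ \<beta>)"
      by (rule sum.cong) (use 2 aw in \<open>auto simp: add_entry_def\<close>)
    ultimately show ?thesis using 2 by (simp add: sum_before_def)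
  next
    case 3
    have "move_last r a \<beta> < move_last r a \<alpha> \<longleftrightarrow> r \<beta> < r \<alpha> \<and> \<beta> \<noteq> a" for \<beta>
      using 3 range(2)[of \<alpha>] ne[of \<beta>] by (cases "\<beta> = a") (auto simp: move_last_def)
    then have "{\<beta>. move_last r a \<beta> < move_last r a \<alpha>} = {\<beta>. r \<beta> < r \<alpha>} - {a}"
      by blast
    with split[of "{\<beta>. r \<beta> < r \<alpha>}"] show ?thesis using 3 aw by (simp add: sum_before_def)
  qed
qed

text \<open>The heights of the rectangles are, up to sign, the translation lengths of \<open>\<tau>\<close>: the letters that
  precede \<open>\<alpha>\<close> in both rows cancel.\<close>

lemma heights_eq_sum_before:
  fixes \<pi> :: "'a::finite rows"
  assumes "bij_rows \<pi>"
  shows "heights \<pi> \<tau> $ \<alpha> = sum_before (top_row \<pi>) \<tau> \<alpha> - sum_before (bot_row \<pi>) \<tau> \<alpha>"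
proof -
  have t: "bij_betw (top_row \<pi>) UNIV {1..CARD('a)}" and b: "bij_betw (bot_row \<pi>) UNIV {1..CARD('a)}"
    using assms by (auto simp: bij_rows_def)
  have "- (Omega_mat \<pi> $ \<alpha> $ \<beta> * \<tau> $ \<beta>) =
      (if top_row \<pi> \<beta> < top_row \<pi> \<alpha> then \<tau> $ \<beta> else 0) - (if bot_row \<pi> \<beta> < bot_row \<pi> \<alpha> then \<tau> $ \<beta> else 0)" for \<beta>
    using bij_row_inj[OF t, of \<alpha> \<beta>] bij_row_inj[OF b, of \<alpha> \<beta>]
    by (cases "\<alpha> = \<beta>") (auto simp: Omega_mat_def)
  then have "heights \<pi> \<tau> $ \<alpha> = (\<Sum>\<beta>\<in>UNIV. (if top_row \<pi> \<beta> < top_row \<pi> \<alpha> then \<tau> $ \<beta> else 0)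
      - (if bot_row \<pi> \<beta> < bot_row \<pi> \<alpha> then \<tau> $ \<beta> else 0))"
    by (simp add: heights_def matrix_vector_mult_def flip: sum_negf)
  then show ?thesis
    by (simp add: sum_subtractf sum_before_def sum.If_cases)
qed

text \<open>The invariant of the algorithm. The sign conditions force the first letters of the two rows, and the last
  ones, to be different: otherwise the same partial sum would be positive and negative. Hence winner and
  loser always exist and the rectangles have positive height.\<close>

definition suspended :: "'a::finite rows \<Rightarrow> real ^ 'a \<Rightarrow> bool" where
  "suspended \<pi> \<tau> \<longleftrightarrow> bij_rows \<pi> \<and>
     (\<forall>\<alpha>. (1 < top_row \<pi> \<alpha> \<longrightarrow> sum_before (top_row \<pi>) \<tau> \<alpha> > 0) \<and>
          (1 < bot_row \<pi> \<alpha> \<longrightarrow> sum_before (bot_row \<pi>) \<tau> \<alpha> < 0))"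

lemma suspended_if_cone:
  fixes \<pi> :: "'a::finite rows"
  assumes "irreducible_rows \<pi>" "\<tau> \<in> suspension_cone \<pi>"
  shows "suspended \<pi> \<tau>"
proof -
  have t: "bij_betw (top_row \<pi>) UNIV {1..CARD('a)}" and b: "bij_betw (bot_row \<pi>) UNIV {1..CARD('a)}"
    using assms by (auto simp: irreducible_rows_def)
  show ?thesis
    using assms(2) t b bij_row_range[OF t] bij_row_range[OF b]
    by (auto simp: suspended_def suspension_cone_def bij_rows_def sum_before_def)
qed

lemma suspended_bij:
  fixes \<pi> :: "'a::finite rows"
  assumes "suspended \<pi> \<tau>"
  shows "bij_betw (top_row \<pi>) UNIV {1..CARD('a)}" "bij_betw (bot_row \<pi>) UNIV {1..CARD('a)}"
  using assms by (auto simp: suspended_def bij_rows_def)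

lemma suspended_last_differ:
  fixes \<pi> :: "'a::finite rows"
  assumes "suspended \<pi> \<tau>" "CARD('a) \<ge> 2" "top_row \<pi> \<alpha> = CARD('a)" "bot_row \<pi> \<alpha> = CARD('a)"
  shows False
proof -
  note s = suspended_bij[OF assms(1)]
  have "sum_before (top_row \<pi>) \<tau> \<alpha> = sum_before (bot_row \<pi>) \<tau> \<alpha>"
    using sum_before_last[OF s(1) assms(3)] sum_before_last[OF s(2) assms(4)] by (metis add_right_cancel)
  then show False using assms by (auto simp: suspended_def dest!: spec[of _ \<alpha>])
qed

lemma suspended_heights_pos:
  fixes \<pi> :: "'a::finite rows"
  assumes sus: "suspended \<pi> \<tau>" and card: "CARD('a) \<ge> 2"
  shows "heights \<pi> \<tau> $ \<alpha> > 0"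
proof -
  note t = suspended_bij(1)[OF sus] and b = suspended_bij(2)[OF sus]
  have first: "{\<beta>. r \<beta> < r \<alpha>} = {}" "sum_before r \<tau> \<alpha> = 0"
    if "bij_betw r UNIV {1..CARD('a)}" "r \<alpha> = 1" for r :: "'a \<Rightarrow> nat"
  proof -
    have "r \<beta> \<noteq> 0" for \<beta> using bij_row_range(1)[OF that(1), of \<beta>] by simp
    then show "{\<beta>. r \<beta> < r \<alpha>} = {}" using that(2) by auto
    then show "sum_before r \<tau> \<alpha> = 0" by (simp add: sum_before_def)
  qed
  have "\<not> (top_row \<pi> \<alpha> = 1 \<and> bot_row \<pi> \<alpha> = 1)"
  proof
    assume *: "top_row \<pi> \<alpha> = 1 \<and> bot_row \<pi> \<alpha> = 1"
    have sec: "sum_before r \<tau> (inv r 2) = \<tau> $ \<alpha>" "r (inv r 2) = 2"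
      if r: "bij_betw r UNIV {1..CARD('a)}" "r \<alpha> = 1" for r :: "'a \<Rightarrow> nat"
    proof -
      show 2: "r (inv r 2) = 2" using card by (intro bij_row_inv[OF r(1)]) auto
      show "sum_before r \<tau> (inv r 2) = \<tau> $ \<alpha>"
        using sum_before_next[OF r(1), of "inv r 2" \<alpha> \<tau>] first(2)[OF r] 2 r(2) by simp
    qed
    have "\<tau> $ \<alpha> > 0" "\<tau> $ \<alpha> < 0"
      using sus sec[OF t] sec[OF b] * unfolding suspended_def
      by (metis one_less_numeral_iff semiring_norm(76))+
    then show False by simp
  qed
  then consider "top_row \<pi> \<alpha> > 1" "bot_row \<pi> \<alpha> > 1" | "top_row \<pi> \<alpha> = 1" "bot_row \<pi> \<alpha> > 1"
    | "top_row \<pi> \<alpha> > 1" "bot_row \<pi> \<alpha> = 1"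
    using bij_row_range(1)[OF t, of \<alpha>] bij_row_range(1)[OF b, of \<alpha>] by linarith
  then show ?thesis
    using sus first(2)[OF t] first(2)[OF b]
    by cases (auto simp: suspended_def heights_eq_sum_before dest!: spec[of _ \<alpha>])
qed

text \<open>The winner is the last letter of one row, hence not of the other one, so there the loser exists as the
  letter following it.\<close>

lemma arrow_cases:
  fixes \<pi> :: "'a::finite rows" and \<tau> :: "real ^ 'a"
  assumes sus: "suspended \<pi> \<tau>" and card: "CARD('a) \<ge> 2"
  obtains (top) "entry_sum \<tau> < 0" "top_row \<pi> (winner \<pi> \<tau>) = CARD('a)"
      "bot_row \<pi> (loser \<pi> \<tau>) = bot_row \<pi> (winner \<pi> \<tau>) + 1"
      "top_row (back_rows \<pi> \<tau>) = top_row \<pi>"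
      "bot_row (back_rows \<pi> \<tau>) = move_last (bot_row \<pi>) (loser \<pi> \<tau>)"
  | (bot) "entry_sum \<tau> \<ge> 0" "bot_row \<pi> (winner \<pi> \<tau>) = CARD('a)"
      "top_row \<pi> (loser \<pi> \<tau>) = top_row \<pi> (winner \<pi> \<tau>) + 1"
      "top_row (back_rows \<pi> \<tau>) = move_last (top_row \<pi>) (loser \<pi> \<tau>)"
      "bot_row (back_rows \<pi> \<tau>) = bot_row \<pi>"
proof (cases "entry_sum \<tau> < 0")
  case True
  note t = suspended_bij(1)[OF sus] and b = suspended_bij(2)[OF sus]
  have w: "top_row \<pi> (winner \<pi> \<tau>) = CARD('a)"
    using True card by (simp add: winner_def bij_row_inv[OF t])
  then have "bot_row \<pi> (winner \<pi> \<tau>) \<noteq> CARD('a)"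
    using suspended_last_differ[OF sus card] by blast
  then have "bot_row \<pi> (winner \<pi> \<tau>) + 1 \<le> CARD('a)"
    using bij_row_range(2)[OF b, of "winner \<pi> \<tau>"] by simp
  then have "bot_row \<pi> (loser \<pi> \<tau>) = bot_row \<pi> (winner \<pi> \<tau>) + 1"
    using True by (simp add: loser_def bij_row_inv[OF b])
  with True w show ?thesis by (intro top) (auto simp: back_rows_def)
next
  case False
  note t = suspended_bij(1)[OF sus] and b = suspended_bij(2)[OF sus]
  have w: "bot_row \<pi> (winner \<pi> \<tau>) = CARD('a)"
    using False card by (simp add: winner_def bij_row_inv[OF b])
  then have "top_row \<pi> (winner \<pi> \<tau>) \<noteq> CARD('a)"
    using suspended_last_differ[OF sus card] by blast
  then have "top_row \<pi> (winner \<pi> \<tau>) + 1 \<le> CARD('a)"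
    using bij_row_range(2)[OF t, of "winner \<pi> \<tau>"] by simp
  then have "top_row \<pi> (loser \<pi> \<tau>) = top_row \<pi> (winner \<pi> \<tau>) + 1"
    using False by (simp add: loser_def bij_row_inv[OF t])
  with False w show ?thesis by (intro bot) (auto simp: back_rows_def)
qed

lemma winner_neq_loser:
  fixes \<pi> :: "'a::finite rows"
  assumes "suspended \<pi> \<tau>" "CARD('a) \<ge> 2"
  shows "winner \<pi> \<tau> \<noteq> loser \<pi> \<tau>"
  using assms by (cases rule: arrow_cases) auto

text \<open>The same rule serves twice: applied to \<open>\<tau>\<close> it gives the new heights, applied to the lengths it gives the
  new intervals and translations.\<close>

lemma sum_before_back_rows:
  fixes \<pi> :: "'a::finite rows" and \<tau> v :: "real ^ 'a"
  assumes sus: "suspended \<pi> \<tau>" and card: "CARD('a) \<ge> 2"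
  defines "w \<equiv> winner \<pi> \<tau>" and "a \<equiv> loser \<pi> \<tau>"
  shows "sum_before (top_row (back_rows \<pi> \<tau>)) (add_entry w a v) \<alpha> =
           (if \<alpha> = a \<and> \<not> entry_sum \<tau> < 0 then entry_sum v else sum_before (top_row \<pi>) v \<alpha>)" (is ?A)
    and "sum_before (bot_row (back_rows \<pi> \<tau>)) (add_entry w a v) \<alpha> =
           (if \<alpha> = a \<and> entry_sum \<tau> < 0 then entry_sum v else sum_before (bot_row \<pi>) v \<alpha>)" (is ?B)
    and "entry_sum \<tau> < 0 \<Longrightarrow> sum_before (top_row \<pi>) v w = entry_sum v - v $ w"
    and "entry_sum \<tau> < 0 \<Longrightarrow> sum_before (bot_row \<pi>) v a = sum_before (bot_row \<pi>) v w + v $ w"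
    and "\<not> entry_sum \<tau> < 0 \<Longrightarrow> sum_before (bot_row \<pi>) v w = entry_sum v - v $ w"
    and "\<not> entry_sum \<tau> < 0 \<Longrightarrow> sum_before (top_row \<pi>) v a = sum_before (top_row \<pi>) v w + v $ w"
proof -
  note t = suspended_bij(1)[OF sus] and b = suspended_bij(2)[OF sus]
  from sus card show ?A ?B
    by (cases rule: arrow_cases;
        simp add: w_def a_def sum_before_add_entry_last[OF t] sum_before_add_entry_last[OF b]
          sum_before_move_last[OF t] sum_before_move_last[OF b])+
  show "entry_sum \<tau> < 0 \<Longrightarrow> sum_before (top_row \<pi>) v w = entry_sum v - v $ w"
    using sus card sum_before_last[OF t, of w v] by (cases rule: arrow_cases) (auto simp: w_def)
  show "entry_sum \<tau> < 0 \<Longrightarrow> sum_before (bot_row \<pi>) v a = sum_before (bot_row \<pi>) v w + v $ w"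
    using sus card sum_before_next[OF b, of a w v] by (cases rule: arrow_cases) (auto simp: w_def a_def)
  show "\<not> entry_sum \<tau> < 0 \<Longrightarrow> sum_before (bot_row \<pi>) v w = entry_sum v - v $ w"
    using sus card sum_before_last[OF b, of w v] by (cases rule: arrow_cases) (auto simp: w_def)
  show "\<not> entry_sum \<tau> < 0 \<Longrightarrow> sum_before (top_row \<pi>) v a = sum_before (top_row \<pi>) v w + v $ w"
    using sus card sum_before_next[OF t, of a w v] by (cases rule: arrow_cases) (auto simp: w_def a_def)
qed

lemma bij_back_rows:
  fixes \<pi> :: "'a::finite rows"
  assumes "suspended \<pi> \<tau>"
  shows "bij_rows (back_rows \<pi> \<tau>)"
  using suspended_bij[OF assms] move_last_bij by (auto simp: back_rows_def bij_rows_def)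

lemma suspended_step:
  fixes \<pi> :: "'a::finite rows" and \<tau> :: "real ^ 'a"
  assumes sus: "suspended \<pi> \<tau>" and card: "CARD('a) \<ge> 2" and nz: "entry_sum \<tau> \<noteq> 0"
  shows "suspended (back_rows \<pi> \<tau>) (add_entry (winner \<pi> \<tau>) (loser \<pi> \<tau>) \<tau>)"
proof -
  have ml: "1 < r \<alpha>" if "1 < move_last r a \<alpha>" "\<alpha> \<noteq> a" for r a and \<alpha> :: 'a
    using that by (auto simp: move_last_def split: if_splits)
  from sus card show ?thesis
  proof (cases rule: arrow_cases)
    case top
    then show ?thesis
      using sus bij_back_rows[OF sus] ml
      unfolding suspended_def sum_before_back_rows[OF sus card] by auto
  next
    case bot
    then show ?thesis
      using sus bij_back_rows[OF sus] ml nz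
      unfolding suspended_def sum_before_back_rows[OF sus card] by auto
  qed
qed

lemma heights_step:
  fixes \<pi> :: "'a::finite rows" and \<tau> :: "real ^ 'a"
  assumes sus: "suspended \<pi> \<tau>" and card: "CARD('a) \<ge> 2"
  defines "w \<equiv> winner \<pi> \<tau>" and "a \<equiv> loser \<pi> \<tau>"
  defines "q' \<equiv> heights (back_rows \<pi> \<tau>) (add_entry w a \<tau>)"
  shows "heights \<pi> \<tau> $ \<alpha> = (if \<alpha> = a then q' $ a + q' $ w else q' $ \<alpha>)"
proof -
  note sb = sum_before_back_rows[OF sus card, folded w_def a_def]
  have wa: "w \<noteq> a" using winner_neq_loser[OF sus card] by (simp add: w_def a_def)
  have bij: "bij_rows \<pi>" using sus by (simp add: suspended_def)
  show ?thesis
    unfolding q'_def heights_eq_sum_before[OF bij_back_rows[OF sus]] heights_eq_sum_before[OF bij] sb(1,2)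
    using wa sb(3-6)[of \<tau>] by auto
qed

text \<open>The loser is moved to the end of its row, so it is the winner of the next arrow if that has the other
  type. The winner stays at the end of its row.\<close>

lemma next_winner:
  fixes \<pi> :: "'a::finite rows" and \<tau> :: "real ^ 'a"
  assumes sus: "suspended \<pi> \<tau>" and card: "CARD('a) \<ge> 2"
  shows "winner (back_rows \<pi> \<tau>) \<tau>' \<in> {winner \<pi> \<tau>, loser \<pi> \<tau>}"
proof -
  have t: "bij_betw (top_row (back_rows \<pi> \<tau>)) UNIV {1..CARD('a)}"
   and b: "bij_betw (bot_row (back_rows \<pi> \<tau>)) UNIV {1..CARD('a)}"
    using bij_back_rows[OF sus] by (auto simp: bij_rows_def)
  note eqs = bij_row_inv_eq[OF t] bij_row_inv_eq[OF b]
  from sus card show ?thesis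
  proof (cases rule: arrow_cases)
    case top
    then have "inv (top_row (back_rows \<pi> \<tau>)) CARD('a) = winner \<pi> \<tau>"
      and "inv (bot_row (back_rows \<pi> \<tau>)) CARD('a) = loser \<pi> \<tau>"
      by (intro eqs; simp add: move_last_def)+
    then show ?thesis by (simp add: winner_def[of "back_rows \<pi> \<tau>"])
  next
    case bot
    then have "inv (top_row (back_rows \<pi> \<tau>)) CARD('a) = loser \<pi> \<tau>"
      and "inv (bot_row (back_rows \<pi> \<tau>)) CARD('a) = winner \<pi> \<tau>"
      by (intro eqs; simp add: move_last_def)+
    then show ?thesis by (simp add: winner_def[of "back_rows \<pi> \<tau>"])
  qed
qed

section \<open>The infinite path and its substitutions\<close>

text \<open>By \<open>infinity_complete\<close> the sum of the suspension vector never vanishes, so every step below is defined.\<close>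

locale backward_path =
  fixes \<pi> :: "'a::finite rows" and \<tau> :: "real ^ 'a"
  assumes card_ge_2: "CARD('a) \<ge> 2"
    and suspended: "suspended \<pi> \<tau>"
    and complete: "infinity_complete \<pi> \<tau>"
begin

lemma rows_seq_Suc:
  "rows_seq \<pi> \<tau> (Suc k) = back_rows (rows_seq \<pi> \<tau> k) (susp_seq \<pi> \<tau> k)"
  by (simp add: rows_seq_def susp_seq_def split_beta)

lemma susp_seq_Suc:
  "susp_seq \<pi> \<tau> (Suc k) = add_entry (win \<pi> \<tau> k) (lose \<pi> \<tau> k) (susp_seq \<pi> \<tau> k)"
  by (simp add: rows_seq_def susp_seq_def win_def lose_def split_beta)

lemma suspended_seq: "suspended (rows_seq \<pi> \<tau> k) (susp_seq \<pi> \<tau> k)"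
proof (induction k)
  case 0
  then show ?case using suspended by (simp add: rows_seq_def susp_seq_def)
next
  case (Suc k)
  have "entry_sum (susp_seq \<pi> \<tau> k) \<noteq> 0" using complete by (simp add: infinity_complete_def)
  with suspended_step[OF Suc card_ge_2] show ?case
    by (simp add: rows_seq_Suc susp_seq_Suc win_def lose_def)
qed

lemma win_neq_lose: "win \<pi> \<tau> k \<noteq> lose \<pi> \<tau> k"
  unfolding win_def lose_def by (rule winner_neq_loser[OF suspended_seq card_ge_2])

lemma win_Suc: "win \<pi> \<tau> (Suc k) \<in> {win \<pi> \<tau> k, lose \<pi> \<tau> k}"
  using next_winner[OF suspended_seq card_ge_2, of k] by (simp add: win_def lose_def rows_seq_Suc)

lemma heights_seq_pos: "heights_seq \<pi> \<tau> k $ \<alpha> > 0"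
  unfolding heights_seq_def by (rule suspended_heights_pos[OF suspended_seq card_ge_2])

lemma heights_seq_0: "heights_seq \<pi> \<tau> 0 = heights \<pi> \<tau>"
  by (simp add: heights_seq_def rows_seq_def susp_seq_def)

text \<open>The rectangle of the loser is the pile of two rectangles of the next level; the word lists
  them from the bottom.\<close>

definition subst :: "nat \<Rightarrow> 'a \<Rightarrow> 'a list" where
  "subst k \<beta> = (if \<beta> = lose \<pi> \<tau> k
     then if entry_sum (susp_seq \<pi> \<tau> k) < 0
       then [lose \<pi> \<tau> k, win \<pi> \<tau> k] else [win \<pi> \<tau> k, lose \<pi> \<tau> k]
     else [\<beta>])"

text \<open>The rule by which the heights, and the coordinates \<open>\<chi>\<close> of a class, are recovered from the next
  level.\<close>

definition compatible :: "(nat \<Rightarrow> 'a \<Rightarrow> real) \<Rightarrow> bool" where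
  "compatible f \<longleftrightarrow> (\<forall>k \<beta>. f k \<beta> =
     (if \<beta> = lose \<pi> \<tau> k then f (Suc k) (lose \<pi> \<tau> k) + f (Suc k) (win \<pi> \<tau> k) else f (Suc k) \<beta>))"

lemma compatible_heights: "compatible (\<lambda>k \<beta>. heights_seq \<pi> \<tau> k $ \<beta>)"
  unfolding compatible_def heights_seq_def rows_seq_Suc susp_seq_Suc win_def lose_def
  by (intro allI heights_step[OF suspended_seq card_ge_2])

lemma compatible_chi: "compatible (\<lambda>k \<beta>. chi_vec \<pi> \<tau> \<Upsilon> k $ \<beta>)"
  using win_neq_lose
  by (simp add: compatible_def chi_vec_def intersection_def algebra_simps sum_subtractf flip: sum.distrib)

text \<open>\<open>descend m n \<beta>\<close> is the word, in the letters of level \<open>m + n\<close>, of the rectangles that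
  pile up to the rectangle \<open>\<beta>\<close> of level \<open>m\<close>.\<close>

primrec descend :: "nat \<Rightarrow> nat \<Rightarrow> 'a \<Rightarrow> 'a list" where
  "descend m 0 \<beta> = [\<beta>]"
| "descend m (Suc n) \<beta> = concat (map (subst (m + n)) (descend m n \<beta>))"

lemma descend_add:
  "descend m (n + n') \<beta> = concat (map (descend (m + n) n') (descend m n \<beta>))"
proof (induction n')
  case (Suc n')
  have *: "concat (map f (concat (map g xs))) = concat (map (\<lambda>x. concat (map f (g x))) xs)" for f g xs
    by (induction xs) auto
  show ?case using Suc by (simp add: * add.assoc)
qed simp

lemma compatible_subst:
  assumes "compatible f"
  shows "sum_list (map (f (Suc k)) (subst k \<beta>)) = f k \<beta>"
proof -
  have "f k \<beta> = (if \<beta> = lose \<pi> \<tau> k then f (Suc k) (lose \<pi> \<tau> k) + f (Suc k) (win \<pi> \<tau> k) else f (Suc k) \<beta>)"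
    using assms unfolding compatible_def by blast
  then show ?thesis by (simp add: subst_def)
qed

lemma sum_list_concat: "sum_list (map f (concat (map g xs))) = sum_list (map (\<lambda>x. sum_list (map f (g x))) xs)"
  for f :: "'b \<Rightarrow> real"
  by (induction xs) auto

lemma compatible_descend:
  assumes "compatible f"
  shows "sum_list (map (f (m + n)) (descend m n \<beta>)) = f m \<beta>"
  by (induction n) (simp_all add: sum_list_concat compatible_subst[OF assms])

lemma descend_nonempty: "descend m n \<beta> \<noteq> []"
  using compatible_descend[OF compatible_heights, of m n \<beta>] heights_seq_pos[of m \<beta>] by auto

text \<open>The matrices count letters: column operations on \<open>B\<close> are substitutions on words.\<close>

lemma B_mat_refl: "B_mat \<pi> \<tau> k k = mat 1"
  by (simp add: B_mat_def)

lemma B_mat_Suc: "j \<le> k \<Longrightarrow> B_mat \<pi> \<tau> (Suc k) j = B_mat \<pi> \<tau> k j ** arrow_mat \<pi> \<tau> k"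
proof -
  have *: "foldr (\<lambda>i P. arrow_mat \<pi> \<tau> i ** P) xs A = foldr (\<lambda>i P. arrow_mat \<pi> \<tau> i ** P) xs (mat 1) ** A" for xs A
    by (induction xs) (simp_all add: matrix_mul_assoc)
  show "j \<le> k \<Longrightarrow> ?thesis" by (simp add: B_mat_def *[of _ "arrow_mat \<pi> \<tau> k"])
qed

lemma B_mat_mult:
  assumes "i \<le> j" "j \<le> k"
  shows "B_mat \<pi> \<tau> k i = B_mat \<pi> \<tau> j i ** B_mat \<pi> \<tau> k j"
  using assms(2,1)
  by (induction k rule: dec_induct) (simp_all add: B_mat_refl B_mat_Suc matrix_mul_assoc)

lemma mult_arrow_mat:
  "(A ** arrow_mat \<pi> \<tau> k) $ \<alpha> $ \<beta> =
     A $ \<alpha> $ \<beta> + (if \<beta> = win \<pi> \<tau> k then A $ \<alpha> $ lose \<pi> \<tau> k else 0)"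
proof -
  have "(A ** arrow_mat \<pi> \<tau> k) $ \<alpha> $ \<beta> = (\<Sum>\<gamma>\<in>UNIV. A $ \<alpha> $ \<gamma> * (if \<gamma> = \<beta> then 1 else 0)
      + A $ \<alpha> $ \<gamma> * (if \<gamma> = lose \<pi> \<tau> k \<and> \<beta> = win \<pi> \<tau> k then 1 else 0))"
    by (simp add: matrix_matrix_mult_def arrow_mat_def mat_def distrib_left)
  then show ?thesis
    by (cases "\<beta> = win \<pi> \<tau> k") (simp_all add: sum.distrib if_distrib[of "\<lambda>x. _ * x"] cong: if_cong)
qed

lemma count_list_concat: "count_list (concat (map g xs)) \<gamma> = sum_list (map (\<lambda>x. count_list (g x) \<gamma>) xs)"
  by (induction xs) auto

lemma count_descend: "real (count_list (descend m n \<beta>) \<gamma>) = B_mat \<pi> \<tau> (m + n) m $ \<beta> $ \<gamma>"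
proof (induction n arbitrary: \<gamma>)
  case 0
  then show ?case by (simp add: B_mat_refl mat_def)
next
  case (Suc n)
  have "sum_list (map (\<lambda>x. count_list (subst (m + n) x) \<gamma>) ws) = count_list ws \<gamma> +
      (if \<gamma> = win \<pi> \<tau> (m + n) then count_list ws (lose \<pi> \<tau> (m + n)) else 0)" for ws
    using win_neq_lose[of "m + n"] by (induction ws) (auto simp: subst_def)
  then show ?case
    using Suc by (simp add: count_list_concat B_mat_Suc mult_arrow_mat)
qed

lemma B_mat_nonneg: "j \<le> k \<Longrightarrow> B_mat \<pi> \<tau> k j $ \<alpha> $ \<beta> \<ge> 0"
  using count_descend[of j "k - j" \<alpha> \<beta>] by (metis le_add_diff_inverse of_nat_0_le_iff)

lemma sum_list_count:
  fixes f :: "'a \<Rightarrow> real"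
  shows "sum_list (map f ws) = (\<Sum>\<beta>\<in>UNIV. real (count_list ws \<beta>) * f \<beta>)"
proof (induction ws)
  case (Cons w ws)
  have "(\<Sum>\<beta>\<in>UNIV. real (count_list (w # ws) \<beta>) * f \<beta>) =
      (\<Sum>\<beta>\<in>UNIV. (if \<beta> = w then f \<beta> else 0) + real (count_list ws \<beta>) * f \<beta>)"
    by (rule sum.cong) (auto simp: distrib_right)
  with Cons show ?case by (simp add: sum.distrib)
qed simp

lemma compatible_B_mat:
  assumes "compatible f" "j \<le> k"
  shows "f j \<alpha> = (\<Sum>\<beta>\<in>UNIV. B_mat \<pi> \<tau> k j $ \<alpha> $ \<beta> * f k \<beta>)"
  using compatible_descend[OF assms(1), of j "k - j" \<alpha>] assms(2)
  by (simp add: sum_list_count count_descend)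

lemma length_descend: "real (length (descend m n \<alpha>)) = (\<Sum>\<beta>\<in>UNIV. B_mat \<pi> \<tau> (m + n) m $ \<alpha> $ \<beta>)"
  using sum_list_count[of "\<lambda>_. 1" "descend m n \<alpha>"] by (simp add: count_descend sum_list_triv)

lemma return_time_eq: "return_time \<pi> \<tau> k \<alpha> = length (descend 0 k \<alpha>)"
  unfolding return_time_def using length_descend[of 0 k \<alpha>] by (metis add_0 floor_of_nat nat_int)


section \<open>Itineraries\<close>

context
  fixes l :: "real ^ 'a"
  assumes length_pos: "\<And>\<alpha>. l $ \<alpha> > 0"
begin

lemma length_seq_pos: "length_seq \<pi> l \<tau> k $ \<alpha> > 0"
  by (induction k arbitrary: \<alpha>) (auto simp: length_pos add_entry_def add_pos_pos)

lemma interval_seq_disjoint: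
  assumes "x \<in> interval_seq \<pi> l \<tau> k \<alpha>" "x \<in> interval_seq \<pi> l \<tau> k \<beta>"
  shows "\<alpha> = \<beta>"
proof (rule ccontr)
  assume "\<alpha> \<noteq> \<beta>"
  define r L where "r = top_row (rows_seq \<pi> \<tau> k)" and "L = length_seq \<pi> l \<tau> k"
  have ordered: "sum_before r L \<gamma> + L $ \<gamma> \<le> sum_before r L \<delta>" if "r \<gamma> < r \<delta>" for \<gamma> \<delta>
  proof -
    have "sum_before r L \<gamma> + L $ \<gamma> = (\<Sum>\<beta>\<in>insert \<gamma> {\<beta>. r \<beta> < r \<gamma>}. L $ \<beta>)"
      by (simp add: sum_before_def)
    also have "\<dots> \<le> sum_before r L \<delta>"
      unfolding sum_before_def using that length_seq_pos
      by (intro sum_mono2) (auto simp: L_def less_imp_le)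
    finally show ?thesis .
  qed
  have "r \<alpha> \<noteq> r \<beta>"
    using \<open>\<alpha> \<noteq> \<beta>\<close> bij_row_inj[OF suspended_bij(1)[OF suspended_seq]] by (simp add: r_def)
  then show False
    using assms ordered[of \<alpha> \<beta>] ordered[of \<beta> \<alpha>]
    by (auto simp: interval_seq_def exch_interval_def neq_iff simp flip: r_def L_def)
qed

lemma iem_seq_eq:
  assumes "x \<in> interval_seq \<pi> l \<tau> k \<alpha>"
  shows "iem_seq \<pi> l \<tau> k x = x + translation (rows_seq \<pi> \<tau> k) (length_seq \<pi> l \<tau> k) \<alpha>"
proof -
  have "{\<beta>. x \<in> interval_seq \<pi> l \<tau> k \<beta>} = {\<alpha>}"
    using assms interval_seq_disjoint by blast
  then show ?thesis by (simp add: iem_seq_def iem_def interval_seq_def)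
qed

primrec visits :: "nat \<Rightarrow> 'a list \<Rightarrow> real \<Rightarrow> bool" where
  "visits k [] x \<longleftrightarrow> True"
| "visits k (\<beta> # ws) x \<longleftrightarrow> x \<in> interval_seq \<pi> l \<tau> k \<beta> \<and> visits k ws (iem_seq \<pi> l \<tau> k x)"

lemma visits_nth:
  "visits k ws x \<Longrightarrow> i < length ws \<Longrightarrow> (iem_seq \<pi> l \<tau> k ^^ i) x \<in> interval_seq \<pi> l \<tau> k (ws ! i)"
proof (induction ws arbitrary: x i)
  case (Cons \<beta> ws)
  then show ?case by (cases i) (auto simp: funpow_swap1)
qed simp

lemma visits_append:
  "visits k (us @ ws) x \<longleftrightarrow> visits k us x \<and> visits k ws ((iem_seq \<pi> l \<tau> k ^^ length us) x)"
  by (induction us arbitrary: x) (auto simp: funpow_swap1)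

text \<open>The level \<open>k\<close> map is the first return of the level \<open>k + 1\<close> map to a shorter interval; a
  point of the loser interval needs two iterations, through the intervals of loser and winner in the
  order given by the type of the arrow.\<close>

lemma visits_subst:
  assumes "x \<in> interval_seq \<pi> l \<tau> k \<beta>"
  shows "visits (Suc k) (subst k \<beta>) x"
    and "(iem_seq \<pi> l \<tau> (Suc k) ^^ length (subst k \<beta>)) x = iem_seq \<pi> l \<tau> k x"
proof -
  define w a L L' e where "w = win \<pi> \<tau> k" and "a = lose \<pi> \<tau> k"
    and "L = length_seq \<pi> l \<tau> k" and "L' = length_seq \<pi> l \<tau> (Suc k)" and "e = entry_sum (susp_seq \<pi> \<tau> k)"
  define t b where "t = sum_before (top_row (rows_seq \<pi> \<tau> k)) L"
    and "b = sum_before (bot_row (rows_seq \<pi> \<tau> k)) L"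
  have L': "L' = add_entry w a L" by (simp add: L'_def L_def w_def a_def)
  have L'_nth: "L' $ \<gamma> = (if \<gamma> = w then L $ w + L $ a else L $ \<gamma>)" for \<gamma>
    by (simp add: L' add_entry_def)
  note sb = sum_before_back_rows[OF suspended_seq[of k] card_ge_2, of L,
      folded e_def, folded win_def lose_def, folded w_def a_def, folded L' t_def b_def, folded rows_seq_Suc, folded t_def b_def]
  have wa: "w \<noteq> a" using win_neq_lose by (simp add: w_def a_def)
  have pos: "L $ \<gamma> > 0" for \<gamma> using length_seq_pos by (simp add: L_def)
  have I: "y \<in> interval_seq \<pi> l \<tau> k \<gamma> \<longleftrightarrow> t \<gamma> \<le> y \<and> y < t \<gamma> + L $ \<gamma>" for y \<gamma>
    by (simp add: interval_seq_def exch_interval_def t_def L_def)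
  have I': "y \<in> interval_seq \<pi> l \<tau> (Suc k) \<gamma> \<longleftrightarrow>
      (if \<gamma> = a \<and> \<not> e < 0 then entry_sum L else t \<gamma>) \<le> y \<and>
      y < (if \<gamma> = a \<and> \<not> e < 0 then entry_sum L else t \<gamma>) + (if \<gamma> = w then L $ w + L $ a else L $ \<gamma>)" for y \<gamma>
    unfolding interval_seq_def exch_interval_def L'_def[symmetric] sb(1) L'_nth by simp
  have T: "iem_seq \<pi> l \<tau> k y = y + b \<gamma> - t \<gamma>" if "y \<in> interval_seq \<pi> l \<tau> k \<gamma>" for y \<gamma>
    using iem_seq_eq[OF that] by (simp add: translation_def t_def b_def L_def)
  have T': "iem_seq \<pi> l \<tau> (Suc k) y = y + (if \<gamma> = a \<and> e < 0 then entry_sum L else b \<gamma>)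
      - (if \<gamma> = a \<and> \<not> e < 0 then entry_sum L else t \<gamma>)" if "y \<in> interval_seq \<pi> l \<tau> (Suc k) \<gamma>" for y \<gamma>
    using iem_seq_eq[OF that] unfolding translation_def L'_def[symmetric] sb(1,2) by simp
  have "visits (Suc k) (subst k \<beta>) x \<and>
    (iem_seq \<pi> l \<tau> (Suc k) ^^ length (subst k \<beta>)) x = iem_seq \<pi> l \<tau> k x"
  proof (cases "\<beta> = a")
    case False
    then have "x \<in> interval_seq \<pi> l \<tau> (Suc k) \<beta>"
      using assms pos[of a] unfolding I I' by auto
    with False T[OF assms] T'[OF this] show ?thesis by (simp add: subst_def flip: a_def)
  next
    case True
    show ?thesis
    proof (cases "e < 0")
      case e: True
      have 1: "x \<in> interval_seq \<pi> l \<tau> (Suc k) a"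
        using assms e wa unfolding I I' True by auto
      have eq1: "iem_seq \<pi> l \<tau> (Suc k) x = x + entry_sum L - t a" using T'[OF 1] e by simp
      have 2: "x + entry_sum L - t a \<in> interval_seq \<pi> l \<tau> (Suc k) w"
        using assms e wa pos[of w] sb(3)[OF e] unfolding I I' True by auto
      have eq2: "iem_seq \<pi> l \<tau> (Suc k) (x + entry_sum L - t a) = iem_seq \<pi> l \<tau> k x"
        using T'[OF 2] wa e sb(3,4)[OF e] T[OF assms] True by auto
      show ?thesis using e True 1 2 eq1 eq2 by (simp add: subst_def flip: a_def w_def e_def)
    next
      case e: False
      have 1: "x \<in> interval_seq \<pi> l \<tau> (Suc k) w"
        using assms e wa pos[of w] sb(6)[OF e] unfolding I I' True by auto
      have eq1: "iem_seq \<pi> l \<tau> (Suc k) x = x + b w - t w" using T'[OF 1] e wa by simp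
      have 2: "x + b w - t w \<in> interval_seq \<pi> l \<tau> (Suc k) a"
        using assms e wa sb(5,6)[OF e] unfolding I I' True by auto
      have eq2: "iem_seq \<pi> l \<tau> (Suc k) (x + b w - t w) = iem_seq \<pi> l \<tau> k x"
        using T'[OF 2] wa e sb(5,6)[OF e] T[OF assms] True by auto
      show ?thesis using e True wa 1 2 eq1 eq2 by (simp add: subst_def flip: a_def w_def e_def)
    qed
  qed
  then show "visits (Suc k) (subst k \<beta>) x"
    and "(iem_seq \<pi> l \<tau> (Suc k) ^^ length (subst k \<beta>)) x = iem_seq \<pi> l \<tau> k x"
    by blast+
qed

lemma visits_concat_subst:
  "visits k ws x \<Longrightarrow> visits (Suc k) (concat (map (subst k) ws)) x"
proof (induction ws arbitrary: x)
  case (Cons \<beta> ws)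
  then show ?case using visits_subst[of x k \<beta>] by (simp add: visits_append)
qed simp

lemma visits_descend:
  assumes "x \<in> interval_seq \<pi> l \<tau> 0 \<alpha>"
  shows "visits k (descend 0 k \<alpha>) x"
  by (induction k) (use assms visits_concat_subst in auto)

lemma itinerary_eq:
  assumes "i < length (descend 0 k \<alpha>)"
  shows "itinerary \<pi> l \<tau> k \<alpha> i = descend 0 k \<alpha> ! i"
proof -
  have *: "(iem_seq \<pi> l \<tau> k ^^ i) x \<in> interval_seq \<pi> l \<tau> k (descend 0 k \<alpha> ! i)"
    if "x \<in> interval_seq \<pi> l \<tau> 0 \<alpha>" for x
    using visits_nth[OF visits_descend[OF that] assms] .
  have "left_end \<pi> l \<alpha> \<in> interval_seq \<pi> l \<tau> 0 \<alpha>"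
    using length_pos by (simp add: interval_seq_def exch_interval_def rows_seq_def left_end_def)
  then show ?thesis
    unfolding itinerary_def
    by (intro the_equality) (use * interval_seq_disjoint in blast)+
qed

end

end

section \<open>Broken lines as sums of ramps\<close>

definition ramp :: "real \<Rightarrow> real" where
  "ramp u = max 0 (min 1 u)"

definition rise :: "('a \<Rightarrow> real) \<Rightarrow> ('a \<Rightarrow> real) \<Rightarrow> 'a \<Rightarrow> real \<Rightarrow> real \<Rightarrow> real" where
  "rise q c \<beta> s x = c \<beta> * ramp ((x - s) / q \<beta>)"

text \<open>The word \<open>ws\<close> divides an interval starting at \<open>s\<close> into consecutive pieces of length \<open>q \<beta>\<close>;
  \<open>tile q g s ws\<close> is the sum over the pieces of the function \<open>g \<beta>\<close> placed at the left end of the piece. With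
  \<open>g = rise q c\<close> this is the broken line with increments \<open>(q \<beta>, c \<beta>)\<close>. As a sum it needs no case
  distinction between pieces, and words may be regrouped freely.\<close>

primrec tile :: "('a \<Rightarrow> real) \<Rightarrow> ('a \<Rightarrow> real \<Rightarrow> real \<Rightarrow> real) \<Rightarrow> real \<Rightarrow> 'a list \<Rightarrow> real \<Rightarrow> real" where
  "tile q g s [] x = 0"
| "tile q g s (\<beta> # ws) x = g \<beta> s x + tile q g (s + q \<beta>) ws x"

lemma tile_append: "tile q g s (us @ ws) x = tile q g s us x + tile q g (s + sum_list (map q us)) ws x"
  by (induction us arbitrary: s) (simp_all add: add.assoc)

lemma tile_concat:
  assumes "\<And>\<beta>. sum_list (map q' (\<sigma> \<beta>)) = q \<beta>"
  shows "tile q' g s (concat (map \<sigma> ws)) x = tile q (\<lambda>\<beta> s. tile q' g s (\<sigma> \<beta>)) s ws x"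
  by (induction ws arbitrary: s) (simp_all add: tile_append assms)

lemma tile_diff: "tile q g s ws x - tile q g' s ws x = tile q (\<lambda>\<beta> s x. g \<beta> s x - g' \<beta> s x) s ws x"
  by (induction ws arbitrary: s) (simp_all add: algebra_simps flip: diff_diff_eq)

lemma continuous_on_tile:
  assumes "\<And>\<beta> s. continuous_on A (g \<beta> s)"
  shows "continuous_on A (tile q g s ws)"
proof (induction ws arbitrary: s)
  case Nil
  then show ?case by (simp add: tile.simps[abs_def])
next
  case (Cons \<beta> ws)
  then show ?case using assms by (simp add: tile.simps[abs_def] continuous_on_add)
qed

lemma continuous_on_rise: "q \<beta> \<noteq> 0 \<Longrightarrow> continuous_on A (rise q c \<beta> s)"
  unfolding rise_def[abs_def] ramp_def by (intro continuous_intros) auto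

lemma ramp_before: "q > 0 \<Longrightarrow> x \<le> s \<Longrightarrow> ramp ((x - s) / q) = 0"
  by (simp add: ramp_def divide_nonpos_pos)

lemma ramp_after: "q > 0 \<Longrightarrow> s + q \<le> x \<Longrightarrow> ramp ((x - s) / q) = 1"
proof -
  assume "q > 0" "s + q \<le> x"
  then have "1 \<le> (x - s) / q" by (simp add: field_simps)
  then show ?thesis by (simp add: ramp_def)
qed

lemma ramp_bounds: "0 \<le> ramp u" "ramp u \<le> 1"
  by (simp_all add: ramp_def)

lemma sum_list_pos: "(\<And>\<beta>. 0 < q \<beta>) \<Longrightarrow> 0 \<le> sum_list (map q ws)" for q :: "'a \<Rightarrow> real"
  by (induction ws) (auto simp: add_nonneg_nonneg less_imp_le)

lemma tile_rise_before:
  assumes "\<And>\<beta>. q \<beta> > 0" "x \<le> s"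
  shows "tile q (rise q c) s ws x = 0"
  using assms(2)
proof (induction ws arbitrary: s)
  case (Cons \<beta> ws)
  then show ?case
    using assms(1)[of \<beta>] Cons.IH[of "s + q \<beta>"] by (simp add: rise_def ramp_before)
qed simp

lemma tile_rise_after:
  assumes "\<And>\<beta>. q \<beta> > 0" "s + sum_list (map q ws) \<le> x"
  shows "tile q (rise q c) s ws x = sum_list (map c ws)"
  using assms(2)
proof (induction ws arbitrary: s)
  case (Cons \<beta> ws)
  then show ?case
    using assms(1)[of \<beta>] Cons.IH[of "s + q \<beta>"] sum_list_pos[of q ws, OF assms(1)]
    by (simp add: rise_def ramp_after add.assoc)
qed simp

lemma tile_rise_bound: "\<bar>tile q (rise q c) s ws x\<bar> \<le> sum_list (map (\<lambda>\<beta>. \<bar>c \<beta>\<bar>) ws)"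
proof (induction ws arbitrary: s)
  case (Cons \<beta> ws)
  have "\<bar>rise q c \<beta> s x\<bar> \<le> \<bar>c \<beta>\<bar>"
    using ramp_bounds[of "(x - s) / q \<beta>"] by (simp add: rise_def abs_mult mult_left_le)
  then show ?case using Cons[of "s + q \<beta>"] by simp
qed simp

lemma tile_rise_shift: "tile q (rise q c) (s + r) ws x = tile q (rise q c) r ws (x - s)"
proof (induction ws arbitrary: r)
  case (Cons \<beta> ws)
  then show ?case by (simp add: rise_def add.assoc diff_diff_eq)
qed simp

lemma closed_segment_ramp:
  fixes s x a b y z :: real
  assumes "a > 0"
  shows "(x, y) \<in> closed_segment (s, z) (s + a, z + b) \<longleftrightarrow>
    s \<le> x \<and> x \<le> s + a \<and> y = z + b * ramp ((x - s) / a)"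
proof
  assume "(x, y) \<in> closed_segment (s, z) (s + a, z + b)"
  then obtain u where u: "0 \<le> u" "u \<le> 1" "x = s + u * a" "y = z + u * b"
    by (auto simp: closed_segment_def algebra_simps)
  then have "ramp ((x - s) / a) = u" using assms by (simp add: ramp_def)
  with u assms show "s \<le> x \<and> x \<le> s + a \<and> y = z + b * ramp ((x - s) / a)"
    by (simp add: mult_left_le_one_le)
next
  assume *: "s \<le> x \<and> x \<le> s + a \<and> y = z + b * ramp ((x - s) / a)"
  define u where "u = (x - s) / a"
  have u: "0 \<le> u" "u \<le> 1" "x = s + u * a" using * assms by (auto simp: u_def field_simps)
  moreover have "ramp u = u" using u by (simp add: ramp_def)
  ultimately show "(x, y) \<in> closed_segment (s, z) (s + a, z + b)"
    using * unfolding closed_segment_def u_def[symmetric] by (auto simp: algebra_simps intro!: exI[of _ u])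
qed

text \<open>The next two lemmas determine the value of a broken line, given by its vertices, at every point; at a
  vertex the two adjacent segments agree.\<close>

lemma broken_line_unique:
  assumes pos: "\<And>\<beta>. q \<beta> > 0" and "j < length ws"
    and "(x, y) \<in> closed_segment (s + (\<Sum>i<j. q (ws ! i)), z + (\<Sum>i<j. c (ws ! i)))
                                 (s + (\<Sum>i<Suc j. q (ws ! i)), z + (\<Sum>i<Suc j. c (ws ! i)))"
  shows "y = z + tile q (rise q c) s ws x"
  using assms(2,3)
proof (induction ws arbitrary: j s z)
  case (Cons \<beta> ws)
  show ?case
  proof (cases j)
    case 0
    then have "s \<le> x" "x \<le> s + q \<beta>" "y = z + rise q c \<beta> s x"
      using Cons.prems closed_segment_ramp[OF pos[of \<beta>]] by (auto simp: rise_def)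
    then show ?thesis using tile_rise_before[OF pos, of x "s + q \<beta>"] by simp
  next
    case (Suc i)
    have seg: "(x, y) \<in> closed_segment (s + q \<beta> + (\<Sum>i<i. q (ws ! i)), z + c \<beta> + (\<Sum>i<i. c (ws ! i)))
                (s + q \<beta> + (\<Sum>i<Suc i. q (ws ! i)), z + c \<beta> + (\<Sum>i<Suc i. c (ws ! i)))"
      using Cons.prems unfolding Suc sum.lessThan_Suc_shift by (simp add: add.assoc)
    have "s + q \<beta> + (\<Sum>i<i. q (ws ! i)) \<le> x"
      using seg closed_segment_ramp[OF pos, of x y _ _ "ws ! i"] by (simp flip: add.assoc)
    moreover have "0 \<le> (\<Sum>i<i. q (ws ! i))" using pos by (simp add: sum_nonneg less_imp_le)
    ultimately have "rise q c \<beta> s x = c \<beta>" using pos by (simp add: rise_def ramp_after)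
    moreover have "y = z + c \<beta> + tile q (rise q c) (s + q \<beta>) ws x"
      using Cons.prems(1) by (intro Cons.IH[OF _ seg]) (simp add: Suc)
    ultimately show ?thesis by simp
  qed
qed simp

lemma broken_line_exists:
  assumes pos: "\<And>\<beta>. q \<beta> > 0" and "ws \<noteq> []" "s \<le> x" "x \<le> s + sum_list (map q ws)"
  shows "\<exists>j<length ws. (x, z + tile q (rise q c) s ws x) \<in>
    closed_segment (s + (\<Sum>i<j. q (ws ! i)), z + (\<Sum>i<j. c (ws ! i)))
                   (s + (\<Sum>i<Suc j. q (ws ! i)), z + (\<Sum>i<Suc j. c (ws ! i)))"
  using assms(2-)
proof (induction ws arbitrary: s z)
  case (Cons \<beta> ws)
  show ?case
  proof (cases "x \<le> s + q \<beta>")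
    case True
    then have "(x, z + tile q (rise q c) s (\<beta> # ws) x) \<in> closed_segment (s, z) (s + q \<beta>, z + c \<beta>)"
      using Cons.prems tile_rise_before[OF pos, of x "s + q \<beta>"] closed_segment_ramp[OF pos[of \<beta>]]
      by (simp add: rise_def)
    then show ?thesis by (intro exI[of _ 0]) simp
  next
    case False
    then have "ws \<noteq> []" using Cons.prems by auto
    then obtain j where j: "j < length ws"
      "(x, z + c \<beta> + tile q (rise q c) (s + q \<beta>) ws x) \<in>
        closed_segment (s + q \<beta> + (\<Sum>i<j. q (ws ! i)), z + c \<beta> + (\<Sum>i<j. c (ws ! i)))
                   (s + q \<beta> + (\<Sum>i<Suc j. q (ws ! i)), z + c \<beta> + (\<Sum>i<Suc j. c (ws ! i)))"
      using Cons.IH[of "s + q \<beta>" "z + c \<beta>"] Cons.prems False by (auto simp: add.assoc)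
    moreover have "rise q c \<beta> s x = c \<beta>" using False pos by (simp add: rise_def ramp_after)
    ultimately show ?thesis
      by (intro exI[of _ "Suc j"]) (simp add: sum.lessThan_Suc_shift add.assoc del: sum.lessThan_Suc)
  qed
qed simp


section \<open>Sums of localized functions\<close>

definition localized :: "('a \<Rightarrow> real) \<Rightarrow> ('a \<Rightarrow> real \<Rightarrow> real \<Rightarrow> real) \<Rightarrow> bool" where
  "localized q g \<longleftrightarrow> (\<forall>\<beta> s x. x \<le> s \<or> s + q \<beta> \<le> x \<longrightarrow> g \<beta> s x = 0)"

lemma tile_localized_outside:
  assumes "\<And>\<beta>. q \<beta> > 0" "localized q g" "x \<le> s \<or> s + sum_list (map q ws) \<le> x"
  shows "tile q g s ws x = 0"
  using assms(3)
proof (induction ws arbitrary: s)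
  case (Cons \<beta> ws)
  have "g \<beta> s x = 0"
    using Cons.prems assms(2) sum_list_pos[of q ws, OF assms(1)] by (auto simp: localized_def)
  then show ?case using Cons.prems assms(1)[of \<beta>] Cons.IH[of "s + q \<beta>"] by (auto simp: add.assoc)
qed simp

lemma tile_localized_bound:
  assumes "\<And>\<beta>. q \<beta> > 0" "localized q g" "\<And>\<beta> s. \<bar>g \<beta> s x\<bar> \<le> h"
  shows "\<bar>tile q g s ws x\<bar> \<le> h"
proof (induction ws arbitrary: s)
  case Nil
  show ?case using assms(3)[of undefined undefined] by simp
next
  case (Cons \<beta> ws)
  show ?case
  proof (cases "x \<le> s + q \<beta>")
    case True
    then show ?thesis using tile_localized_outside[OF assms(1,2), of x "s + q \<beta>" ws] assms(3) by simp
  next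
    case False
    then show ?thesis using assms(2) Cons by (simp add: localized_def)
  qed
qed

text \<open>Localized functions of different pieces do not overlap, so the integral against a weight splits at the
  ends of the pieces.\<close>

lemma integral_tile_Cons:
  fixes u :: "real \<Rightarrow> real"
  assumes pos: "\<And>\<beta>. q \<beta> > 0" and loc: "localized q g" and cont: "\<And>\<beta> s. continuous_on UNIV (g \<beta> s)"
    and u: "continuous_on {s..s + q \<beta> + sum_list (map q ws)} u"
  shows "integral {s..s + q \<beta> + sum_list (map q ws)} (\<lambda>x. u x * (tile q g s (\<beta> # ws) x - c)) =
    integral {s..s + q \<beta>} (\<lambda>x. u x * (g \<beta> s x - c)) +
    integral {s + q \<beta>..s + q \<beta> + sum_list (map q ws)} (\<lambda>x. u x * (tile q g (s + q \<beta>) ws x - c))"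
proof -
  let ?b = "s + q \<beta> + sum_list (map q ws)"
  have le: "s \<le> s + q \<beta>" "s + q \<beta> \<le> ?b"
    using pos[of \<beta>] sum_list_pos[of q ws, OF pos] by auto
  have "continuous_on {s..?b} (tile q g s (\<beta> # ws))"
    using cont by (intro continuous_on_tile) (rule continuous_on_subset, auto)
  then have "(\<lambda>x. u x * (tile q g s (\<beta> # ws) x - c)) integrable_on {s..?b}"
    using u by (intro integrable_continuous_real continuous_intros)
  then have "integral {s..?b} (\<lambda>x. u x * (tile q g s (\<beta> # ws) x - c)) =
      integral {s..s + q \<beta>} (\<lambda>x. u x * (tile q g s (\<beta> # ws) x - c)) +
      integral {s + q \<beta>..?b} (\<lambda>x. u x * (tile q g s (\<beta> # ws) x - c))"
    by (rule Henstock_Kurzweil_Integration.integral_combine[OF le, symmetric])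
  moreover have "integral {s..s + q \<beta>} (\<lambda>x. u x * (tile q g s (\<beta> # ws) x - c)) =
      integral {s..s + q \<beta>} (\<lambda>x. u x * (g \<beta> s x - c))"
    by (rule integral_cong) (simp add: tile_localized_outside[OF pos loc])
  moreover have "integral {s + q \<beta>..?b} (\<lambda>x. u x * (tile q g s (\<beta> # ws) x - c)) =
      integral {s + q \<beta>..?b} (\<lambda>x. u x * (tile q g (s + q \<beta>) ws x - c))"
    using loc by (intro integral_cong) (simp add: localized_def)
  ultimately show ?thesis by simp
qed

lemma integral_tile:
  assumes pos: "\<And>\<beta>. q \<beta> > 0" and loc: "localized q g" and cont: "\<And>\<beta> s. continuous_on UNIV (g \<beta> s)"
    and I: "\<And>\<beta> s. integral {s..s + q \<beta>} (g \<beta> s) = I \<beta>"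
  shows "integral {s..s + sum_list (map q ws)} (tile q g s ws) = sum_list (map I ws)"
proof (induction ws arbitrary: s)
  case (Cons \<beta> ws)
  then show ?case
    using integral_tile_Cons[OF pos loc cont, of s \<beta> ws "\<lambda>_. 1" 0] I Cons[of "s + q \<beta>"]
    by (simp add: add.assoc)
qed simp

lemma integral_tile_weighted_le:
  fixes u :: "real \<Rightarrow> real"
  assumes pos: "\<And>\<beta>. q \<beta> > 0" and loc: "localized q g" and cont: "\<And>\<beta> s. continuous_on UNIV (g \<beta> s)"
    and u: "continuous_on {a..b} u"
    and E: "\<And>\<beta> s. a \<le> s \<Longrightarrow> s + q \<beta> \<le> b \<Longrightarrow> \<bar>integral {s..s + q \<beta>} (\<lambda>x. u x * (g \<beta> s x - c))\<bar> \<le> E \<beta>"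
    and "a \<le> s" "s + sum_list (map q ws) \<le> b"
  shows "\<bar>integral {s..s + sum_list (map q ws)} (\<lambda>x. u x * (tile q g s ws x - c))\<bar> \<le> sum_list (map E ws)"
  using assms(6,7)
proof (induction ws arbitrary: s)
  case (Cons \<beta> ws)
  have le: "s \<le> s + q \<beta>" "s + q \<beta> \<le> s + q \<beta> + sum_list (map q ws)"
    using pos[of \<beta>] sum_list_pos[of q ws, OF pos] by auto
  have "continuous_on {s..s + q \<beta> + sum_list (map q ws)} u"
    using Cons.prems by (intro continuous_on_subset[OF u]) auto
  from integral_tile_Cons[OF pos loc cont this, where c = c]
  show ?case
    using E[of s \<beta>] Cons.IH[of "s + q \<beta>"] Cons.prems le by (simp add: add.assoc)
qed simp

text \<open>On a piece the weight \<open>u\<close> is nearly the constant \<open>u s\<close>, so only the mean value of \<open>G\<close> matters.\<close>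

lemma integral_hoelder_weight_le:
  fixes u G :: "real \<Rightarrow> real"
  assumes "continuous_on {s..s + r} u" "continuous_on {s..s + r} G" "0 < r" "r \<le> \<delta>" "0 < \<eta>" "0 \<le> H"
    and hoelder: "\<And>x. x \<in> {s..s + r} \<Longrightarrow> \<bar>u x - u s\<bar> \<le> H * \<bar>x - s\<bar> powr \<eta>"
    and G: "\<And>x. \<bar>G x\<bar> \<le> h" and c: "\<bar>c\<bar> \<le> h" and M: "\<bar>u s\<bar> \<le> M"
    and mean: "\<bar>integral {s..s + r} G - c * r\<bar> \<le> e"
  shows "\<bar>integral {s..s + r} (\<lambda>x. u x * (G x - c))\<bar> \<le> 2 * h * H * \<delta> powr \<eta> * r + M * e"
proof -
  have ints: "(\<lambda>x. (u x - u s) * (G x - c)) integrable_on {s..s + r}"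
    "(\<lambda>x. G x - c) integrable_on {s..s + r}" "G integrable_on {s..s + r}"
    by (intro integrable_continuous_real continuous_intros assms)+
  have "integral {s..s + r} (\<lambda>x. u x * (G x - c)) =
      integral {s..s + r} (\<lambda>x. (u x - u s) * (G x - c) + u s * (G x - c))"
    by (rule integral_cong) (simp add: algebra_simps)
  also have "\<dots> = integral {s..s + r} (\<lambda>x. (u x - u s) * (G x - c)) + u s * integral {s..s + r} (\<lambda>x. G x - c)"
    using ints by (subst integral_add) (auto intro: integrable_on_mult_right)
  also have "integral {s..s + r} (\<lambda>x. G x - c) = integral {s..s + r} G - c * r"
    using ints assms(3) by (subst integral_diff) auto
  finally have eq: "integral {s..s + r} (\<lambda>x. u x * (G x - c)) =
      integral {s..s + r} (\<lambda>x. (u x - u s) * (G x - c)) + u s * (integral {s..s + r} G - c * r)" .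
  have "norm (integral {s..s + r} (\<lambda>x. (u x - u s) * (G x - c))) \<le> (H * \<delta> powr \<eta>) * (2 * h) * (s + r - s)"
  proof (rule integral_bound)
    fix x assume x: "x \<in> {s..s + r}"
    have "\<bar>x - s\<bar> powr \<eta> \<le> \<delta> powr \<eta>" using x assms by (intro powr_mono2) auto
    then have "\<bar>u x - u s\<bar> \<le> H * \<delta> powr \<eta>"
      using hoelder[OF x] assms(6) by (meson mult_left_mono order_trans)
    moreover have "\<bar>G x - c\<bar> \<le> 2 * h" using G[of x] c by linarith
    ultimately show "norm ((u x - u s) * (G x - c)) \<le> (H * \<delta> powr \<eta>) * (2 * h)"
      unfolding real_norm_def abs_mult by (intro mult_mono) auto
  qed (use assms in \<open>auto intro!: continuous_intros\<close>)
  moreover have "\<bar>u s * (integral {s..s + r} G - c * r)\<bar> \<le> M * e"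
    unfolding abs_mult using M mean by (intro mult_mono) auto
  ultimately show ?thesis unfolding eq by (simp add: mult_ac)
qed

text \<open>If \<open>G\<close> has nearly the same mean value \<open>c\<close> on all pieces, then its integral against a Hoelder
  function of mean zero is small.\<close>

lemma integral_tile_hoelder_le:
  fixes u :: "real \<Rightarrow> real"
  assumes pos: "\<And>\<beta>. q \<beta> > 0" and loc: "localized q g" and cont: "\<And>\<beta> s. continuous_on UNIV (g \<beta> s)"
    and h: "\<And>\<beta> s x. \<bar>g \<beta> s x\<bar> \<le> h" and c: "\<bar>c\<bar> \<le> h" and \<delta>: "\<And>\<beta>. q \<beta> \<le> \<delta>"
    and mean: "\<And>\<beta> s. \<bar>integral {s..s + q \<beta>} (g \<beta> s) - c * q \<beta>\<bar> \<le> e"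
    and \<eta>: "0 < \<eta>" "0 \<le> H"
    and b: "b = sum_list (map q ws)"
    and u: "continuous_on {0..b} u"
    and hoelder: "\<And>x y. x \<in> {0..b} \<Longrightarrow> y \<in> {0..b} \<Longrightarrow> \<bar>u x - u y\<bar> \<le> H * \<bar>x - y\<bar> powr \<eta>"
    and M: "\<And>x. x \<in> {0..b} \<Longrightarrow> \<bar>u x\<bar> \<le> M"
    and zero: "integral {0..b} u = 0"
  shows "\<bar>integral {0..b} (\<lambda>x. u x * tile q g 0 ws x)\<bar> \<le> 2 * h * H * \<delta> powr \<eta> * b + M * e * length ws"
proof -
  have "continuous_on {0..b} (tile q g 0 ws)"
    using cont by (intro continuous_on_tile) (rule continuous_on_subset, auto)
  then have int: "(\<lambda>x. u x * tile q g 0 ws x) integrable_on {0..b}"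
    using u by (intro integrable_continuous_real continuous_intros)
  have "integral {0..b} (\<lambda>x. u x * (tile q g 0 ws x - c)) =
      integral {0..b} (\<lambda>x. u x * tile q g 0 ws x - u x * c)"
    by (simp add: right_diff_distrib)
  also have "\<dots> = integral {0..b} (\<lambda>x. u x * tile q g 0 ws x)"
    using int integrable_on_mult_left[OF integrable_continuous_real[OF u]] zero
    by (subst integral_diff) auto
  finally have eq: "integral {0..b} (\<lambda>x. u x * tile q g 0 ws x) =
      integral {0..b} (\<lambda>x. u x * (tile q g 0 ws x - c))" by simp
  have piece: "\<bar>integral {s..s + q \<beta>} (\<lambda>x. u x * (g \<beta> s x - c))\<bar> \<le> 2 * h * H * \<delta> powr \<eta> * q \<beta> + M * e"
    if "0 \<le> s" "s + q \<beta> \<le> b" for \<beta> s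
  proof (rule integral_hoelder_weight_le)
    show "continuous_on {s..s + q \<beta>} u" using that by (intro continuous_on_subset[OF u]) auto
    show "continuous_on {s..s + q \<beta>} (g \<beta> s)" using cont by (rule continuous_on_subset) auto
    show "\<bar>u x - u s\<bar> \<le> H * \<bar>x - s\<bar> powr \<eta>" if "x \<in> {s..s + q \<beta>}" for x
      using that \<open>0 \<le> s\<close> \<open>s + q \<beta> \<le> b\<close> by (intro hoelder) auto
    show "\<bar>u s\<bar> \<le> M" using that pos[of \<beta>] by (intro M) auto
  qed (use pos \<delta> \<eta> h c mean in auto)
  have "\<bar>integral {0..b} (\<lambda>x. u x * (tile q g 0 ws x - c))\<bar>
      \<le> sum_list (map (\<lambda>\<beta>. 2 * h * H * \<delta> powr \<eta> * q \<beta> + M * e) ws)"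
    using integral_tile_weighted_le[OF pos loc cont u piece, of 0 ws] by (simp add: b)
  also have "\<dots> = 2 * h * H * \<delta> powr \<eta> * b + M * e * length ws"
    unfolding b by (simp add: sum_list_addf sum_list_const_mult sum_list_triv)
  finally show ?thesis unfolding eq .
qed

section \<open>The difference of consecutive functions\<close>

context backward_path
begin

abbreviation height :: "nat \<Rightarrow> 'a \<Rightarrow> real" where
  "height k \<beta> \<equiv> heights_seq \<pi> \<tau> k $ \<beta>"

abbreviation chi :: "'a rel_class \<Rightarrow> nat \<Rightarrow> 'a \<Rightarrow> real" where
  "chi \<Upsilon> k \<beta> \<equiv> chi_vec \<pi> \<tau> \<Upsilon> k $ \<beta>"

lemma sum_list_height_descend: "sum_list (map (height (m + n)) (descend m n \<beta>)) = height m \<beta>"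
  by (rule compatible_descend[OF compatible_heights])

lemma Omega_fun_eq:
  assumes l: "\<And>\<alpha>. l $ \<alpha> > 0" and x: "0 \<le> x" "x \<le> heights \<pi> \<tau> $ \<alpha>"
  shows "Omega_fun \<pi> l \<tau> \<Upsilon> k \<alpha> x = tile (height k) (rise (height k) (chi \<Upsilon> k)) 0 (descend 0 k \<alpha>) x"
    (is "_ = ?y")
proof -
  let ?ws = "descend 0 k \<alpha>"
  have vertex: "vertex \<pi> l \<tau> \<Upsilon> k \<alpha> j = (0 + (\<Sum>i<j. height k (?ws ! i)), 0 + (\<Sum>i<j. chi \<Upsilon> k (?ws ! i)))"
    if "j \<le> length ?ws" for j
    using that by (simp add: vertex_def itinerary_eq[OF l] chi_vec_def)
  have "x \<le> 0 + sum_list (map (height k) ?ws)"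
    using x sum_list_height_descend[of 0 k \<alpha>] by (simp add: heights_seq_0)
  then obtain j where "j < length ?ws"
      "(x, ?y) \<in> closed_segment (vertex \<pi> l \<tau> \<Upsilon> k \<alpha> j) (vertex \<pi> l \<tau> \<Upsilon> k \<alpha> (Suc j))"
    using broken_line_exists[where s = 0 and z = 0 and q = "height k" and c = "chi \<Upsilon> k",
        OF heights_seq_pos descend_nonempty x(1), of 0 k \<alpha>]
    by (auto simp: vertex)
  moreover have "y = ?y" if "j < length ?ws"
      "(x, y) \<in> closed_segment (vertex \<pi> l \<tau> \<Upsilon> k \<alpha> j) (vertex \<pi> l \<tau> \<Upsilon> k \<alpha> (Suc j))" for j y
    using broken_line_unique[where q = "height k" and z = 0 and s = 0 and c = "chi \<Upsilon> k",
        OF heights_seq_pos that(1)] that vertex by simp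
  ultimately show ?thesis
    unfolding Omega_fun_def return_time_eq by (intro the_equality) blast+
qed

text \<open>For the loser this is the difference between a line of two segments and the segment with the same end points;
  for the other letters it vanishes.\<close>

definition tent :: "'a rel_class \<Rightarrow> nat \<Rightarrow> 'a \<Rightarrow> real \<Rightarrow> real \<Rightarrow> real" where
  "tent \<Upsilon> k \<beta> s x = tile (height (Suc k)) (rise (height (Suc k)) (chi \<Upsilon> (Suc k))) s (subst k \<beta>) x
     - rise (height k) (chi \<Upsilon> k) \<beta> s x"

lemma Omega_step_eq_tile_tent:
  "tile (height (Suc k)) (rise (height (Suc k)) (chi \<Upsilon> (Suc k))) 0 (descend 0 (Suc k) \<alpha>) x
   - tile (height k) (rise (height k) (chi \<Upsilon> k)) 0 (descend 0 k \<alpha>) x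
   = tile (height k) (tent \<Upsilon> k) 0 (descend 0 k \<alpha>) x"
  unfolding tent_def[abs_def] tile_diff[symmetric] descend.simps add_0
  by (subst tile_concat[where q = "height k"]) (simp_all add: compatible_subst[OF compatible_heights])

lemma localized_tent: "localized (height k) (tent \<Upsilon> k)"
  unfolding localized_def
proof (intro allI impI)
  fix \<beta> and s x :: real assume "x \<le> s \<or> s + height k \<beta> \<le> x"
  then show "tent \<Upsilon> k \<beta> s x = 0"
  proof
    assume "x \<le> s"
    then show ?thesis
      using heights_seq_pos by (simp add: tent_def tile_rise_before rise_def ramp_before)
  next
    assume "s + height k \<beta> \<le> x"
    then show ?thesis
      using heights_seq_pos tile_rise_after[of "height (Suc k)" s "subst k \<beta>" x "chi \<Upsilon> (Suc k)"]
      by (simp add: tent_def rise_def ramp_after compatible_subst[OF compatible_heights] compatible_subst[OF compatible_chi])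
  qed
qed

lemma tent_eq_0: "\<beta> \<noteq> lose \<pi> \<tau> k \<Longrightarrow> tent \<Upsilon> k \<beta> s x = 0"
  using compatible_subst[OF compatible_heights, of k \<beta>] compatible_subst[OF compatible_chi, of \<Upsilon> k \<beta>]
  by (simp add: tent_def subst_def rise_def)

lemma tent_bound: "\<bar>tent \<Upsilon> k \<beta> s x\<bar> \<le> 4 * norm (chi_vec \<pi> \<tau> \<Upsilon> (Suc k))"
proof -
  let ?S = "sum_list (map (\<lambda>\<gamma>. \<bar>chi \<Upsilon> (Suc k) \<gamma>\<bar>) (subst k \<beta>))"
  have "\<bar>chi \<Upsilon> k \<beta>\<bar> \<le> ?S"
    unfolding compatible_subst[OF compatible_chi, of \<Upsilon> k \<beta>, symmetric]
    using sum_list_abs[of "map (chi \<Upsilon> (Suc k)) (subst k \<beta>)"] by (simp add: o_def)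
  then have "\<bar>rise (height k) (chi \<Upsilon> k) \<beta> s x\<bar> \<le> ?S"
    using ramp_bounds[of "(x - s) / height k \<beta>"] mult_left_le[of "ramp ((x - s) / height k \<beta>)" "\<bar>chi \<Upsilon> k \<beta>\<bar>"]
    by (simp add: rise_def abs_mult)
  then have "\<bar>tent \<Upsilon> k \<beta> s x\<bar> \<le> 2 * ?S"
    using tile_rise_bound[of "height (Suc k)" "chi \<Upsilon> (Suc k)" s "subst k \<beta>" x] unfolding tent_def by linarith
  also have "?S \<le> 2 * norm (chi_vec \<pi> \<tau> \<Upsilon> (Suc k))"
    using component_le_norm_cart[of "chi_vec \<pi> \<tau> \<Upsilon> (Suc k)" "lose \<pi> \<tau> k"]
      component_le_norm_cart[of "chi_vec \<pi> \<tau> \<Upsilon> (Suc k)" "win \<pi> \<tau> k"]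
      component_le_norm_cart[of "chi_vec \<pi> \<tau> \<Upsilon> (Suc k)" \<beta>] norm_ge_zero[of "chi_vec \<pi> \<tau> \<Upsilon> (Suc k)"]
    by (auto simp: subst_def)
  finally show ?thesis by simp
qed

lemma heights_seq_nonzero: "heights_seq \<pi> \<tau> k $ \<beta> \<noteq> 0"
  using heights_seq_pos[of k \<beta>] by simp

lemma continuous_on_tent: "continuous_on A (tent \<Upsilon> k \<beta> s)"
  unfolding tent_def[abs_def]
  by (intro continuous_intros continuous_on_tile continuous_on_rise heights_seq_nonzero)

text \<open>The number \<open>t\<close> is the mean value of the tent; the same for all copies, since they are translates.\<close>

lemma integral_tent:
  obtains t where "\<bar>t\<bar> \<le> 4 * norm (chi_vec \<pi> \<tau> \<Upsilon> (Suc k))"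
    "\<And>\<beta> s. integral {s..s + height k \<beta>} (tent \<Upsilon> k \<beta> s) =
       (if \<beta> = lose \<pi> \<tau> k then t * height k (lose \<pi> \<tau> k) else 0)"
proof
  let ?h = "4 * norm (chi_vec \<pi> \<tau> \<Upsilon> (Suc k))" and ?a = "lose \<pi> \<tau> k"
  define t where "t = integral {0..height k ?a} (tent \<Upsilon> k ?a 0) / height k ?a"
  have pos: "height k ?a > 0" by (rule heights_seq_pos)
  have "norm (integral {0..height k ?a} (tent \<Upsilon> k ?a 0)) \<le> ?h * (height k ?a - 0)"
    using pos by (intro integral_bound continuous_on_tent) (auto simp: tent_bound)
  then show "\<bar>t\<bar> \<le> ?h" using pos by (simp add: t_def abs_divide divide_le_eq)
  fix \<beta> s
  have shift: "tent \<Upsilon> k \<beta> s x = tent \<Upsilon> k \<beta> 0 (x - s)" for x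
    using tile_rise_shift[where s = s and r = 0] by (simp add: tent_def rise_def)
  show "integral {s..s + height k \<beta>} (tent \<Upsilon> k \<beta> s) = (if \<beta> = ?a then t * height k ?a else 0)"
  proof (cases "\<beta> = ?a")
    case True
    have "integral {s..s + height k \<beta>} (tent \<Upsilon> k \<beta> s) = integral {0..height k \<beta>} (\<lambda>x. tent \<Upsilon> k \<beta> s (x + s))"
      using integral_shift_Icc_real[of 0 "height k \<beta>" "tent \<Upsilon> k \<beta> s" s]
      by (simp add: add.commute o_def)
    also have "\<dots> = integral {0..height k \<beta>} (tent \<Upsilon> k \<beta> 0)"
      by (simp add: shift)
    finally show ?thesis using True pos by (simp add: t_def)
  next
    case False
    then have "tent \<Upsilon> k \<beta> s = (\<lambda>x. 0)" by (simp add: fun_eq_iff tent_eq_0)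
    then show ?thesis using False by simp
  qed
qed

text \<open>The occurrences of the loser of level \<open>k\<close> are counted in the pieces of an intermediate level
  \<open>m\<close>; \<open>e\<close> bounds the deviation of the share of the piece \<open>\<beta>\<close> from the share in the whole
  interval.\<close>

lemma Omega_step_le:
  fixes \<psi> :: "real \<Rightarrow> real"
  assumes l: "\<And>\<alpha>. l $ \<alpha> > 0" and "m \<le> k"
    and \<delta>: "\<And>\<beta>. height m \<beta> \<le> \<delta>"
    and e: "\<And>\<beta>. \<bar>B_mat \<pi> \<tau> k m $ \<beta> $ a * height k a - B_mat \<pi> \<tau> k 0 $ \<alpha> $ a * height k a / height 0 \<alpha> * height m \<beta>\<bar> \<le> e"
    and a: "a = lose \<pi> \<tau> k" and h: "h = 4 * norm (chi_vec \<pi> \<tau> \<Upsilon> (Suc k))"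
    and b: "b = heights \<pi> \<tau> $ \<alpha>" and \<eta>: "0 < \<eta>" "0 \<le> H"
    and \<psi>: "continuous_on {0..b} \<psi>"
    and hoelder: "\<And>x y. x \<in> {0..b} \<Longrightarrow> y \<in> {0..b} \<Longrightarrow> \<bar>\<psi> x - \<psi> y\<bar> \<le> H * \<bar>x - y\<bar> powr \<eta>"
    and M: "\<And>x. x \<in> {0..b} \<Longrightarrow> \<bar>\<psi> x\<bar> \<le> M"
    and zero: "integral {0..b} \<psi> = 0"
  shows "\<bar>integral {0..b} (\<lambda>x. \<psi> x * Omega_fun \<pi> l \<tau> \<Upsilon> (Suc k) \<alpha> x)
       - integral {0..b} (\<lambda>x. \<psi> x * Omega_fun \<pi> l \<tau> \<Upsilon> k \<alpha> x)\<bar>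
     \<le> h * (2 * H * \<delta> powr \<eta> * b + M * e * length (descend 0 m \<alpha>))"
proof -
  define n where "n = k - m"
  have k: "k = m + n" using \<open>m \<le> k\<close> by (simp add: n_def)
  define g where "g \<beta> s = tile (height k) (tent \<Upsilon> k) s (descend m n \<beta>)" for \<beta> s
  have b_sum: "b = sum_list (map (height m) (descend 0 m \<alpha>))"
    using sum_list_height_descend[of 0 m \<alpha>] by (simp add: b heights_seq_0)
  have \<Omega>: "Omega_fun \<pi> l \<tau> \<Upsilon> j \<alpha> x = tile (height j) (rise (height j) (chi \<Upsilon> j)) 0 (descend 0 j \<alpha>) x"
    if "x \<in> {0..b}" for j x
    using that by (intro Omega_fun_eq l) (auto simp: b)
  have cont: "continuous_on {0..b} (\<lambda>x. Omega_fun \<pi> l \<tau> \<Upsilon> j \<alpha> x)" for j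
  proof (subst continuous_on_cong[OF refl \<Omega>])
    show "continuous_on {0..b} (tile (height j) (rise (height j) (chi \<Upsilon> j)) 0 (descend 0 j \<alpha>))"
      by (intro continuous_on_tile continuous_on_rise heights_seq_nonzero)
  qed
  have int: "(\<lambda>x. \<psi> x * Omega_fun \<pi> l \<tau> \<Upsilon> j \<alpha> x) integrable_on {0..b}" for j
    by (intro integrable_continuous_real continuous_intros \<psi> cont)
  have regroup: "tile (height k) (tent \<Upsilon> k) 0 (descend 0 k \<alpha>) x = tile (height m) g 0 (descend 0 m \<alpha>) x" for x
    unfolding k descend_add[of 0 m n, simplified] g_def[abs_def, unfolded k]
    by (subst tile_concat[where q = "height m"]) (simp_all add: sum_list_height_descend)
  have "integral {0..b} (\<lambda>x. \<psi> x * Omega_fun \<pi> l \<tau> \<Upsilon> (Suc k) \<alpha> x)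
       - integral {0..b} (\<lambda>x. \<psi> x * Omega_fun \<pi> l \<tau> \<Upsilon> k \<alpha> x)
      = integral {0..b} (\<lambda>x. \<psi> x * Omega_fun \<pi> l \<tau> \<Upsilon> (Suc k) \<alpha> x - \<psi> x * Omega_fun \<pi> l \<tau> \<Upsilon> k \<alpha> x)"
    by (rule integral_diff[OF int int, symmetric])
  also have "\<dots> = integral {0..b} (\<lambda>x. \<psi> x * tile (height m) g 0 (descend 0 m \<alpha>) x)"
    by (rule integral_cong)
       (simp only: \<Omega> regroup[symmetric] Omega_step_eq_tile_tent[symmetric] right_diff_distrib)
  finally have eq: "integral {0..b} (\<lambda>x. \<psi> x * Omega_fun \<pi> l \<tau> \<Upsilon> (Suc k) \<alpha> x)
       - integral {0..b} (\<lambda>x. \<psi> x * Omega_fun \<pi> l \<tau> \<Upsilon> k \<alpha> x)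
      = integral {0..b} (\<lambda>x. \<psi> x * tile (height m) g 0 (descend 0 m \<alpha>) x)" .
  obtain t where t: "\<bar>t\<bar> \<le> h" "\<And>\<beta> s. integral {s..s + height k \<beta>} (tent \<Upsilon> k \<beta> s) =
       (if \<beta> = a then t * height k a else 0)"
    using integral_tent[of \<Upsilon> k] unfolding h a by metis
  \<comment> \<open>The fraction of the whole interval that the loser covers; \<open>t * p\<close> is the mean value of the
    difference on the whole interval.\<close>
  define p where "p = B_mat \<pi> \<tau> k 0 $ \<alpha> $ a * height k a / height 0 \<alpha>"
  have "B_mat \<pi> \<tau> k 0 $ \<alpha> $ a * height k a \<le> height 0 \<alpha>"
    unfolding compatible_B_mat[OF compatible_heights, of 0 k \<alpha>, simplified]
    by (intro member_le_sum) (auto simp: B_mat_nonneg less_imp_le[OF heights_seq_pos])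
  then have p: "0 \<le> p" "p \<le> 1"
    using heights_seq_pos[of 0 \<alpha>] heights_seq_pos[of k a] B_mat_nonneg[of 0 k \<alpha> a]
    by (auto simp: p_def intro!: divide_nonneg_nonneg mult_nonneg_nonneg)
  have mean: "\<bar>integral {s..s + height m \<beta>} (g \<beta> s) - (t * p) * height m \<beta>\<bar> \<le> h * e" for \<beta> s
  proof -
    have "integral {s..s + height m \<beta>} (g \<beta> s) =
        sum_list (map (\<lambda>\<gamma>. if \<gamma> = a then t * height k a else 0) (descend m n \<beta>))"
      using integral_tile[where ws = "descend m n \<beta>", OF heights_seq_pos localized_tent continuous_on_tent t(2), of s]
        sum_list_height_descend[of m n \<beta>]
      by (simp add: g_def k)
    also have "\<dots> = B_mat \<pi> \<tau> k m $ \<beta> $ a * (t * height k a)"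
      unfolding sum_list_count by (simp add: count_descend k if_distrib[of "\<lambda>x. _ * x"] cong: if_cong)
    finally have "integral {s..s + height m \<beta>} (g \<beta> s) - (t * p) * height m \<beta> =
        t * (B_mat \<pi> \<tau> k m $ \<beta> $ a * height k a - p * height m \<beta>)"
      by (simp add: algebra_simps)
    then show ?thesis
      using t(1) e[of \<beta>] unfolding p_def by (simp only: abs_mult) (intro mult_mono, auto)
  qed
  have "\<bar>integral {0..b} (\<lambda>x. \<psi> x * tile (height m) g 0 (descend 0 m \<alpha>) x)\<bar>
      \<le> 2 * h * H * \<delta> powr \<eta> * b + M * (h * e) * length (descend 0 m \<alpha>)"
  proof (rule integral_tile_hoelder_le[where c = "t * p"])
    show "localized (height m) g"
      unfolding localized_def g_def
      using tile_localized_outside[OF heights_seq_pos localized_tent] sum_list_height_descend[of m n]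
      by (simp add: k)
    show "continuous_on UNIV (g \<beta> s)" for \<beta> s
      unfolding g_def by (intro continuous_on_tile continuous_on_tent)
    show "\<bar>g \<beta> s x\<bar> \<le> h" for \<beta> s x
      unfolding g_def h by (intro tile_localized_bound heights_seq_pos localized_tent tent_bound)
    show "\<bar>t * p\<bar> \<le> h"
      using t(1) p mult_left_le[of p "\<bar>t\<bar>"] by (simp add: abs_mult)
  qed (fact heights_seq_pos \<delta> mean \<eta> b_sum \<psi> hoelder M zero)+
  then show ?thesis unfolding eq by (simp add: algebra_simps)
qed

end

section \<open>Norms and determinants of nonnegative matrices\<close>

lemma mat_norm_nonneg: "0 \<le> mat_norm A"
  unfolding mat_norm_def by (intro sum_nonneg) auto

lemma entry_le_mat_norm: "\<bar>A $ \<alpha> $ \<beta>\<bar> \<le> mat_norm A"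
proof -
  have "\<bar>A $ \<alpha> $ \<beta>\<bar> \<le> (\<Sum>\<beta>\<in>UNIV. \<bar>A $ \<alpha> $ \<beta>\<bar>)"
    by (rule member_le_sum) auto
  also have "\<dots> \<le> mat_norm A"
    unfolding mat_norm_def by (rule member_le_sum[of \<alpha> UNIV "\<lambda>\<alpha>. \<Sum>\<beta>\<in>UNIV. \<bar>A $ \<alpha> $ \<beta>\<bar>"]) (auto intro: sum_nonneg)
  finally show ?thesis .
qed

lemma mat_norm_mult_le:
  fixes A :: "real ^ 'b ^ 'c" and B :: "real ^ 'd ^ 'b"
  shows "mat_norm (A ** B) \<le> mat_norm A * mat_norm B"
proof -
  have "mat_norm (A ** B) \<le> (\<Sum>\<alpha>\<in>UNIV. \<Sum>\<beta>\<in>UNIV. \<Sum>\<gamma>\<in>UNIV. \<bar>A $ \<alpha> $ \<gamma>\<bar> * \<bar>B $ \<gamma> $ \<beta>\<bar>)"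
    unfolding mat_norm_def matrix_matrix_mult_def
    by (intro sum_mono) (auto simp: abs_mult[symmetric] intro: sum_abs)
  also have "\<dots> = (\<Sum>\<alpha>\<in>UNIV. \<Sum>\<gamma>\<in>UNIV. \<bar>A $ \<alpha> $ \<gamma>\<bar> * (\<Sum>\<beta>\<in>UNIV. \<bar>B $ \<gamma> $ \<beta>\<bar>))"
    by (subst sum.swap) (simp add: sum_distrib_left)
  also have "\<dots> \<le> (\<Sum>\<alpha>\<in>UNIV. \<Sum>\<gamma>\<in>UNIV. \<bar>A $ \<alpha> $ \<gamma>\<bar> * mat_norm B)"
    unfolding mat_norm_def[of B]
    by (intro sum_mono mult_left_mono member_le_sum[of _ UNIV "\<lambda>\<gamma>. \<Sum>\<beta>\<in>UNIV. \<bar>B $ \<gamma> $ \<beta>\<bar>"])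
       (auto intro: sum_nonneg)
  also have "\<dots> = mat_norm A * mat_norm B"
    by (simp add: mat_norm_def[of A] sum_distrib_right)
  finally show ?thesis .
qed

lemma mat_norm_transpose: "mat_norm (transpose A) = mat_norm A"
  unfolding mat_norm_def transpose_def by (subst sum.swap) simp

lemma abs_det_le:
  fixes A :: "real ^ 'n ^ 'n"
  assumes "\<And>i j. \<bar>A $ i $ j\<bar> \<le> M"
  shows "\<bar>det A\<bar> \<le> fact CARD('n) * M ^ CARD('n)"
proof -
  have "\<bar>det A\<bar> \<le> (\<Sum>p | p permutes (UNIV :: 'n set). M ^ CARD('n))"
    unfolding det_def
  proof (rule order_trans[OF sum_abs sum_mono])
    fix p
    have "\<bar>of_int (sign p) * (\<Prod>i\<in>UNIV. A $ i $ p i)\<bar> = (\<Prod>i\<in>UNIV. \<bar>A $ i $ p i\<bar>)"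
      by (simp add: abs_mult sign_def abs_prod)
    also have "\<dots> \<le> (\<Prod>i\<in>(UNIV :: 'n set). M)"
      by (intro prod_mono) (auto simp: assms)
    finally show "\<bar>of_int (sign p) * (\<Prod>i\<in>UNIV. A $ i $ p i)\<bar> \<le> M ^ CARD('n)" by simp
  qed
  then show ?thesis by (simp add: card_permutations)
qed

text \<open>By Cramer's rule the solutions of a unimodular system grow at most polynomially with its matrix.\<close>

lemma unimodular_solution:
  fixes A :: "real ^ 'n ^ 'n"
  assumes det: "det A = 1" and M: "\<And>i j. \<bar>A $ i $ j\<bar> \<le> M" "1 \<le> M"
  obtains x where "A *v x = axis \<beta> 1" "\<And>k. \<bar>x $ k\<bar> \<le> fact CARD('n) * M ^ CARD('n)"
proof -
  obtain x where x: "A *v x = axis \<beta> 1"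
    using det invertible_det_nz[of A] by (metis invertible_right_inverse matrix_vector_mul_assoc
      matrix_vector_mul_lid zero_neq_one)
  have "\<bar>x $ k\<bar> \<le> fact CARD('n) * M ^ CARD('n)" for k
  proof -
    have "x $ k = det (\<chi> i j. if j = k then (A *v x) $ i else A $ i $ j)"
      using cramer_lemma[of k A x] det by simp
    also have "\<bar>\<dots>\<bar> \<le> fact CARD('n) * M ^ CARD('n)"
      using M by (intro abs_det_le) (auto simp: x axis_def)
    finally show ?thesis .
  qed
  with x that show ?thesis by blast
qed

lemma restricted_norm_le:
  fixes A :: "real ^ 'n ^ 'm"
  assumes "v \<in> H" and scale: "\<And>c. c *\<^sub>R v \<in> H"
  shows "norm (A *v v) \<le> restricted_norm A H * norm v"
proof (cases "v = 0")
  case True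
  then show ?thesis by simp
next
  case False
  let ?w = "(1 / norm v) *\<^sub>R v"
  have bdd: "bdd_above ((\<lambda>v. norm (A *v v)) ` {v \<in> H. norm v \<le> 1})"
  proof (rule bdd_aboveI2)
    fix w assume "w \<in> {v \<in> H. norm v \<le> 1}"
    then have "onorm (\<lambda>v. A *v v) * norm w \<le> onorm (\<lambda>v. A *v v) * 1"
      by (intro mult_left_mono) (auto intro!: onorm_pos_le)
    then show "norm (A *v w) \<le> onorm (\<lambda>v. A *v v)"
      using onorm[of "\<lambda>v. A *v v" w] by simp
  qed
  have "norm (A *v ?w) \<le> restricted_norm A H"
    unfolding restricted_norm_def using False scale by (intro cSUP_upper bdd) auto
  then show ?thesis using False
    by (simp add: matrix_vector_mult_scaleR divide_le_eq)
qed


section \<open>Balance along the path\<close>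

context backward_path
begin

abbreviation B_norm :: "nat \<Rightarrow> real" where
  "B_norm k \<equiv> mat_norm (B_mat \<pi> \<tau> k 0)"

lemma mat_norm_B_mat: "j \<le> k \<Longrightarrow> mat_norm (B_mat \<pi> \<tau> k j) = (\<Sum>\<alpha>\<in>UNIV. \<Sum>\<beta>\<in>UNIV. B_mat \<pi> \<tau> k j $ \<alpha> $ \<beta>)"
  by (simp add: mat_norm_def B_mat_nonneg)

lemma B_norm_0: "B_norm 0 = CARD('a)"
  by (simp add: mat_norm_def B_mat_refl mat_def if_distrib[of abs] cong: if_cong)

lemma B_norm_Suc:
  "B_norm (Suc k) = B_norm k + (\<Sum>\<alpha>\<in>UNIV. B_mat \<pi> \<tau> k 0 $ \<alpha> $ lose \<pi> \<tau> k)"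
  using mat_norm_B_mat[of 0 k] mat_norm_B_mat[of 0 "Suc k"]
  by (simp add: B_mat_Suc mult_arrow_mat sum.distrib)

lemma column_sum_le: "(\<Sum>\<alpha>\<in>UNIV. B_mat \<pi> \<tau> k 0 $ \<alpha> $ \<beta>) \<le> B_norm k"
  unfolding mat_norm_B_mat[OF le0]
  by (intro sum_mono member_le_sum) (auto simp: B_mat_nonneg)

lemma B_norm_Suc_le: "B_norm (Suc k) \<le> 2 * B_norm k"
  using column_sum_le[of k "lose \<pi> \<tau> k"] by (simp add: B_norm_Suc)

lemma B_norm_mono: "j \<le> k \<Longrightarrow> B_norm j \<le> B_norm k"
  by (rule lift_Suc_mono_le) (simp add: B_norm_Suc sum_nonneg B_mat_nonneg)

lemma B_norm_ge_2: "2 \<le> B_norm k"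
  using B_norm_mono[of 0 k] card_ge_2 by (simp add: B_norm_0)

lemma length_descend_le: "real (length (descend 0 m \<alpha>)) \<le> B_norm m"
  unfolding length_descend mat_norm_B_mat[OF le0] add_0
  by (rule member_le_sum[of \<alpha> UNIV "\<lambda>\<alpha>. \<Sum>\<beta>\<in>UNIV. B_mat \<pi> \<tau> m 0 $ \<alpha> $ \<beta>"])
     (auto intro: sum_nonneg simp: B_mat_nonneg)

lemma det_arrow_mat: "det (arrow_mat \<pi> \<tau> k) = 1"
proof -
  have "arrow_mat \<pi> \<tau> k = (\<chi> i. if i = lose \<pi> \<tau> k
      then row (lose \<pi> \<tau> k) (mat 1) + 1 *s row (win \<pi> \<tau> k) (mat 1) else row i (mat 1))"
    by (auto simp: vec_eq_iff arrow_mat_def row_def mat_def)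
  then show ?thesis
    using det_row_operation[OF win_neq_lose[THEN not_sym], where c = 1 and A = "mat 1 :: real ^ 'a ^ 'a", of k]
    by simp
qed

lemma det_B_mat: "j \<le> k \<Longrightarrow> det (B_mat \<pi> \<tau> k j) = 1"
  by (induction k rule: dec_induct) (simp_all add: B_mat_refl B_mat_Suc det_mul det_arrow_mat)

lemma complete_time_Suc:
  "complete_time \<pi> \<tau> j < complete_time \<pi> \<tau> (Suc j)"
  "complete_path \<pi> \<tau> (complete_time \<pi> \<tau> j) (complete_time \<pi> \<tau> (Suc j))"
proof -
  obtain N :: "nat \<Rightarrow> nat" where N: "strict_mono N" "\<And>i. complete_path \<pi> \<tau> (N i) (N (Suc i))"
    using complete by (auto simp: infinity_complete_def)
  let ?c = "complete_time \<pi> \<tau> j"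
  have c: "?c \<le> N ?c" using N(1) by (rule strict_mono_imp_increasing)
  have "?c < N (Suc ?c)" using c N(1) by (metis lessI order_le_less_trans strict_mono_less)
  moreover have "complete_path \<pi> \<tau> ?c (N (Suc ?c))"
    using N(2)[of ?c] c by (fastforce simp: complete_path_def)
  ultimately show "?c < complete_time \<pi> \<tau> (Suc j)" "complete_path \<pi> \<tau> ?c (complete_time \<pi> \<tau> (Suc j))"
    using LeastI[of "\<lambda>k. ?c < k \<and> complete_path \<pi> \<tau> ?c k" "N (Suc ?c)"] by auto
qed

lemma complete_time_mono: "i \<le> j \<Longrightarrow> complete_time \<pi> \<tau> i \<le> complete_time \<pi> \<tau> j"
  by (rule lift_Suc_mono_le) (simp_all add: complete_time_Suc less_imp_le del: complete_time.simps)

text \<open>The support of the row \<open>\<alpha>\<close> of the matrix \<open>B(- k, - j)\<close>.\<close>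

definition reached :: "nat \<Rightarrow> 'a \<Rightarrow> nat \<Rightarrow> 'a set" where
  "reached j \<alpha> k = set (descend j (k - j) \<alpha>)"

lemma reached_Suc:
  "j \<le> k \<Longrightarrow> reached j \<alpha> (Suc k) =
     reached j \<alpha> k \<union> (if lose \<pi> \<tau> k \<in> reached j \<alpha> k then {win \<pi> \<tau> k} else {})"
  by (auto simp: reached_def Suc_diff_le subst_def split: if_splits)

lemma reached_mono:
  assumes "j \<le> k" "k \<le> k'"
  shows "reached j \<alpha> k \<subseteq> reached j \<alpha> k'"
  using assms(2,1) by (induction k' rule: dec_induct) (auto simp: reached_Suc)

lemma reached_self: "j \<le> k \<Longrightarrow> \<alpha> \<in> reached j \<alpha> k"
  using reached_mono[of j j k \<alpha>] by (auto simp: reached_def)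

text \<open>The winner of an arrow is the winner or the loser of the previous one. So as long as the reached set
  does not grow, a winner outside of it is followed by winners outside of it. During a first complete
  path some winner is outside of a proper subset; during a second one some winner is inside.\<close>

lemma reached_grows:
  assumes "j \<le> k" and path: "complete_path \<pi> \<tau> k k'" "complete_path \<pi> \<tau> k' k''"
    and same: "reached j \<alpha> k'' = reached j \<alpha> k"
  shows "reached j \<alpha> k = UNIV"
proof (rule ccontr)
  let ?S = "reached j \<alpha> k"
  assume "?S \<noteq> UNIV"
  then obtain \<beta> where "\<beta> \<notin> ?S" by blast
  moreover obtain i where "k \<le> i" "i < k'" "win \<pi> \<tau> i = \<beta>"
    using path(1) unfolding complete_path_def by (meson atLeastLessThan_iff)
  ultimately have i: "k \<le> i" "i < k'" "win \<pi> \<tau> i \<notin> ?S" by auto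
  obtain i' where i': "k' \<le> i'" "i' < k''" "win \<pi> \<tau> i' = \<alpha>"
    using path(2) unfolding complete_path_def by (meson atLeastLessThan_iff)
  have S: "reached j \<alpha> n = ?S" if "k \<le> n" "n \<le> k''" for n
    using reached_mono[of j k n \<alpha>] reached_mono[of j n k'' \<alpha>] that assms(1) same by auto
  have closed: "win \<pi> \<tau> n \<in> ?S" if "k \<le> n" "n < k''" "lose \<pi> \<tau> n \<in> ?S" for n
    using reached_Suc[of j n \<alpha>] S[of n] S[of "Suc n"] that assms(1) by auto
  have "win \<pi> \<tau> n \<notin> ?S" if "i \<le> n" "n < k''" for n
    using that
  proof (induction n rule: dec_induct)
    case (step n)
    then show ?case using win_Suc[of n] closed[of n] i(1) by auto
  qed (use i(3) in simp)
  then have "\<alpha> \<notin> ?S" using i i' by (metis less_le_trans less_imp_le)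
  then show False using reached_self[OF assms(1)] by blast
qed

lemma card_reached:
  fixes i :: nat and \<alpha> :: 'a
  defines "S \<equiv> \<lambda>r. reached (complete_time \<pi> \<tau> i) \<alpha> (complete_time \<pi> \<tau> (i + 2 * r))"
  shows "r < card (S r) \<or> S r = UNIV"
proof (induction r)
  case 0
  then show ?case by (auto simp: S_def reached_def)
next
  case (Suc r)
  let ?c = "complete_time \<pi> \<tau>"
  have le: "?c i \<le> ?c (i + 2 * r)" "?c (i + 2 * r) \<le> ?c (i + 2 * Suc r)"
    by (rule complete_time_mono, simp)+
  have sub: "S r \<subseteq> S (Suc r)" unfolding S_def by (rule reached_mono) (fact le)+
  show ?case
  proof (cases "S (Suc r) = S r")
    case True
    have "S r = UNIV" unfolding S_def
      by (rule reached_grows[where k' = "?c (Suc (i + 2 * r))" and k'' = "?c (Suc (Suc (i + 2 * r)))"])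
         (use le(1) True complete_time_Suc(2) in \<open>auto simp: S_def simp del: complete_time.simps\<close>)
    then show ?thesis using True by simp
  next
    case False
    then have "card (S r) < card (S (Suc r))" using sub by (intro psubset_card_mono) auto
    then show ?thesis using Suc sub by auto
  qed
qed

lemma B_mat_ge_1_if_reached:
  assumes "j \<le> k" "\<beta> \<in> reached j \<alpha> k"
  shows "1 \<le> B_mat \<pi> \<tau> k j $ \<alpha> $ \<beta>"
proof -
  have "count_list (descend j (k - j) \<alpha>) \<beta> \<noteq> 0"
    using assms by (simp add: count_list_0_iff reached_def)
  then have "1 \<le> real (count_list (descend j (k - j) \<alpha>) \<beta>)" by simp
  then show ?thesis using assms by (simp add: count_descend)
qed

text \<open>Two complete paths for each letter make the matrix positive.\<close>

lemma B_mat_ge_1: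
  assumes "complete_time \<pi> \<tau> (i + 2 * CARD('a)) \<le> k"
  shows "1 \<le> B_mat \<pi> \<tau> k (complete_time \<pi> \<tau> i) $ \<alpha> $ \<beta>"
proof -
  let ?c = "complete_time \<pi> \<tau>" and ?d = "CARD('a)"
  have le: "?c i \<le> ?c (i + 2 * ?d)" by (intro complete_time_mono) simp
  have "card S \<le> ?d" for S :: "'a set" by (simp add: card_mono)
  then have "reached (?c i) \<alpha> (?c (i + 2 * ?d)) = UNIV"
    using card_reached[of ?d i \<alpha>] by (metis leD)
  then have "\<beta> \<in> reached (?c i) \<alpha> k"
    using reached_mono[OF le assms, of \<alpha>] by auto
  with le assms show ?thesis by (intro B_mat_ge_1_if_reached) auto
qed

end

section \<open>Decay of the heights\<close>

context backward_path
begin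

definition Roth_growth :: bool where
  "Roth_growth \<longleftrightarrow> (\<forall>\<epsilon>>0. \<exists>C>0. \<forall>j.
     mat_norm (B_mat \<pi> \<tau> (complete_time \<pi> \<tau> (Suc j)) (complete_time \<pi> \<tau> j))
       \<le> C * B_norm (complete_time \<pi> \<tau> j) powr \<epsilon>)"

text \<open>A growth by an arbitrarily small power over one complete path remains one over any fixed number of
  them.\<close>

lemma B_norm_complete_times_le:
  assumes "Roth_growth" "0 < \<epsilon>"
  shows "\<exists>C>0. \<forall>j. B_norm (complete_time \<pi> \<tau> (j + r)) \<le> C * B_norm (complete_time \<pi> \<tau> j) powr (1 + \<epsilon>)"
  using assms(2)
proof (induction r arbitrary: \<epsilon>)
  case 0
  have "B_norm k \<le> 1 * B_norm k powr (1 + \<epsilon>)" for k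
    using powr_mono[of 1 "1 + \<epsilon>" "B_norm k"] B_norm_ge_2[of k] 0 by simp
  then show ?case by (intro exI[of _ 1]) simp
next
  case (Suc r)
  let ?c = "complete_time \<pi> \<tau>"
  define \<delta> where "\<delta> = min 1 (\<epsilon> / 3)"
  have \<delta>: "0 < \<delta>" "\<delta> \<le> 1" "3 * \<delta> \<le> \<epsilon>" using Suc.prems by (auto simp: \<delta>_def)
  from Suc.IH[OF \<delta>(1)] obtain C where C: "C > 0" "\<And>j. B_norm (?c (j + r)) \<le> C * B_norm (?c j) powr (1 + \<delta>)"
    by blast
  from assms(1) \<delta>(1) obtain C' where C': "C' > 0"
    "\<And>j. mat_norm (B_mat \<pi> \<tau> (?c (Suc j)) (?c j)) \<le> C' * B_norm (?c j) powr \<delta>"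
    unfolding Roth_growth_def by blast
  have "B_norm (?c (j + Suc r)) \<le> (C' * C powr (1 + \<delta>)) * B_norm (?c j) powr (1 + \<epsilon>)" for j
  proof -
    let ?X = "B_norm (?c (j + r))" and ?Y = "B_norm (?c j)"
    have X: "?X \<ge> 2" "?Y \<ge> 2" by (rule B_norm_ge_2)+
    have "B_norm (?c (j + Suc r)) \<le> ?X * mat_norm (B_mat \<pi> \<tau> (?c (Suc (j + r))) (?c (j + r)))"
      using B_mat_mult[of 0 "?c (j + r)" "?c (Suc (j + r))"] complete_time_Suc(1)[of "j + r"]
        mat_norm_mult_le by (metis add_Suc_right le0 less_imp_le)
    also have "\<dots> \<le> ?X * (C' * ?X powr \<delta>)"
      using X by (intro mult_left_mono C') auto
    also have "\<dots> = C' * ?X powr (1 + \<delta>)" using X by (simp add: powr_add)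
    also have "\<dots> \<le> C' * (C * ?Y powr (1 + \<delta>)) powr (1 + \<delta>)"
      using X C' C \<delta> by (intro mult_left_mono powr_mono2) auto
    also have "\<dots> = C' * C powr (1 + \<delta>) * ?Y powr ((1 + \<delta>) * (1 + \<delta>))"
      using X C(1) by (simp add: powr_mult powr_powr)
    also have "\<dots> \<le> C' * C powr (1 + \<delta>) * ?Y powr (1 + \<epsilon>)"
    proof (intro mult_left_mono powr_mono)
      have "\<delta> * \<delta> \<le> \<delta>" using \<delta> by (simp add: mult_left_le)
      moreover have "(1 + \<delta>) * (1 + \<delta>) = 1 + 2 * \<delta> + \<delta> * \<delta>" by (simp add: algebra_simps)
      ultimately show "(1 + \<delta>) * (1 + \<delta>) \<le> 1 + \<epsilon>" using \<delta>(3) by linarith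
    qed (use X C' in auto)
    finally show ?thesis .
  qed
  then show ?case using C(1) C'(1) by (intro exI[of _ "C' * C powr (1 + \<delta>)"]) auto
qed

lemma height_le_total: "height k \<beta> \<le> (\<Sum>\<alpha>\<in>UNIV. height 0 \<alpha>)"
proof -
  have "1 * height k \<beta> \<le> B_mat \<pi> \<tau> k 0 $ \<beta> $ \<beta> * height k \<beta>"
    using B_mat_ge_1_if_reached[OF le0 reached_self[OF le0]] heights_seq_pos[of k \<beta>]
    by (intro mult_right_mono) auto
  also have "\<dots> \<le> height 0 \<beta>"
    unfolding compatible_B_mat[OF compatible_heights le0, of \<beta> k]
    by (intro member_le_sum) (auto simp: B_mat_nonneg less_imp_le[OF heights_seq_pos])
  also have "\<dots> \<le> (\<Sum>\<alpha>\<in>UNIV. height 0 \<alpha>)"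
    by (intro member_le_sum) (auto simp: less_imp_le[OF heights_seq_pos])
  finally show ?thesis by simp
qed

text \<open>Since \<open>q\<^sup>(\<^sup>0\<^sup>) = B(n,0) q\<^sup>(\<^sup>n\<^sup>)\<close> is fixed, the heights are at most of the order
  of the inverse of \<open>B(n,0)\<close> if that is balanced. A number of complete paths that does not depend on
  \<open>n\<close> provides the balance, and by the growth condition its cost is an arbitrarily small power.\<close>

lemma height_le:
  assumes "Roth_growth" "0 < \<epsilon>" "\<epsilon> < 1"
  shows "\<exists>C>0. \<forall>k \<beta>. height k \<beta> \<le> C * B_norm k powr (\<epsilon> - 1)"
proof -
  let ?c = "complete_time \<pi> \<tau>" and ?d = "CARD('a)"
  define Q where "Q = (\<Sum>\<alpha>\<in>UNIV. height 0 \<alpha>)"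
  have Q: "Q > 0" unfolding Q_def using heights_seq_pos by (intro sum_pos) auto
  obtain C where C: "C > 0" "\<And>j. B_norm (?c (j + (2 * ?d + 1))) \<le> C * B_norm (?c j) powr (1 + \<epsilon>)"
    using B_norm_complete_times_le[OF assms(1,2)] by metis
  have near: "\<exists>i. B_norm (?c i) * height k \<beta> \<le> ?d * Q \<and> B_norm k \<le> B_norm (?c (i + (2 * ?d + 1)))" for k \<beta>
  proof -
    have unbounded: "n \<le> ?c n" for n
      by (rule strict_mono_imp_increasing) (auto intro: strict_monoI_Suc complete_time_Suc simp del: complete_time.simps)
    define j where "j = (LEAST j. k < ?c (Suc j))"
    have "k < ?c (Suc k)" using unbounded[of "Suc k"] by simp
    then have j: "k < ?c (Suc j)" unfolding j_def by (rule LeastI)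
    have cj: "?c j \<le> k"
    proof (cases j)
      case (Suc j')
      then have "\<not> k < ?c (Suc j')" using not_less_Least[of j' "\<lambda>j. k < ?c (Suc j)"] by (simp add: j_def)
      then show ?thesis unfolding Suc by simp
    qed simp
    \<comment> \<open>If fewer than \<open>2 * ?d\<close> complete paths fit, truncated subtraction gives level \<open>0\<close>, where the norm is
      \<open>?d\<close> and the bound is trivial.\<close>
    define i where "i = j - 2 * ?d"
    have "B_norm k \<le> B_norm (?c (i + (2 * ?d + 1)))"
    proof (rule B_norm_mono)
      have "?c (Suc j) \<le> ?c (i + (2 * ?d + 1))" by (rule complete_time_mono) (simp add: i_def)
      with j show "k \<le> ?c (i + (2 * ?d + 1))" by simp
    qed
    moreover have "B_norm (?c i) * height k \<beta> \<le> ?d * Q"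
    proof (cases "j < 2 * ?d")
      case True
      then show ?thesis using height_le_total[of k \<beta>] by (simp add: i_def B_norm_0 Q_def)
    next
      case False
      then have ge: "?c (i + 2 * ?d) \<le> k" using cj by (simp add: i_def)
      have "?c i \<le> ?c (i + 2 * ?d)" by (rule complete_time_mono) simp
      with ge have le: "?c i \<le> k" by simp
      have hk: "height k \<beta> \<le> height (?c i) \<gamma>" for \<gamma>
      proof -
        have "1 * height k \<beta> \<le> B_mat \<pi> \<tau> k (?c i) $ \<gamma> $ \<beta> * height k \<beta>"
          using B_mat_ge_1[OF ge] heights_seq_pos[of k \<beta>] by (intro mult_right_mono) auto
        also have "\<dots> \<le> height (?c i) \<gamma>"
          unfolding compatible_B_mat[OF compatible_heights le, of \<gamma>]
          by (intro member_le_sum) (auto simp: B_mat_nonneg le less_imp_le[OF heights_seq_pos])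
        finally show ?thesis by simp
      qed
      have "B_norm (?c i) * height k \<beta> = (\<Sum>\<alpha>\<in>UNIV. \<Sum>\<gamma>\<in>UNIV. B_mat \<pi> \<tau> (?c i) 0 $ \<alpha> $ \<gamma> * height k \<beta>)"
        by (simp add: mat_norm_B_mat sum_distrib_right)
      also have "\<dots> \<le> (\<Sum>\<alpha>\<in>UNIV. \<Sum>\<gamma>\<in>UNIV. B_mat \<pi> \<tau> (?c i) 0 $ \<alpha> $ \<gamma> * height (?c i) \<gamma>)"
        by (intro sum_mono mult_left_mono hk B_mat_nonneg) auto
      also have "\<dots> = Q"
        unfolding Q_def using compatible_B_mat[OF compatible_heights le0, of _ "?c i"] by simp
      also have "\<dots> \<le> ?d * Q" using Q card_ge_2 by simp
      finally show ?thesis .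
    qed
    ultimately show ?thesis by blast
  qed
  have "height k \<beta> \<le> (C powr (1 - \<epsilon>) * (?d * Q)) * B_norm k powr (\<epsilon> - 1)" for k \<beta>
  proof -
    obtain i where i: "B_norm (?c i) * height k \<beta> \<le> ?d * Q" "B_norm k \<le> B_norm (?c (i + (2 * ?d + 1)))"
      using near by blast
    let ?X = "B_norm (?c i)" and ?Y = "B_norm k"
    have X: "?X \<ge> 2" "?Y \<ge> 2" by (rule B_norm_ge_2)+
    have "?Y powr (1 - \<epsilon>) \<le> (C * ?X powr (1 + \<epsilon>)) powr (1 - \<epsilon>)"
      using i(2) C(2)[of i] X assms by (intro powr_mono2) auto
    also have "\<dots> = C powr (1 - \<epsilon>) * ?X powr ((1 + \<epsilon>) * (1 - \<epsilon>))"
      using C(1) X by (simp add: powr_mult powr_powr)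
    also have "\<dots> \<le> C powr (1 - \<epsilon>) * ?X powr 1"
    proof (intro mult_left_mono powr_mono)
      have "(1 + \<epsilon>) * (1 - \<epsilon>) = 1 - \<epsilon> * \<epsilon>" by (simp add: algebra_simps)
      then show "(1 + \<epsilon>) * (1 - \<epsilon>) \<le> 1" using assms(2) by simp
    qed (use X in auto)
    finally have "?Y powr (1 - \<epsilon>) \<le> C powr (1 - \<epsilon>) * ?X" using X by simp
    then have "height k \<beta> * ?Y powr (1 - \<epsilon>) \<le> height k \<beta> * (C powr (1 - \<epsilon>) * ?X)"
      using heights_seq_pos[of k \<beta>] by (intro mult_left_mono) auto
    also have "\<dots> = C powr (1 - \<epsilon>) * (?X * height k \<beta>)" by (simp only: mult_ac)
    also have "\<dots> \<le> C powr (1 - \<epsilon>) * (?d * Q)"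
      using i(1) by (intro mult_left_mono) auto
    finally have "height k \<beta> * ?Y powr (1 - \<epsilon>) \<le> C powr (1 - \<epsilon>) * (?d * Q)" .
    then have "height k \<beta> \<le> C powr (1 - \<epsilon>) * (?d * Q) / ?Y powr (1 - \<epsilon>)"
      using X by (simp add: pos_le_divide_eq)
    also have "\<dots> = C powr (1 - \<epsilon>) * (?d * Q) * ?Y powr (\<epsilon> - 1)"
      using powr_minus_divide[of ?Y "1 - \<epsilon>"] by simp
    finally show ?thesis .
  qed
  then show ?thesis using C(1) Q by (intro exI[of _ "C powr (1 - \<epsilon>) * (?d * Q)"]) auto
qed


section \<open>Equidistribution of the letters\<close>

lemma transpose_mult_nth: "(transpose A *v x) $ \<beta> = (\<Sum>\<alpha>\<in>UNIV. A $ \<alpha> $ \<beta> * x $ \<alpha>)" for A :: "real ^ 'n ^ 'm"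
  by (simp add: matrix_vector_mult_def transpose_def)

text \<open>The share of the letter \<open>a\<close> of level \<open>k\<close> in the rectangle \<open>\<beta>\<close> of level \<open>m\<close>, compared with
  its share in the rectangle \<open>\<alpha>\<close> of level \<open>0\<close>, is \<open>q\<^sub>a\<close> times the \<open>a\<close>-entry of \<open>\<^sup>tB(- k, 0) u\<close> for a vector \<open>u\<close>
  orthogonal to \<open>q\<^sup>(\<^sup>0\<^sup>)\<close>: transport the unit vector of \<open>\<beta>\<close> from level \<open>m\<close> to level \<open>0\<close> by
  the inverse of \<open>\<^sup>tB(- m, 0)\<close> and subtract a multiple of the unit vector of \<open>\<alpha>\<close>. On such vectors
  \<open>\<^sup>tB(- k, 0)\<close> is smaller than its norm by a power.\<close>

lemma letter_share_le:
  assumes C1: "C\<^sub>1 > 0"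
    and contr: "\<And>k. restricted_norm (transpose (B_mat \<pi> \<tau> k 0)) {v. (\<Sum>\<alpha>\<in>UNIV. heights \<pi> \<tau> $ \<alpha> * v $ \<alpha>) = 0}
          \<le> C\<^sub>1 * mat_norm (transpose (B_mat \<pi> \<tau> k 0)) powr (1 - \<theta>)"
  shows "\<exists>C>0. \<forall>m k \<beta> a. m \<le> k \<longrightarrow>
    \<bar>B_mat \<pi> \<tau> k m $ \<beta> $ a * height k a - B_mat \<pi> \<tau> k 0 $ \<alpha> $ a * height k a / height 0 \<alpha> * height m \<beta>\<bar>
      \<le> C * B_norm m ^ CARD('a) * B_norm k powr (1 - \<theta>) * height k a"
proof -
  let ?d = "CARD('a)"
  define Q where "Q = (\<Sum>\<alpha>\<in>UNIV. height 0 \<alpha>)"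
  define D where "D = real ?d * fact ?d + Q / height 0 \<alpha>"
  have Q: "Q > 0" unfolding Q_def using heights_seq_pos by (intro sum_pos) auto
  have D: "D > 0" unfolding D_def using Q heights_seq_pos[of 0 \<alpha>] by (intro add_nonneg_pos) auto
  have "\<bar>B_mat \<pi> \<tau> k m $ \<beta> $ a * height k a - B_mat \<pi> \<tau> k 0 $ \<alpha> $ a * height k a / height 0 \<alpha> * height m \<beta>\<bar>
      \<le> (C\<^sub>1 * D) * B_norm m ^ ?d * B_norm k powr (1 - \<theta>) * height k a" if "m \<le> k" for m k \<beta> a
  proof -
    have m1: "1 \<le> B_norm m" using B_norm_ge_2[of m] by simp
    obtain x where x: "transpose (B_mat \<pi> \<tau> m 0) *v x = axis \<beta> 1"
      "\<And>\<gamma>. \<bar>x $ \<gamma>\<bar> \<le> fact ?d * B_norm m ^ ?d"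
    proof (rule unimodular_solution)
      show "det (transpose (B_mat \<pi> \<tau> m 0)) = 1" by (simp add: det_transpose det_B_mat)
      show "\<bar>transpose (B_mat \<pi> \<tau> m 0) $ i $ j\<bar> \<le> B_norm m" for i j
        by (simp add: transpose_def entry_le_mat_norm)
    qed (use m1 in auto)
    define \<rho> where "\<rho> = height m \<beta> / height 0 \<alpha>"
    have \<rho>: "0 \<le> \<rho>" "\<rho> \<le> Q / height 0 \<alpha>"
      using height_le_total[of m \<beta>] heights_seq_pos[of 0 \<alpha>] heights_seq_pos[of m \<beta>]
      by (auto simp: \<rho>_def Q_def intro!: divide_right_mono)
    define u where "u = x - \<rho> *\<^sub>R axis \<alpha> 1"
    have "(\<Sum>\<gamma>\<in>UNIV. height 0 \<gamma> * x $ \<gamma>) = (\<Sum>\<gamma>\<in>UNIV. \<Sum>\<delta>\<in>UNIV. B_mat \<pi> \<tau> m 0 $ \<gamma> $ \<delta> * height m \<delta> * x $ \<gamma>)"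
      unfolding compatible_B_mat[OF compatible_heights le0, of _ m] by (simp add: sum_distrib_right)
    also have "\<dots> = (\<Sum>\<delta>\<in>UNIV. height m \<delta> * (transpose (B_mat \<pi> \<tau> m 0) *v x) $ \<delta>)"
      unfolding transpose_mult_nth by (subst sum.swap) (simp add: sum_distrib_left mult_ac)
    also have "\<dots> = height m \<beta>"
      unfolding x(1) by (simp add: axis_def if_distrib[of "\<lambda>x. _ * x"] cong: if_cong)
    finally have ortho: "(\<Sum>\<gamma>\<in>UNIV. heights \<pi> \<tau> $ \<gamma> * u $ \<gamma>) = 0"
      using heights_seq_pos[of 0 \<alpha>]
      by (simp add: u_def right_diff_distrib sum_subtractf \<rho>_def axis_def if_distrib[of "\<lambda>x. _ * x"]
          flip: heights_seq_0 cong: if_cong)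
    have "(transpose (B_mat \<pi> \<tau> k 0) *v x) = transpose (B_mat \<pi> \<tau> k m) *v axis \<beta> 1"
      unfolding B_mat_mult[OF le0 that] matrix_transpose_mul matrix_vector_mul_assoc[symmetric] x(1) ..
    moreover have "(transpose A *v axis \<gamma> 1) $ a = A $ \<gamma> $ a" for A :: "real ^ 'a ^ 'a" and \<gamma>
      unfolding transpose_mult_nth by (simp add: axis_def if_distrib[of "\<lambda>x. _ * x"] cong: if_cong)
    ultimately have "(transpose (B_mat \<pi> \<tau> k 0) *v u) $ a = B_mat \<pi> \<tau> k m $ \<beta> $ a - \<rho> * B_mat \<pi> \<tau> k 0 $ \<alpha> $ a"
      unfolding u_def by (simp only: matrix_vector_mult_diff_distrib matrix_vector_mult_scaleR
          vector_minus_component vector_scaleR_component real_scaleR_def)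
    then have "B_mat \<pi> \<tau> k m $ \<beta> $ a * height k a - B_mat \<pi> \<tau> k 0 $ \<alpha> $ a * height k a / height 0 \<alpha> * height m \<beta>
        = (transpose (B_mat \<pi> \<tau> k 0) *v u) $ a * height k a"
      by (simp only: \<rho>_def) (simp add: algebra_simps)
    then have "\<bar>B_mat \<pi> \<tau> k m $ \<beta> $ a * height k a - B_mat \<pi> \<tau> k 0 $ \<alpha> $ a * height k a / height 0 \<alpha> * height m \<beta>\<bar>
        = \<bar>(transpose (B_mat \<pi> \<tau> k 0) *v u) $ a\<bar> * height k a"
      by (simp only: abs_mult abs_of_pos[OF heights_seq_pos])
    also have "\<dots> \<le> (C\<^sub>1 * B_norm k powr (1 - \<theta>) * (D * B_norm m ^ ?d)) * height k a"
    proof (rule mult_right_mono)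
      have "\<bar>(transpose (B_mat \<pi> \<tau> k 0) *v u) $ a\<bar> \<le> norm (transpose (B_mat \<pi> \<tau> k 0) *v u)"
        by (rule component_le_norm_cart)
      also have "\<dots> \<le> restricted_norm (transpose (B_mat \<pi> \<tau> k 0)) {v. (\<Sum>\<alpha>\<in>UNIV. heights \<pi> \<tau> $ \<alpha> * v $ \<alpha>) = 0} * norm u"
        using ortho by (intro restricted_norm_le) (auto simp: mult.left_commute simp flip: sum_distrib_left)
      also have "\<dots> \<le> (C\<^sub>1 * B_norm k powr (1 - \<theta>)) * norm u"
        using contr[of k] unfolding mat_norm_transpose by (intro mult_right_mono) auto
      also have "norm u \<le> D * B_norm m ^ ?d"
      proof -
        have "norm x \<le> (\<Sum>\<gamma>\<in>UNIV. \<bar>x $ \<gamma>\<bar>)" by (rule norm_le_l1_cart)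
        also have "\<dots> \<le> (\<Sum>\<gamma>\<in>(UNIV :: 'a set). fact ?d * B_norm m ^ ?d)" by (intro sum_mono x(2))
        finally have "norm x \<le> real ?d * fact ?d * B_norm m ^ ?d" by (simp add: mult.assoc)
        moreover have "norm u \<le> norm x + \<rho>"
          unfolding u_def using norm_triangle_ineq4[of x "\<rho> *\<^sub>R axis \<alpha> 1"] \<rho> by (simp add: norm_axis_1)
        moreover have "\<rho> \<le> Q / height 0 \<alpha> * B_norm m ^ ?d"
          using \<rho> mult_left_mono[OF one_le_power[OF m1, of ?d], of "Q / height 0 \<alpha>"] by auto
        ultimately show ?thesis by (simp add: D_def distrib_right)
      qed
      finally show "\<bar>(transpose (B_mat \<pi> \<tau> k 0) *v u) $ a\<bar> \<le> C\<^sub>1 * B_norm k powr (1 - \<theta>) * (D * B_norm m ^ ?d)"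
        using C1 by (simp add: mult_left_mono)
    qed (use heights_seq_pos[of k a] in auto)
    also have "\<dots> = (C\<^sub>1 * D) * B_norm m ^ ?d * B_norm k powr (1 - \<theta>) * height k a"
      by (simp only: mult_ac)
    finally show ?thesis .
  qed
  then show ?thesis using C1 D by (intro exI[of _ "C\<^sub>1 * D"]) auto
qed


section \<open>Convergence\<close>

lemma B_norm_at_top:
  assumes "summable (\<lambda>k. B_norm (Suc k) powr - 1)"
  shows "filterlim B_norm at_top sequentially"
proof -
  have "(\<lambda>k. inverse (B_norm (Suc k))) \<longlonglongrightarrow> 0"
    using summable_LIMSEQ_zero[OF assms] B_norm_ge_2 by (simp add: powr_minus mat_norm_nonneg)
  then have "filterlim (\<lambda>k. inverse (inverse (B_norm (Suc k)))) at_top sequentially"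
    using B_norm_ge_2 by (intro filterlim_inverse_at_top always_eventually)
      (auto intro!: less_le_trans[OF _ B_norm_ge_2])
  then have "filterlim (\<lambda>k. B_norm (Suc k)) at_top sequentially" by simp
  then show ?thesis by (rule filterlim_sequentially_Suc[THEN iffD1])
qed

text \<open>Each arrow at most doubles the norm, so the norms do not skip any scale.\<close>

lemma intermediate_level:
  assumes "CARD('a) \<le> B_norm k powr \<kappa>" "\<kappa> \<le> 1"
  shows "\<exists>m\<le>k. B_norm m \<le> B_norm k powr \<kappa> \<and> B_norm k powr \<kappa> \<le> 2 * B_norm m"
proof -
  define m where "m = Max {i. i \<le> k \<and> B_norm i \<le> B_norm k powr \<kappa>}"
  have fin: "finite {i. i \<le> k \<and> B_norm i \<le> B_norm k powr \<kappa>}" by simp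
  have "0 \<in> {i. i \<le> k \<and> B_norm i \<le> B_norm k powr \<kappa>}" using assms by (simp add: B_norm_0)
  then have m: "m \<le> k" "B_norm m \<le> B_norm k powr \<kappa>"
    using Max_in[OF fin] unfolding m_def by blast+
  have "B_norm k powr \<kappa> \<le> 2 * B_norm m"
  proof (cases "m = k")
    case True
    then show ?thesis using powr_mono[OF assms(2), of "B_norm k"] B_norm_ge_2[of k] by simp
  next
    case False
    have "\<not> (Suc m \<le> k \<and> B_norm (Suc m) \<le> B_norm k powr \<kappa>)"
      using Max_ge[OF fin, of "Suc m"] by (auto simp flip: m_def)
    then show ?thesis using False m(1) B_norm_Suc_le[of m] by auto
  qed
  with m show ?thesis by blast
qed

lemma chi_vec_0: "chi_vec \<pi> \<tau> \<Upsilon> 0 = \<Upsilon>"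
  by (simp add: vec_eq_iff chi_vec_def intersection_def axis_def if_distrib[of real_of_int] if_distrib[of "\<lambda>x. _ * x"] cong: if_cong)

text \<open>A class with \<open>\<chi>\<^sup>(\<^sup>0\<^sup>) = 0\<close> or \<open>\<chi>\<^sup>(\<^sup>n\<^sup>) = 0\<close> gives the default value \<open>0\<close> to the quotient of
  logarithms; there the bound is immediate.\<close>

lemma subpolynomial_growth_le:
  assumes "subpolynomial_growth_past \<pi> \<tau> \<Upsilon>" "\<epsilon> > 0"
  shows "\<forall>\<^sub>F k in sequentially. norm (chi_vec \<pi> \<tau> \<Upsilon> k) \<le> norm \<Upsilon> * B_norm k powr \<epsilon>"
proof (cases "\<Upsilon> = 0")
  case True
  have "chi_vec \<pi> \<tau> 0 k = 0" for k by (simp add: vec_eq_iff chi_vec_def intersection_def)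
  with True show ?thesis by simp
next
  case False
  have "\<forall>\<^sub>F k in sequentially. ereal (ln (norm (chi_vec \<pi> \<tau> \<Upsilon> k) / norm (chi_vec \<pi> \<tau> \<Upsilon> 0)) / ln (B_norm k)) < ereal \<epsilon>"
    using assms by (intro Limsup_lessD) (auto simp: subpolynomial_growth_past_def)
  then show ?thesis
  proof eventually_elim
    case (elim k)
    have B: "B_norm k > 1" using B_norm_ge_2[of k] by simp
    show ?case
    proof (cases "chi_vec \<pi> \<tau> \<Upsilon> k = 0")
      case False
      with \<open>\<Upsilon> \<noteq> 0\<close> have pos: "norm (chi_vec \<pi> \<tau> \<Upsilon> k) / norm \<Upsilon> > 0" by simp
      have "ln (norm (chi_vec \<pi> \<tau> \<Upsilon> k) / norm \<Upsilon>) < \<epsilon> * ln (B_norm k)"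
        using elim B by (simp add: divide_less_eq chi_vec_0)
      then have "norm (chi_vec \<pi> \<tau> \<Upsilon> k) / norm \<Upsilon> \<le> exp (\<epsilon> * ln (B_norm k))"
        using pos by (metis exp_le_cancel_iff exp_ln less_imp_le)
      then show ?thesis using B \<open>\<Upsilon> \<noteq> 0\<close> by (simp add: powr_def divide_le_eq mult.commute)
    qed simp
  qed
qed

end

lemma continuous_on_if_hoelder:
  fixes u :: "real \<Rightarrow> real"
  assumes "0 < \<eta>" and hoelder: "\<And>x y. x \<in> S \<Longrightarrow> y \<in> S \<Longrightarrow> \<bar>u x - u y\<bar> \<le> H * \<bar>x - y\<bar> powr \<eta>"
  shows "continuous_on S u"
  unfolding continuous_on_def
proof
  fix x assume x: "x \<in> S"
  have "((\<lambda>y. \<bar>y - x\<bar>) \<longlongrightarrow> \<bar>x - x\<bar>) (at x within S)" by (intro tendsto_intros)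
  then have "((\<lambda>y. \<bar>y - x\<bar> powr \<eta>) \<longlongrightarrow> 0) (at x within S)"
    using assms(1) by (intro tendsto_zero_powrI[where b = \<eta>]) auto
  then have "((\<lambda>y. H * \<bar>y - x\<bar> powr \<eta>) \<longlongrightarrow> 0) (at x within S)"
    by (rule tendsto_mult_right_zero)
  then have "((\<lambda>y. u y - u x) \<longlongrightarrow> 0) (at x within S)"
    by (rule Lim_null_comparison[rotated]) (auto simp: eventually_at_filter hoelder x)
  then show "(u \<longlongrightarrow> u x) (at x within S)" by (rule LIM_zero_cancel)
qed

context backward_path
begin

text \<open>The piece estimate with a choice of the intermediate level for which all its terms are powers of
  \<open>B_norm k\<close>: the oscillation of \<open>\<psi>\<close> on a piece gains \<open>\<kappa> \<eta> / 2\<close>, the equidistribution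
  gains \<open>\<theta>' / 2\<close>, and the growth of the class loses half of the smaller one.\<close>

lemma Omega_step_eventually_le:
  fixes \<psi> :: "real \<Rightarrow> real"
  assumes l: "\<And>\<alpha>. l $ \<alpha> > 0" and Roth: "Roth_growth"
    and C1: "C\<^sub>1 > 0" "\<theta> > 0"
    and contr: "\<And>k. restricted_norm (transpose (B_mat \<pi> \<tau> k 0)) {v. (\<Sum>\<alpha>\<in>UNIV. heights \<pi> \<tau> $ \<alpha> * v $ \<alpha>) = 0}
          \<le> C\<^sub>1 * mat_norm (transpose (B_mat \<pi> \<tau> k 0)) powr (1 - \<theta>)"
    and sum: "summable (\<lambda>k. B_norm (Suc k) powr - 1)"
    and sub: "subpolynomial_growth_past \<pi> \<tau> \<Upsilon>"
    and b: "b = heights \<pi> \<tau> $ \<alpha>" and \<eta>: "0 < \<eta>" "0 \<le> H"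
    and hoelder: "\<And>x y. x \<in> {0..b} \<Longrightarrow> y \<in> {0..b} \<Longrightarrow> \<bar>\<psi> x - \<psi> y\<bar> \<le> H * \<bar>x - y\<bar> powr \<eta>"
    and zero: "integral {0..b} \<psi> = 0"
  shows "\<exists>s>0. \<exists>C. \<forall>\<^sub>F k in sequentially.
     \<bar>integral {0..b} (\<lambda>x. \<psi> x * Omega_fun \<pi> l \<tau> \<Upsilon> (Suc k) \<alpha> x)
       - integral {0..b} (\<lambda>x. \<psi> x * Omega_fun \<pi> l \<tau> \<Upsilon> k \<alpha> x)\<bar> \<le> C * B_norm k powr (- s)"
proof -
  let ?d = "CARD('a)"
  have cont: "continuous_on {0..b} \<psi>" by (rule continuous_on_if_hoelder[OF \<eta>(1) hoelder])
  then have "bounded (\<psi> ` {0..b})" by (intro compact_imp_bounded compact_continuous_image) auto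
  then obtain M where M: "M > 0" "\<And>x. x \<in> {0..b} \<Longrightarrow> \<bar>\<psi> x\<bar> \<le> M" by (auto simp: bounded_pos)
  have b0: "b > 0" using heights_seq_pos[of 0 \<alpha>] by (simp add: b heights_seq_0)
  \<comment> \<open>The level \<open>m\<close> is chosen with norm about \<open>B_norm k powr \<kappa>\<close>, where \<open>\<kappa>\<close> is so small that the
    losses from the inversion up to level \<open>m\<close> and from the number of pieces do not spoil the gain
    \<open>\<theta>\<close>.\<close>
  define \<theta>' where "\<theta>' = min \<theta> 1"
  define \<kappa> where "\<kappa> = \<theta>' / (4 * (real ?d + 1))"
  define s where "s = min (\<kappa> * \<eta> / 2) (\<theta>' / 2)"
  have \<theta>': "0 < \<theta>'" "\<theta>' \<le> \<theta>" "\<theta>' \<le> 1" using C1 by (auto simp: \<theta>'_def)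
  have "\<theta>' / (4 * D) * D = \<theta>' / 4" if "D > 0" for D using that by simp
  then have \<kappa>: "0 < \<kappa>" "\<kappa> * (real ?d + 1) = \<theta>' / 4"
    using \<theta>' by (auto simp: \<kappa>_def simp del: distrib_left_numeral)
  have "\<kappa> * 1 \<le> \<kappa> * (real ?d + 1)" using \<kappa>(1) by (intro mult_left_mono) auto
  then have \<kappa>1: "\<kappa> \<le> 1" using \<kappa>(2) \<theta>' by linarith
  have s: "0 < s" "s \<le> \<kappa> * \<eta> / 2" "s \<le> \<theta>' / 2" using \<kappa>(1) \<eta> \<theta>' by (auto simp: s_def)
  obtain C2 where C2: "C2 > 0" "\<And>k \<beta>. height k \<beta> \<le> C2 * B_norm k powr (1 / 2 - 1)"
    using height_le[OF Roth, of "1 / 2"] by auto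
  obtain C4 where C4: "C4 > 0" "\<And>k \<beta>. height k \<beta> \<le> C4 * B_norm k powr (\<theta>' / 4 - 1)"
    using height_le[OF Roth, of "\<theta>' / 4"] \<theta>' by auto
  obtain C3 where C3: "C3 > 0" "\<And>m k \<beta> a. m \<le> k \<Longrightarrow>
    \<bar>B_mat \<pi> \<tau> k m $ \<beta> $ a * height k a - B_mat \<pi> \<tau> k 0 $ \<alpha> $ a * height k a / height 0 \<alpha> * height m \<beta>\<bar>
      \<le> C3 * B_norm m ^ ?d * B_norm k powr (1 - \<theta>) * height k a"
    using letter_share_le[OF C1(1) contr, of \<alpha>] by auto
  define K0 where "K0 = 4 * (norm \<Upsilon> * 2 powr (s / 2))"
  define K1 where "K1 = C2 powr \<eta> * 2 powr (\<eta> / 2)"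
  have K: "0 \<le> K0" "0 \<le> K1" by (simp_all add: K0_def K1_def)
  have top: "filterlim B_norm at_top sequentially" by (rule B_norm_at_top[OF sum])
  have "\<forall>\<^sub>F k in sequentially. norm (chi_vec \<pi> \<tau> \<Upsilon> (Suc k)) \<le> norm \<Upsilon> * B_norm (Suc k) powr (s / 2)"
    using subpolynomial_growth_le[OF sub, of "s / 2"] s(1)
      eventually_sequentially_Suc[of "\<lambda>k. norm (chi_vec \<pi> \<tau> \<Upsilon> k) \<le> norm \<Upsilon> * B_norm k powr (s / 2)"]
    by simp
  moreover have "\<forall>\<^sub>F k in sequentially. real ?d powr (1 / \<kappa>) \<le> B_norm k"
    using top by (simp add: filterlim_at_top)
  ultimately have "\<forall>\<^sub>F k in sequentially.
     \<bar>integral {0..b} (\<lambda>x. \<psi> x * Omega_fun \<pi> l \<tau> \<Upsilon> (Suc k) \<alpha> x)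
       - integral {0..b} (\<lambda>x. \<psi> x * Omega_fun \<pi> l \<tau> \<Upsilon> k \<alpha> x)\<bar>
     \<le> K0 * (2 * H * K1 * b + M * (C3 * C4)) * B_norm k powr (- (s / 2))"
  proof eventually_elim
    case (elim k)
    define X where "X = B_norm k"
    have X: "X \<ge> 2" unfolding X_def by (rule B_norm_ge_2)
    have "(real ?d powr (1 / \<kappa>)) powr \<kappa> \<le> X powr \<kappa>"
      using elim(2) \<kappa>(1) unfolding X_def by (intro powr_mono2) auto
    then have "real ?d \<le> X powr \<kappa>" using \<kappa>(1) by (simp add: powr_powr)
    then obtain m where m: "m \<le> k" "B_norm m \<le> X powr \<kappa>" "X powr \<kappa> \<le> 2 * B_norm m"
      using intermediate_level[of k \<kappa>] \<kappa>1 by (auto simp: X_def)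
    define Y where "Y = B_norm m"
    have Y: "Y \<ge> 2" "Y \<le> X powr \<kappa>" "X powr \<kappa> \<le> 2 * Y"
      using m B_norm_ge_2[of m] by (simp_all add: Y_def)
    define a where "a = lose \<pi> \<tau> k"
    define \<delta> where "\<delta> = C2 * Y powr (1 / 2 - 1)"
    define e where "e = C3 * Y ^ ?d * X powr (1 - \<theta>') * (C4 * X powr (\<theta>' / 4 - 1))"
    define h where "h = 4 * norm (chi_vec \<pi> \<tau> \<Upsilon> (Suc k))"
    have h_le: "h \<le> K0 * X powr (s / 2)"
    proof -
      have "B_norm (Suc k) powr (s / 2) \<le> (2 * X) powr (s / 2)"
        using B_norm_Suc_le[of k] s(1) by (intro powr_mono2) (auto simp: X_def mat_norm_nonneg)
      also have "\<dots> = 2 powr (s / 2) * X powr (s / 2)" using X by (simp add: powr_mult)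
      finally have "norm (chi_vec \<pi> \<tau> \<Upsilon> (Suc k)) \<le> norm \<Upsilon> * (2 powr (s / 2) * X powr (s / 2))"
        using elim(1) by (meson mult_left_mono norm_ge_zero order_trans)
      then show ?thesis by (simp add: h_def K0_def mult_ac)
    qed
    have delta_le: "\<delta> powr \<eta> \<le> K1 * X powr (- s)"
    proof -
      have "X powr \<kappa> / 2 > 0" using X by simp
      then have "Y powr (- (\<eta> / 2)) \<le> (X powr \<kappa> / 2) powr (- (\<eta> / 2))"
        using Y \<eta> by (intro powr_mono2') auto
      also have "\<dots> = 2 powr (\<eta> / 2) * X powr (- (\<kappa> * \<eta> / 2))"
        using X by (simp add: powr_divide powr_powr powr_minus_divide[of 2] divide_simps)
      also have "X powr (- (\<kappa> * \<eta> / 2)) \<le> X powr (- s)"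
        using X s by (intro powr_mono) auto
      finally have "Y powr (- (\<eta> / 2)) \<le> 2 powr (\<eta> / 2) * X powr (- s)" by simp
      moreover have "\<delta> powr \<eta> = C2 powr \<eta> * Y powr (- (\<eta> / 2))"
        using C2(1) Y by (simp add: \<delta>_def powr_mult powr_powr)
      ultimately show ?thesis
        by (simp add: K1_def mult.assoc mult_left_mono)
    qed
    have e_le: "M * e * length (descend 0 m \<alpha>) \<le> M * (C3 * C4 * X powr (- s))"
    proof -
      have Yd: "Y ^ ?d * Y \<le> X powr (\<theta>' / 4)"
      proof -
        have "Y ^ ?d * Y = Y powr (real ?d + 1)" using Y by (simp add: powr_add powr_realpow)
        also have "\<dots> \<le> (X powr \<kappa>) powr (real ?d + 1)" using Y by (intro powr_mono2) auto
        also have "\<dots> = X powr (\<theta>' / 4)" by (simp only: powr_powr \<kappa>(2))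
        finally show ?thesis .
      qed
      have "e * length (descend 0 m \<alpha>) \<le> e * Y"
        unfolding Y_def using C3(1) C4(1) Y X length_descend_le[of m \<alpha>]
        by (intro mult_left_mono) (auto simp: e_def)
      also have "e * Y = (C3 * C4 * (X powr (1 - \<theta>') * X powr (\<theta>' / 4 - 1))) * (Y ^ ?d * Y)"
        by (simp add: e_def mult_ac)
      also have "\<dots> \<le> (C3 * C4 * (X powr (1 - \<theta>') * X powr (\<theta>' / 4 - 1))) * X powr (\<theta>' / 4)"
        using C3(1) C4(1) by (intro mult_left_mono Yd) auto
      also have "\<dots> = C3 * C4 * X powr (- (\<theta>' / 2))"
        using X by (simp add: mult.assoc flip: powr_add)
      also have "\<dots> \<le> C3 * C4 * X powr (- s)"
        using X C3(1) C4(1) s by (intro mult_left_mono powr_mono) auto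
      finally have "e * length (descend 0 m \<alpha>) \<le> C3 * C4 * X powr (- s)" .
      then show ?thesis
        using M(1) by (simp add: mult.assoc)
    qed
    have "\<bar>integral {0..b} (\<lambda>x. \<psi> x * Omega_fun \<pi> l \<tau> \<Upsilon> (Suc k) \<alpha> x)
       - integral {0..b} (\<lambda>x. \<psi> x * Omega_fun \<pi> l \<tau> \<Upsilon> k \<alpha> x)\<bar>
     \<le> h * (2 * H * \<delta> powr \<eta> * b + M * e * length (descend 0 m \<alpha>))"
    proof (rule Omega_step_le[OF l m(1) _ _ a_def h_def b \<eta> cont hoelder M(2) zero])
      show "height m \<beta> \<le> \<delta>" for \<beta> unfolding \<delta>_def Y_def by (rule C2(2))
      show "\<bar>B_mat \<pi> \<tau> k m $ \<beta> $ a * height k a - B_mat \<pi> \<tau> k 0 $ \<alpha> $ a * height k a / height 0 \<alpha> * height m \<beta>\<bar> \<le> e" for \<beta>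
      proof (rule order_trans[OF C3(2)[OF m(1)]])
        have "X powr (1 - \<theta>) \<le> X powr (1 - \<theta>')" using X \<theta>' by (intro powr_mono) auto
        moreover have "height k a \<le> C4 * X powr (\<theta>' / 4 - 1)" unfolding X_def by (rule C4(2))
        ultimately show "C3 * B_norm m ^ ?d * B_norm k powr (1 - \<theta>) * height k a \<le> e"
          unfolding e_def X_def[symmetric] Y_def[symmetric] using C3(1) C4(1) X Y heights_seq_pos[of k a]
          by (intro mult_mono) (auto simp: X_def[symmetric] intro!: mult_nonneg_nonneg)
      qed
    qed
    also have "\<dots> \<le> (K0 * X powr (s / 2)) * (2 * H * (K1 * X powr (- s)) * b + M * (C3 * C4 * X powr (- s)))"
    proof (rule mult_mono[OF h_le add_mono[OF _ e_le]])
      show "2 * H * \<delta> powr \<eta> * b \<le> 2 * H * (K1 * X powr (- s)) * b"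
        using \<eta> b0 by (intro mult_right_mono mult_left_mono delta_le) auto
      show "0 \<le> K0 * X powr (s / 2)" using K by simp
      show "0 \<le> 2 * H * \<delta> powr \<eta> * b + M * e * length (descend 0 m \<alpha>)"
        using \<eta> b0 M(1) C3(1) C4(1) Y(1) by (simp add: e_def)
    qed
    also have "\<dots> = K0 * (2 * H * K1 * b + M * (C3 * C4)) * (X powr (s / 2) * X powr (- s))"
      by (simp add: algebra_simps)
    also have "X powr (s / 2) * X powr (- s) = X powr (- (s / 2))"
      by (simp flip: powr_add)
    finally show ?case unfolding X_def .
  qed
  then show ?thesis using s(1) by (intro exI[of _ "s / 2"]) auto
qed

end

theorem proposition6p13:
  fixes \<pi> :: "'a::finite rows" and l \<tau> :: "real ^ 'a"
    and \<upsilon> :: "'a rect_point set \<Rightarrow> real" and \<Upsilon> :: "'a rel_class"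
  assumes "CARD('a) \<ge> 2"
    and "irreducible_rows \<pi>"
    and "\<forall>\<alpha>. l $ \<alpha> > 0"
    and "\<tau> \<in> suspension_cone \<pi>"
    and "neg_KZ_hyperbolic \<pi> l \<tau>"
    and "dual_Roth_type \<pi> \<tau>"
    and "\<upsilon> \<in> zero_sum_on_marked \<pi> l \<tau>"
    and "boundary \<pi> l \<tau> \<Upsilon> = \<upsilon>"
    and "subpolynomial_growth_past \<pi> \<tau> \<Upsilon>"
  shows "\<forall>\<alpha>. \<forall>\<psi> :: real \<Rightarrow> real.
    (\<exists>\<eta>. 0 < \<eta> \<and> \<eta> < 1 \<and> hoelder_on {0..heights \<pi> \<tau> $ \<alpha>} \<eta> \<psi>) \<longrightarrow>
    integral {0..heights \<pi> \<tau> $ \<alpha>} \<psi> = 0 \<longrightarrow>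
    convergent (\<lambda>k. integral {0..heights \<pi> \<tau> $ \<alpha>}
      (\<lambda>x. \<psi> x * Omega_fun \<pi> l \<tau> \<Upsilon> k \<alpha> x))"
proof (intro allI impI)
  fix \<alpha> :: 'a and \<psi> :: "real \<Rightarrow> real"
  define b where "b = heights \<pi> \<tau> $ \<alpha>"
  define J where "J k = integral {0..b} (\<lambda>x. \<psi> x * Omega_fun \<pi> l \<tau> \<Upsilon> k \<alpha> x)" for k
  assume "\<exists>\<eta>. 0 < \<eta> \<and> \<eta> < 1 \<and> hoelder_on {0..heights \<pi> \<tau> $ \<alpha>} \<eta> \<psi>"
    and zero: "integral {0..heights \<pi> \<tau> $ \<alpha>} \<psi> = 0"
  then obtain \<eta> H where \<eta>: "0 < \<eta>"
    and H: "\<And>x y. x \<in> {0..b} \<Longrightarrow> y \<in> {0..b} \<Longrightarrow> \<bar>\<psi> x - \<psi> y\<bar> \<le> H * \<bar>x - y\<bar> powr \<eta>"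
    unfolding hoelder_on_def b_def by blast
  have hoelder: "\<bar>\<psi> x - \<psi> y\<bar> \<le> \<bar>H\<bar> * \<bar>x - y\<bar> powr \<eta>" if "x \<in> {0..b}" "y \<in> {0..b}" for x y
    by (rule order_trans[OF H[OF that]]) (auto intro: mult_right_mono)
  interpret backward_path \<pi> \<tau>
    using assms(1,6) suspended_if_cone[OF assms(2,4)] by unfold_locales (simp_all add: dual_Roth_type_def)
  obtain \<theta> C\<^sub>1 where C1: "\<theta> > 0" "C\<^sub>1 > 0"
    "\<And>k. restricted_norm (transpose (B_mat \<pi> \<tau> k 0)) {v. (\<Sum>\<alpha>\<in>UNIV. heights \<pi> \<tau> $ \<alpha> * v $ \<alpha>) = 0}
          \<le> C\<^sub>1 * mat_norm (transpose (B_mat \<pi> \<tau> k 0)) powr (1 - \<theta>)"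
    using assms(6) unfolding dual_Roth_type_def by blast
  have Roth: "Roth_growth"
    using assms(6) unfolding dual_Roth_type_def Roth_growth_def by blast
  have sum: "summable (\<lambda>k. B_norm (Suc k) powr - t)" if "t > 0" for t
    using assms(5) that unfolding neg_KZ_hyperbolic_def by blast
  have l: "\<And>\<alpha>. l $ \<alpha> > 0" using assms(3) by blast
  have "\<exists>s>0. \<exists>C. \<forall>\<^sub>F k in sequentially. \<bar>J (Suc k) - J k\<bar> \<le> C * B_norm k powr (- s)"
    unfolding J_def
    by (rule Omega_step_eventually_le[OF l Roth C1(2,1,3) sum[OF zero_less_one] assms(9) b_def \<eta>
          abs_ge_zero[of H] hoelder zero[folded b_def]])
  then obtain s C where s: "s > 0" "\<forall>\<^sub>F k in sequentially. \<bar>J (Suc k) - J k\<bar> \<le> C * B_norm k powr (- s)"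
    by blast
  have "summable (\<lambda>k. B_norm k powr - s)"
    using sum[OF s(1)] by (rule summable_Suc_iff[THEN iffD1])
  then have "summable (\<lambda>k. C * B_norm k powr - s)" by (rule summable_mult)
  then have "summable (\<lambda>k. J (Suc k) - J k)"
    by (rule summable_comparison_test_ev[OF s(2)[folded real_norm_def]])
  then have "(\<lambda>n. \<Sum>k<n. J (Suc k) - J k) \<longlonglongrightarrow> (\<Sum>k. J (Suc k) - J k)"
    by (rule summable_LIMSEQ)
  then have "(\<lambda>n. J n - J 0 + J 0) \<longlonglongrightarrow> (\<Sum>k. J (Suc k) - J k) + J 0"
    unfolding sum_lessThan_telescope by (intro tendsto_add tendsto_const)
  then have "convergent J" by (auto simp: convergent_def)
  then show "convergent (\<lambda>k. integral {0..heights \<pi> \<tau> $ \<alpha>} (\<lambda>x. \<psi> x * Omega_fun \<pi> l \<tau> \<Upsilon> k \<alpha> x))"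
    by (simp add: J_def[abs_def] b_def)
qed

end
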